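(* For every integer $r\ge 2$ there exists a function $\Upsilon$ analytic in the unit disk $\mathbb D$ such that: (i) $\Upsilon\in PF_r$; (ii) $\Upsilon$ is of infinite order in $\mathbb D$; (iii) $\Upsilon$ is analytically extendable to $\overline{\mathbb C}\setminus\{1\}$ and has at $z=1$ an essential singularity of infinite order.
   Context: **$PF_r$.** For $r\in\mathbb N$, a real sequence $\{a_k\}_{k=0}^\infty$ belongs to $PF_r$ if all minors of order $\le r$ of the infinite upper triangular Toeplitz matrix $(a_{j-i})_{i,j\ge 0}$ (with $a_m:=0$ for $m<0$) are non-negative. The generating function $\sum_{k\ge0}a_kz^k$ of such a sequence is also said to belong to $PF_r$. **Orders.** For $g$ analytic in $\mathbb D=\{|z|<1\}$ let $M(y,g)=\max_{|z|=y}|g(z)|$; the order of $g$ in $\mathbb D$ is $\limsup_{y\to1^-}\frac{\log\log M(y,g)}{\log(1/(1-y))}\in[0,\infty]$. For $g$ analytic in $\{0<|z-1|\le\varepsilon\}$ let $M_1(x,g)=\max_{1/x\le|z-1|\le\varepsilon}|g(z)|$, $x>1/\varepsilon$; the order of the singularity of $g$ at $z=1$ is $\limsup_{x\to\infty}\frac{\log\log M_1(x,g)}{\log x}\in[0,\infty]$. Infinite order means that the corresponding limsup equals $+\infty$. $\overline{\mathbb C}$ is the extended complex plane. *)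

theory Defs
  imports
    "HOL-Complex_Analysis.Complex_Analysis"
    "Jordan_Normal_Form.Determinant"
begin

definition toeplitz :: "(nat \<Rightarrow> real) \<Rightarrow> nat \<Rightarrow> nat \<Rightarrow> real" where
  "toeplitz a i j = (if i \<le> j then a (j - i) else 0)"

text \<open>
  The determinant is the one for matrices with numeric dimensions, not the one for
  type-indexed matrices. The only minor of order 0 is 1, so including it adds no condition.
\<close>

definition toeplitz_minor ::
    "(nat \<Rightarrow> real) \<Rightarrow> nat \<Rightarrow> (nat \<Rightarrow> nat) \<Rightarrow> (nat \<Rightarrow> nat) \<Rightarrow> real" where
  "toeplitz_minor a k I J =
     Determinant.det (Matrix.mat k k (\<lambda>(p, q). toeplitz a (I p) (J q)))"

definition PF_seq :: "nat \<Rightarrow> (nat \<Rightarrow> real) \<Rightarrow> bool" where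
  "PF_seq r a \<longleftrightarrow>
     (\<forall>k I J. k \<le> r \<and> strict_mono_on {..<k} I \<and> strict_mono_on {..<k} J
        \<longrightarrow> toeplitz_minor a k I J \<ge> 0)"

definition PF_fun :: "nat \<Rightarrow> (complex \<Rightarrow> complex) \<Rightarrow> bool" where
  "PF_fun r f \<longleftrightarrow>
     (\<exists>a. PF_seq r a \<and> (\<forall>z\<in>ball 0 1. (\<lambda>k. complex_of_real (a k) * z ^ k) sums f z))"

text \<open>
  The orders use the positive part of the logarithm. Where the maximum modulus eventually
  exceeds 1, this does not change the upper limit, because the maximum modulus is monotone.
  It gives bounded functions order 0. With plain \<^const>\<open>ln\<close>, which satisfies
  \<open>ln (- x) = ln x\<close>, the identity function would have order \<open>-1\<close> in the disk.

  The maxima over compact sets are written as suprema; they agree for continuous functions.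
\<close>

definition log_plus :: "real \<Rightarrow> real" where
  "log_plus x = ln (max 1 x)"

definition max_mod :: "real \<Rightarrow> (complex \<Rightarrow> complex) \<Rightarrow> real" where
  "max_mod y g = (SUP z\<in>sphere 0 y. norm (g z))"

definition disk_order :: "(complex \<Rightarrow> complex) \<Rightarrow> ereal" where
  "disk_order g =
     Limsup (at_left 1)
       (\<lambda>y. ereal (log_plus (log_plus (max_mod y g)) / ln (1 / (1 - y))))"

definition max_mod_at_1 :: "real \<Rightarrow> real \<Rightarrow> (complex \<Rightarrow> complex) \<Rightarrow> real" where
  "max_mod_at_1 \<epsilon> x g = (SUP z\<in>{z. 1 / x \<le> norm (z - 1) \<and> norm (z - 1) \<le> \<epsilon>}. norm (g z))"

text \<open>
  \<open>\<epsilon>\<close> is the outer radius of the punctured disk around 1 on which the function is analytic;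
  the order does not depend on its choice.
\<close>

definition order_at_1 :: "real \<Rightarrow> (complex \<Rightarrow> complex) \<Rightarrow> ereal" where
  "order_at_1 \<epsilon> g =
     Limsup at_top
       (\<lambda>x. ereal (log_plus (log_plus (max_mod_at_1 \<epsilon> x g)) / ln x))"

text \<open>
  Analyticity at the point at infinity of the Riemann sphere, in the chart \<open>w = 1 / z\<close>.
\<close>

definition analytic_at_infinity :: "(complex \<Rightarrow> complex) \<Rightarrow> bool" where
  "analytic_at_infinity f \<longleftrightarrow>
     (\<exists>h. h analytic_on {0} \<and> (\<forall>\<^sub>F w in at 0. h w = f (1 / w)))"

definition essential_singularity_at :: "(complex \<Rightarrow> complex) \<Rightarrow> complex \<Rightarrow> bool" where
  "essential_singularity_at f z \<longleftrightarrow> isolated_singularity_at f z \<and> \<not> not_essential f z"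

end

theory Submission
  imports Defs
begin

text \<open>
  The function is \<open>\<Upsilon>(z) = \<Sum>k. \<phi>(k) z^k\<close>, where \<open>\<phi>\<close> is the product of \<open>(z + 1) \<dots> (z + N)\<close> and of the
  factors \<open>(1 + z / \<lambda>\<^sub>j)^m\<^sub>j\<close> with \<open>\<lambda>\<^sub>j = M 2^(j\<^sup>2)\<close> and \<open>m\<^sub>j = 2^(j\<^sup>2 - j)\<close>. Everything is read off
  from this entire function of minimal exponential type, all of whose zeros are negative.

  Continuation. Each \<open>\<Sum>k. k^n z^k\<close> is a polynomial in \<open>w = 1 / (1 - z)\<close>, with coefficients of total
  size at most \<open>2^n n!\<close>. The Taylor coefficients of \<open>\<phi>\<close> are so small that they can be summed against
  these polynomials for every \<open>w\<close>; hence \<open>\<Upsilon>(z) = G(1 / (1 - z))\<close> with \<open>G\<close> entire, which is analytic on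
  the sphere without 1 (\<open>wigert_analytic_continuation\<close>).

  Growth. The number of zeros of \<open>\<phi>\<close> is almost linear along \<open>\<lambda>\<^sub>j\<close>, so that the coefficient with index
  \<open>\<lambda>\<^sub>j\<close> is at least \<open>2^m\<^sub>j\<close>. At \<open>1 - 1 / x\<close> with \<open>x\<close> a constant times \<open>2^j\<close> this single term
  exceeds, for large \<open>j\<close>, every \<open>exp (x^p)\<close> (\<open>growth_towards_1\<close>). Both orders are therefore infinite,
  and neither a pole nor a removable singularity at 1 is possible.

  Total positivity. By a Fekete argument it suffices that the minors \<open>T\<^sub>s(k)\<close> of the Toeplitz matrix
  with consecutive rows and columns are positive (\<open>PF_seq_if_solid_minors_pos\<close>). The
  Desnanot-Jacobi identity \<open>T\<^sub>s\<^sub>+\<^sub>1(k) T\<^sub>s\<^sub>-\<^sub>1(k) = T\<^sub>s(k)\<^sup>2 - T\<^sub>s(k - 1) T\<^sub>s(k + 1)\<close> turns this into the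
  positivity of the quotients \<open>R\<^sub>s = T\<^sub>s\<^sub>+\<^sub>1 T\<^sub>s\<^sub>-\<^sub>1 / T\<^sub>s\<^sup>2\<close>, which obey a recursion in \<open>s\<close>. In its linear
  approximation the recursion reads \<open>R\<^sub>s\<^sub>+\<^sub>1 = 2 R\<^sub>s - R\<^sub>s\<^sub>-\<^sub>1 - (log R\<^sub>s)''\<close>. Here \<open>R\<^sub>1(k)\<close> is close to
  \<open>W = \<Sum>\<lambda>. 1 / (k + \<lambda>)\<^sup>2\<close>, the sum over all zeros \<open>-\<lambda>\<close> of \<open>\<phi>\<close>, and the zeros at \<open>-1, \<dots>, -N\<close> alone
  give \<open>W \<ge> N / (4 k\<^sup>2)\<close> for \<open>k \<ge> N\<close>. All \<open>R\<^sub>s\<close> extend to complex arguments and vary little on a disc about \<open>k\<close> whose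
  radius is a small multiple of \<open>k\<close>; by Cauchy's estimate the last term is \<open>O(1 / k\<^sup>2)\<close>, and so it is
  negligible against \<open>W\<close> when \<open>N\<close> is large. Thus \<open>R\<^sub>s\<close> is close to \<open>s W\<close>, and positive, for \<open>s \<le> r\<close> and
  \<open>k \<ge> K\<close> (\<open>defect_rec_pos_far_out\<close>). For \<open>k < K\<close> one compares with \<open>(k + 1) \<dots> (k + N)\<close>, whose
  \<open>R\<^sub>s\<close> are explicit: finitely many minors have to stay positive, and the remaining zeros disturb the
  finitely many coefficients involved as little as desired if \<open>\<Sum>j. m\<^sub>j / \<lambda>\<^sub>j\<close> is small. The
  choice of \<open>N\<close>, \<open>K\<close> and of the bound for this sum depends on \<open>r\<close> only, which permits the passage from
  finite products to \<open>\<phi>\<close>.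
\<close>

section \<open>Determinants indexed by functions\<close>

text \<open>
  The entries are a function, so that taking a minor is a change of the index functions.
\<close>

definition fdet :: "nat \<Rightarrow> (nat \<Rightarrow> nat \<Rightarrow> 'a :: comm_ring_1) \<Rightarrow> 'a" where
  "fdet n f = Determinant.det (Matrix.mat n n (\<lambda>(i, j). f i j))"

lemma fdet_cong:
  assumes "\<And>i j. i < n \<Longrightarrow> j < n \<Longrightarrow> f i j = g i j"
  shows "fdet n f = fdet n g"
  unfolding fdet_def by (rule arg_cong[where f = Determinant.det], rule eq_matI) (auto simp: assms)

lemma fdet_0 [simp]: "fdet 0 f = 1"
  by (simp add: fdet_def det_dim_zero)

lemma fdet_transpose: "fdet n f = fdet n (\<lambda>i j. f j i)"
proof -
  have "transpose_mat (Matrix.mat n n (\<lambda>(i, j). f i j)) = Matrix.mat n n (\<lambda>(i, j). f j i)"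
    by (rule eq_matI) auto
  then show ?thesis
    unfolding fdet_def using det_transpose[of "Matrix.mat n n (\<lambda>(i, j). f i j)" n] by simp
qed

lemma fdet_expand_column:
  assumes "q \<le> n"
  shows "fdet (Suc n) f = (\<Sum>i\<le>n. f i q * ((-1) ^ (i + q) *
           fdet n (\<lambda>a b. f (if a < i then a else Suc a) (if b < q then b else Suc b))))"
proof -
  let ?A = "Matrix.mat (Suc n) (Suc n) (\<lambda>(i, j). f i j)"
  have "fdet (Suc n) f = (\<Sum>i<Suc n. ?A $$ (i, q) * cofactor ?A i q)"
    unfolding fdet_def using assms by (intro laplace_expansion_column) auto
  also have "\<dots> = (\<Sum>i\<le>n. f i q * ((-1) ^ (i + q) *
           fdet n (\<lambda>a b. f (if a < i then a else Suc a) (if b < q then b else Suc b))))"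
  proof (rule sum.cong)
    fix i assume i: "i \<in> {..n}"
    have "mat_delete ?A i q = Matrix.mat n n
            (\<lambda>(a, b). f (if a < i then a else Suc a) (if b < q then b else Suc b))"
      using i assms by (intro eq_matI) (auto simp: mat_delete_def)
    then show "?A $$ (i, q) * cofactor ?A i q = f i q * ((-1) ^ (i + q) *
           fdet n (\<lambda>a b. f (if a < i then a else Suc a) (if b < q then b else Suc b)))"
      using i assms by (simp add: cofactor_def fdet_def)
  qed auto
  finally show ?thesis .
qed

lemma fdet_1 [simp]: "fdet (Suc 0) f = f 0 0"
  by (subst fdet_expand_column[of 0]) auto

lemma fdet_single_entry_column:
  assumes "q \<le> n" "i \<le> n" "\<And>i'. i' \<le> n \<Longrightarrow> i' \<noteq> i \<Longrightarrow> f i' q = 0"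
  shows "fdet (Suc n) f = (-1) ^ (i + q) * f i q *
           fdet n (\<lambda>a b. f (if a < i then a else Suc a) (if b < q then b else Suc b))"
  by (subst fdet_expand_column[OF assms(1)], subst sum.remove[of _ i])
     (use assms in \<open>auto intro!: sum.neutral\<close>)

lemma fdet_zero_column:
  assumes "q < n" "\<And>i. i < n \<Longrightarrow> f i q = 0"
  shows "fdet n f = 0"
proof -
  obtain k where "n = Suc k" using assms by (cases n) auto
  then show ?thesis using assms by (simp add: fdet_expand_column[of q])
qed

lemma fdet_column_sum:
  assumes "q < n"
  shows "fdet n (\<lambda>i j. if j = q then \<Sum>l\<in>L. c l * g l i else f i j)
       = (\<Sum>l\<in>L. c l * fdet n (\<lambda>i j. if j = q then g l i else f i j))"
proof -
  obtain k where k: "n = Suc k" using assms by (cases n) auto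
  have *: "fdet n (\<lambda>i j. if j = q then v i else f i j) = (\<Sum>i\<le>k. v i * ((-1) ^ (i + q) *
           fdet k (\<lambda>a b. f (if a < i then a else Suc a) (if b < q then b else Suc b))))" for v
    unfolding k using assms k
    by (subst fdet_expand_column[of q])
       (auto intro!: sum.cong arg_cong2[where f = "(*)"] fdet_cong)
  show ?thesis
    unfolding * sum_distrib_left sum_distrib_right
    by (subst sum.swap) (simp add: mult.assoc)
qed

lemma fdet_equal_columns:
  assumes "p < n" "q < n" "p \<noteq> q" "\<And>i. i < n \<Longrightarrow> f i p = f i q"
  shows "fdet n f = 0"
  unfolding fdet_def using assms
  by (intro det_identical_columns[of _ n p q]) (auto intro!: eq_vecI)

lemma fdet_subtract_columns:
  assumes "q < n" "finite L" "L \<subseteq> {..<n} - {q}"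
  shows "fdet n f = fdet n (\<lambda>i j. if j = q then f i q - (\<Sum>l\<in>L. y l * f i l) else f i j)"
proof -
  let ?c = "\<lambda>l. if l = q then 1 else - y l"
  have "fdet n (\<lambda>i j. if j = q then \<Sum>l\<in>insert q L. ?c l * f i l else f i j)
      = (\<Sum>l\<in>insert q L. ?c l * fdet n (\<lambda>i j. if j = q then f i l else f i j))"
    by (rule fdet_column_sum[OF assms(1)])
  also have "\<dots> = fdet n (\<lambda>i j. if j = q then f i q else f i j)"
  proof -
    have "fdet n (\<lambda>i j. if j = q then f i l else f i j) = 0" if "l \<in> L" for l
      using that assms by (intro fdet_equal_columns[of l n q]) auto
    then show ?thesis using assms by (subst sum.insert) auto
  qed
  also have "\<dots> = fdet n f" by (rule fdet_cong) auto
  also have "(\<lambda>i j. if j = q then \<Sum>l\<in>insert q L. ?c l * f i l else f i j)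
     = (\<lambda>i j. if j = q then f i q - (\<Sum>l\<in>L. y l * f i l) else f i j)"
  proof -
    have "(\<Sum>l\<in>insert q L. ?c l * f i l) = f i q - (\<Sum>l\<in>L. y l * f i l)" for i
    proof -
      have "(\<Sum>l\<in>insert q L. ?c l * f i l) = f i q + (\<Sum>l\<in>L. ?c l * f i l)"
        using assms by (subst sum.insert) auto
      also have "(\<Sum>l\<in>L. ?c l * f i l) = (\<Sum>l\<in>L. - (y l * f i l))"
        using assms by (intro sum.cong) auto
      finally show ?thesis by (simp add: sum_negf)
    qed
    then show ?thesis by (simp only:)
  qed
  finally show ?thesis by simp
qed

lemma fdet_upper_triangular:
  fixes f :: "nat \<Rightarrow> nat \<Rightarrow> 'a :: idom"
  assumes "\<And>i j. j < i \<Longrightarrow> i < n \<Longrightarrow> f i j = 0"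
  shows "fdet n f = (\<Prod>i<n. f i i)"
proof -
  have "fdet n f = prod_list (diag_mat (Matrix.mat n n (\<lambda>(i, j). f i j)))"
    unfolding fdet_def by (rule det_upper_triangular[of _ n]) (auto simp: upper_triangular_def assms)
  also have "\<dots> = (\<Prod>i<n. f i i)"
    by (simp add: diag_mat_def prod.distinct_set_conv_list[symmetric] atLeast0LessThan
          interv_sum_list_conv_sum_set_nat prod.list_conv_set_nth)
  finally show ?thesis .
qed

lemma fdet_mult:
  "fdet n (\<lambda>i j. \<Sum>k<n. f i k * g k j) = fdet n f * fdet n g"
proof -
  have "Matrix.mat n n (\<lambda>(i, j). \<Sum>k<n. f i k * g k j)
      = Matrix.mat n n (\<lambda>(i, j). f i j) * Matrix.mat n n (\<lambda>(i, j). g i j)"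
    by (rule eq_matI) (auto simp: scalar_prod_def atLeast0LessThan)
  then show ?thesis unfolding fdet_def by (simp add: det_mult[of _ n])
qed

text \<open>
  Chio's condensation with the first row as pivot row. After column \<open>q\<close> is divided by \<open>f 0 q\<close>,
  the first row is constant, so that subtracting adjacent columns leaves a single entry in it.
  Differences of adjacent columns, instead of differences with one fixed column, are what makes
  the right-hand side additive along a chain of columns.
\<close>

lemma fdet_condensation:
  fixes f :: "nat \<Rightarrow> nat \<Rightarrow> 'a :: field"
  assumes nz: "\<And>q. q \<le> n \<Longrightarrow> f 0 q \<noteq> 0"
  shows "fdet (Suc n) f
       = (\<Prod>q\<le>n. f 0 q) * fdet n (\<lambda>i q. f (Suc i) (Suc q) / f 0 (Suc q) - f (Suc i) q / f 0 q)"
proof -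
  define B where "B = (\<lambda>i q. if q = 0 then f i 0 / f 0 0 else f i q / f 0 q - f i (q - 1) / f 0 (q - 1))"
  \<comment> \<open>The inverse operation: partial sums of the columns of B, scaled by the pivots, restore f.\<close>
  define E where "E = (\<lambda>q' q. if q' \<le> q then f 0 q else 0)"
  have sumB: "(\<Sum>k\<le>q. B i k) = f i q / f 0 q" for i q
    by (induction q) (auto simp: B_def)
  have "fdet (Suc n) f = fdet (Suc n) (\<lambda>i j. \<Sum>k<Suc n. B i k * E k j)"
  proof (rule fdet_cong)
    fix i j assume "i < Suc n" "j < Suc n"
    have "(\<Sum>k<Suc n. B i k * E k j) = (\<Sum>k\<le>j. B i k * f 0 j)"
      using \<open>j < Suc n\<close> unfolding E_def by (intro sum.mono_neutral_cong_right) auto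
    also have "\<dots> = f i j" using nz[of j] \<open>j < Suc n\<close> by (simp add: sum_distrib_right[symmetric] sumB)
    finally show "f i j = (\<Sum>k<Suc n. B i k * E k j)" by simp
  qed
  also have "\<dots> = fdet (Suc n) B * fdet (Suc n) E" by (rule fdet_mult)
  also have "fdet (Suc n) E = (\<Prod>q\<le>n. f 0 q)"
    by (subst fdet_upper_triangular) (auto simp: E_def lessThan_Suc_atMost)
  also have "fdet (Suc n) B = fdet n (\<lambda>i q. f (Suc i) (Suc q) / f 0 (Suc q) - f (Suc i) q / f 0 q)"
  proof -
    have "fdet (Suc n) B = fdet (Suc n) (\<lambda>i j. B j i)" by (rule fdet_transpose)
    also have "\<dots> = fdet n (\<lambda>i j. B (Suc j) (Suc i))"
      using nz by (subst fdet_single_entry_column[of 0 n 0]) (auto simp: B_def)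
    also have "\<dots> = fdet n (\<lambda>i j. B (Suc i) (Suc j))" by (rule fdet_transpose)
    finally show ?thesis by (simp add: B_def)
  qed
  finally show ?thesis by simp
qed

section \<open>Positivity from solid minors\<close>

text \<open>
  Multilinearity turns a determinant whose columns are sums into a sum of minors. If all of them
  are nonnegative, each single one is a lower bound; this is how strict positivity survives.
\<close>

lemma fdet_column_sums_ge:
  fixes g :: "nat \<Rightarrow> nat \<Rightarrow> 'a :: linordered_idom"
  assumes fin: "\<And>q. q < n \<Longrightarrow> finite (L q)"
    and nonneg: "\<And>l. (\<And>q. q < n \<Longrightarrow> l q \<in> L q) \<Longrightarrow> fdet n (\<lambda>i q. g i (l q)) \<ge> 0"
    and l: "\<And>q. q < n \<Longrightarrow> l q \<in> L q"
  shows "fdet n (\<lambda>i q. \<Sum>k\<in>L q. g i k) \<ge> fdet n (\<lambda>i q. g i (l q))"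
proof -
  \<comment> \<open>Only the first m columns are sums; m is increased one column at a time.\<close>
  define D where "D = (\<lambda>m l. fdet n (\<lambda>i q. if q < m then \<Sum>k\<in>L q. g i k else g i (l q)))"
  have *: "m \<le> n \<Longrightarrow> (\<And>q. q < n \<Longrightarrow> l q \<in> L q) \<Longrightarrow> D m l \<ge> fdet n (\<lambda>i q. g i (l q))" for m l
  proof (induction m arbitrary: l)
    case 0
    show ?case by (simp add: D_def)
  next
    case (Suc m)
    have "D (Suc m) l = fdet n (\<lambda>i j. if j = m then \<Sum>k\<in>L m. 1 * g i k
             else (if j < m then \<Sum>k\<in>L j. g i k else g i (l j)))"
      unfolding D_def by (rule fdet_cong) auto
    also have "\<dots> = (\<Sum>k\<in>L m. 1 * fdet n (\<lambda>i j. if j = m then g i k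
             else (if j < m then \<Sum>k\<in>L j. g i k else g i (l j))))"
      using Suc.prems(1) by (intro fdet_column_sum) simp
    also have "\<dots> = (\<Sum>k\<in>L m. D m (l(m := k)))"
      unfolding D_def by (intro sum.cong refl) (auto intro!: fdet_cong)
    finally have D: "D (Suc m) l = (\<Sum>k\<in>L m. D m (l(m := k)))" .
    have nn: "D m (l(m := k)) \<ge> 0" if "k \<in> L m" for k
    proof -
      have "fdet n (\<lambda>i q. g i ((l(m := k)) q)) \<le> D m (l(m := k))"
        using that Suc.prems by (intro Suc.IH) auto
      moreover have "fdet n (\<lambda>i q. g i ((l(m := k)) q)) \<ge> 0"
        using that Suc.prems by (intro nonneg) auto
      ultimately show ?thesis by linarith
    qed
    have "fdet n (\<lambda>i q. g i (l q)) \<le> D m l" using Suc.prems by (intro Suc.IH) auto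
    also have "\<dots> = D m (l(m := l m))" by simp
    also have "\<dots> \<le> (\<Sum>k\<in>L m. D m (l(m := k)))"
      using Suc.prems fin nn by (intro member_le_sum) auto
    finally show ?case by (simp only: D)
  qed
  have "fdet n (\<lambda>i q. g i (l q)) \<le> D n l" by (rule *) (use l in auto)
  also have "D n l = fdet n (\<lambda>i q. \<Sum>k\<in>L q. g i k)" unfolding D_def by (rule fdet_cong) auto
  finally show ?thesis .
qed

text \<open>
  This is Fekete's criterion for a system of functions \<open>f 0, f 1, \<dots>\<close> of which the \<open>p\<close>-th one vanishes
  before the threshold \<open>m p\<close>: minors with consecutive columns control all minors. Condensation
  replaces the system by the increments of the quotients \<open>f p / f 0\<close>. They satisfy the same
  hypotheses with all thresholds lowered by one, and a minor of the old system is a sum of minors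
  of the new one, over choices of one increment between any two neighbouring columns. The
  thresholds are what a triangular matrix needs, where minors may vanish for trivial reasons.
\<close>

lemma staircase_minors:
  fixes f :: "nat \<Rightarrow> nat \<Rightarrow> 'a :: linordered_field"
  assumes "\<And>p j. p < s \<Longrightarrow> j < m p \<Longrightarrow> f p j = 0"
    and "strict_mono_on {..<s} m"
    and "\<And>p j. p < s \<Longrightarrow> m p \<le> j + p \<Longrightarrow> fdet (Suc p) (\<lambda>i q. f i (j + q)) > 0"
    and "strict_mono_on {..<s} J"
  shows "fdet s (\<lambda>i q. f i (J q)) \<ge> 0
       \<and> ((\<forall>q<s. m q \<le> J q) \<longrightarrow> fdet s (\<lambda>i q. f i (J q)) > 0)"
  using assms
proof (induction s arbitrary: f m J)
  case 0
  then show ?case by simp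
next
  case (Suc n)
  note zero = Suc.prems(1) and mono = Suc.prems(2) and solid = Suc.prems(3) and J = Suc.prems(4)
  have mless: "m p < m q" if "p < q" "q \<le> n" for p q
    using strict_mono_onD[OF mono, of p q] that by auto
  have mle: "m 0 + p \<le> m p" if "p \<le> n" for p
    using that
  proof (induction p)
    case (Suc p)
    then show ?case using mless[of p "Suc p"] by simp
  qed simp
  have Jless: "J p < J q" if "p < q" "q \<le> n" for p q
    using strict_mono_onD[OF J, of p q] that by auto
  have J0: "J 0 \<le> J q" if "q \<le> n" for q
    using Jless[of 0 q] that by (cases "q = 0") auto
  have pos: "f 0 j > 0" if "m 0 \<le> j" for j
    using solid[of 0 j] that by simp
  show ?case
  proof (cases "J 0 < m 0")
    case True
    have "fdet (Suc n) (\<lambda>i q. f i (J q)) = 0"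
    proof (rule fdet_zero_column[of 0])
      fix i assume "i < Suc n"
      then show "f i (J 0) = 0" using True mle[of i] by (intro zero) auto
    qed simp
    then show ?thesis using True by (auto simp: not_le)
  next
    case False
    \<comment> \<open>The zeros of f 0 before its threshold are harmless: there all f p vanish, and 0 / 0 = 0.\<close>
    define g where "g = (\<lambda>p l. f (Suc p) (Suc l) / f 0 (Suc l) - f (Suc p) l / f 0 l)"
    define m' where "m' = (\<lambda>p. m (Suc p) - 1)"
    have zero': "g p j = 0" if "p < n" "j < m' p" for p j
      using that zero[of "Suc p" j] zero[of "Suc p" "Suc j"] by (auto simp: g_def m'_def)
    have mono': "strict_mono_on {..<n} m'"
    proof (rule strict_mono_onI)
      fix p q assume "p \<in> {..<n}" "q \<in> {..<n}" "p < q"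
      then show "m' p < m' q"
        using mless[of "Suc p" "Suc q"] mle[of "Suc p"] by (auto simp: m'_def)
    qed
    have solid': "fdet (Suc p) (\<lambda>i q. g i (j + q)) > 0" if "p < n" "m' p \<le> j + p" for p j
    proof -
      have j: "m (Suc p) \<le> j + Suc p" using that by (simp add: m'_def)
      then have "m 0 \<le> j" using mle[of "Suc p"] that by simp
      then have nz: "f 0 (j + q) > 0" for q by (intro pos) simp
      have "fdet (Suc (Suc p)) (\<lambda>i q. f i (j + q)) > 0"
        using solid[of "Suc p" j] that j by simp
      also have "fdet (Suc (Suc p)) (\<lambda>i q. f i (j + q))
         = (\<Prod>q\<le>Suc p. f 0 (j + q)) * fdet (Suc p) (\<lambda>i q. g i (j + q))"
        by (subst fdet_condensation) (use nz in \<open>auto simp: g_def less_imp_neq[symmetric] intro: less_imp_neq[symmetric]\<close>)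
      finally show ?thesis
        using prod_pos[of "{..Suc p}" "\<lambda>q. f 0 (j + q)"] nz by (simp only: zero_less_mult_pos)
    qed
    have IH: "fdet n (\<lambda>i q. g i (l q)) \<ge> 0
       \<and> ((\<forall>q<n. m' q \<le> l q) \<longrightarrow> fdet n (\<lambda>i q. g i (l q)) > 0)"
      if "strict_mono_on {..<n} l" for l
      using Suc.IH[of m' g l, OF zero' mono' solid' that] by blast
    define L where "L = (\<lambda>q. {J q..<J (Suc q)})"
    have telescope: "f (Suc i) (J (Suc q)) / f 0 (J (Suc q)) - f (Suc i) (J q) / f 0 (J q)
          = (\<Sum>k\<in>L q. g i k)" if "q < n" for i q
      using sum_Suc_diff'[of "J q" "J (Suc q)" "\<lambda>l. f (Suc i) l / f 0 l"] Jless[of q "Suc q"] that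
      by (simp add: L_def g_def)
    have nz: "f 0 (J q) > 0" if "q \<le> n" for q
      using False J0[OF that] by (intro pos) simp
    have eq: "fdet (Suc n) (\<lambda>i q. f i (J q))
       = (\<Prod>q\<le>n. f 0 (J q)) * fdet n (\<lambda>i q. \<Sum>k\<in>L q. g i k)"
      by (subst fdet_condensation)
         (use nz in \<open>auto intro: less_imp_neq[symmetric] intro!: fdet_cong simp: telescope less_imp_neq[symmetric]\<close>)
    have P: "(\<Prod>q\<le>n. f 0 (J q)) > 0" using nz by (intro prod_pos) auto
    have Lmono: "strict_mono_on {..<n} l" if "\<And>q. q < n \<Longrightarrow> l q \<in> L q" for l
    proof (rule strict_mono_onI)
      fix p q assume pq: "p \<in> {..<n}" "q \<in> {..<n}" "p < q"
      have "l p < J (Suc p)" using that[of p] pq by (simp add: L_def)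
      also have "\<dots> \<le> J q" using Jless[of "Suc p" q] pq by (cases "Suc p = q") auto
      also have "\<dots> \<le> l q" using that[of q] pq by (simp add: L_def)
      finally show "l p < l q" .
    qed
    \<comment> \<open>The last increment before each column: it lies beyond the lowered threshold if the column lies beyond the old one.\<close>
    define t where "t = (\<lambda>q. J (Suc q) - 1)"
    have tL: "t q \<in> L q" if "q < n" for q
      using Jless[of q "Suc q"] that by (auto simp: t_def L_def)
    have ge: "fdet n (\<lambda>i q. \<Sum>k\<in>L q. g i k) \<ge> fdet n (\<lambda>i q. g i (t q))"
      by (rule fdet_column_sums_ge) (use IH Lmono tL in \<open>auto simp: L_def\<close>)
    have t: "fdet n (\<lambda>i q. g i (t q)) \<ge> 0" using IH Lmono tL by blast
    show ?thesis
    proof (intro conjI impI)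
      show "fdet (Suc n) (\<lambda>i q. f i (J q)) \<ge> 0" unfolding eq using P ge t by simp
      assume "\<forall>q<Suc n. m q \<le> J q"
      then have "\<forall>q<n. m' q \<le> t q" by (auto simp: m'_def t_def intro!: diff_le_mono)
      then have "fdet n (\<lambda>i q. g i (t q)) > 0" using IH Lmono tL by blast
      then show "fdet (Suc n) (\<lambda>i q. f i (J q)) > 0" unfolding eq using P ge by simp
    qed
  qed
qed

text \<open>
  Reversing the order of rows and of columns is conjugation by the permutation matrix \<open>P\<close> of the
  reversal, and \<open>P\<close> is its own inverse.
\<close>

lemma fdet_reverse: "fdet (Suc p) (\<lambda>i q. G (p - i) (p - q)) = fdet (Suc p) G"
proof -
  define P where "P = (\<lambda>i j. if i + j = p then 1 else 0 :: 'a)"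
  have pick: "(\<Sum>k<Suc p. P i k * h k) = h (p - i)" "(\<Sum>k<Suc p. h k * P k i) = h (p - i)"
    if "i < Suc p" for i h
  proof -
    have "(\<Sum>k<Suc p. P i k * h k) = (\<Sum>k<Suc p. if k = p - i then h k else 0)"
      using that by (intro sum.cong) (auto simp: P_def)
    then show "(\<Sum>k<Suc p. P i k * h k) = h (p - i)" by (simp add: sum.delta')
    have "(\<Sum>k<Suc p. h k * P k i) = (\<Sum>k<Suc p. if k = p - i then h k else 0)"
      using that by (intro sum.cong) (auto simp: P_def)
    then show "(\<Sum>k<Suc p. h k * P k i) = h (p - i)" by (simp add: sum.delta')
  qed
  have "fdet (Suc p) P * fdet (Suc p) P = fdet (Suc p) (\<lambda>i j. \<Sum>k<Suc p. P i k * P k j)"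
    by (rule fdet_mult[symmetric])
  also have "\<dots> = fdet (Suc p) (\<lambda>i j. if i = j then 1 else 0)"
    by (rule fdet_cong, subst pick) (auto simp: P_def)
  also have "\<dots> = 1"
  proof -
    have "Matrix.mat (Suc p) (Suc p) (\<lambda>(i, j). if i = j then 1 else 0 :: 'a) = 1\<^sub>m (Suc p)"
      by (rule eq_matI) auto
    then show ?thesis by (simp add: fdet_def)
  qed
  finally have PP: "fdet (Suc p) P * fdet (Suc p) P = 1" .
  have "fdet (Suc p) (\<lambda>i q. G (p - i) (p - q))
      = fdet (Suc p) (\<lambda>i q. \<Sum>k<Suc p. G (p - i) k * P k q)"
    by (rule fdet_cong, subst pick) auto
  also have "\<dots> = fdet (Suc p) (\<lambda>i q. G (p - i) q) * fdet (Suc p) P"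
    by (rule fdet_mult)
  also have "fdet (Suc p) (\<lambda>i q. G (p - i) q) = fdet (Suc p) (\<lambda>i q. \<Sum>k<Suc p. P i k * G k q)"
    by (rule fdet_cong, subst pick) auto
  also have "\<dots> = fdet (Suc p) P * fdet (Suc p) G" by (rule fdet_mult)
  also have "fdet (Suc p) P * fdet (Suc p) G * fdet (Suc p) P
           = fdet (Suc p) G * (fdet (Suc p) P * fdet (Suc p) P)" by (simp only: mult_ac)
  finally show ?thesis by (simp add: PP)
qed

text \<open>
  The minor whose rows and columns are both consecutive. Since the matrix is Toeplitz, only the
  offset \<open>k \<ge> 0\<close> between its first row and its first column matters.
\<close>

definition solid_minor :: "(nat \<Rightarrow> real) \<Rightarrow> nat \<Rightarrow> nat \<Rightarrow> real" where
  "solid_minor a s k = fdet s (\<lambda>i q. toeplitz a i (k + q))"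

lemma strict_mono_on_ge:
  fixes J :: "nat \<Rightarrow> nat"
  assumes "strict_mono_on {..<s} J" "q < s"
  shows "q \<le> J q"
  using assms(2)
proof (induction q)
  case (Suc q)
  then have "J q < J (Suc q)" by (intro strict_mono_onD[OF assms(1)]) auto
  with Suc show ?case by simp
qed simp

lemma first_rows_minor_pos:
  assumes "\<And>t k. 1 \<le> t \<Longrightarrow> t \<le> s \<Longrightarrow> solid_minor a t k > 0" and J: "strict_mono_on {..<s} J"
  shows "fdet s (\<lambda>i q. toeplitz a i (J q)) > 0"
proof -
  have "fdet s (\<lambda>i q. toeplitz a i (J q)) \<ge> 0
       \<and> ((\<forall>q<s. q \<le> J q) \<longrightarrow> fdet s (\<lambda>i q. toeplitz a i (J q)) > 0)"
  proof (rule staircase_minors[where m = "\<lambda>q. q"])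
    show "strict_mono_on {..<s} (\<lambda>q. q)" by (auto intro: strict_mono_onI)
    show "fdet (Suc p) (\<lambda>i q. toeplitz a i (j + q)) > 0" if "p < s" for p j
      using assms(1)[of "Suc p" j] that by (simp add: solid_minor_def)
  qed (use J in \<open>auto simp: toeplitz_def\<close>)
  then show ?thesis using strict_mono_on_ge[OF J] by blast
qed

text \<open>
  Fekete's criterion is applied twice, first to the initial rows of the Toeplitz matrix and then to
  arbitrary rows. The second application needs minors with arbitrary rows and consecutive columns.
  Reflection of the Toeplitz matrix in its antidiagonal exchanges rows and columns, so these are
  the minors with consecutive rows and arbitrary columns that the first application provides.
\<close>

lemma PF_seq_if_solid_minors_pos:
  assumes pos: "\<And>s k. 1 \<le> s \<Longrightarrow> s \<le> r \<Longrightarrow> solid_minor a s k > 0"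
  shows "PF_seq r a"
  unfolding PF_seq_def
proof (intro allI impI, elim conjE)
  fix s and I J :: "nat \<Rightarrow> nat"
  assume s: "s \<le> r" and I: "strict_mono_on {..<s} I" and J: "strict_mono_on {..<s} J"
  have "fdet s (\<lambda>i q. toeplitz a (I i) (J q)) \<ge> 0
       \<and> ((\<forall>q<s. I q \<le> J q) \<longrightarrow> fdet s (\<lambda>i q. toeplitz a (I i) (J q)) > 0)"
  proof (rule staircase_minors[where m = I])
    show "toeplitz a (I p) j = 0" if "j < I p" for p j using that by (simp add: toeplitz_def)
  next
    fix p j assume p: "p < s" "I p \<le> j + p"
    define J' where "J' = (\<lambda>y. j + p - I (p - y))"
    have Imono: "I x < I y" if "x < y" "y \<le> p" for x y
      using strict_mono_onD[OF I, of x y] that p by auto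
    have Ile: "I x \<le> j + p" if "x \<le> p" for x
      using Imono[of x p] that p by (cases "x = p") auto
    have J': "strict_mono_on {..<Suc p} J'"
    proof (rule strict_mono_onI)
      fix x y assume "x \<in> {..<Suc p}" "y \<in> {..<Suc p}" "x < y"
      then have "I (p - y) < I (p - x)" by (intro Imono) auto
      then show "J' x < J' y" using Ile[of "p - x"] by (simp add: J'_def)
    qed
    have "fdet (Suc p) (\<lambda>i q. toeplitz a (I i) (j + q))
        = fdet (Suc p) (\<lambda>i q. toeplitz a (p - q) (J' (p - i)))"
    proof (rule fdet_cong)
      fix i q assume "i < Suc p" "q < Suc p"
      then show "toeplitz a (I i) (j + q) = toeplitz a (p - q) (J' (p - i))"
        using Ile[of i] by (auto simp: toeplitz_def J'_def)
    qed
    also have "\<dots> = fdet (Suc p) (\<lambda>i q. toeplitz a (p - i) (J' (p - q)))"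
      by (rule fdet_transpose)
    also have "\<dots> = fdet (Suc p) (\<lambda>i q. toeplitz a i (J' q))"
      by (rule fdet_reverse)
    also have "\<dots> > 0" by (rule first_rows_minor_pos) (use pos s p J' in auto)
    finally show "fdet (Suc p) (\<lambda>i q. toeplitz a (I i) (j + q)) > 0" .
  qed (use I J in auto)
  then show "toeplitz_minor a s I J \<ge> 0" by (simp add: toeplitz_minor_def fdet_def)
qed

section \<open>The Desnanot-Jacobi identity and its recursion\<close>

lemma fdet_nonzero_solve:
  fixes C :: "nat \<Rightarrow> nat \<Rightarrow> 'a :: field"
  assumes "fdet n C \<noteq> 0"
  obtains y where "\<And>i. i < n \<Longrightarrow> (\<Sum>l<n. y l * C i l) = v i"
proof -
  define A where "A = Matrix.mat n n (\<lambda>(i, j). C i j)"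
  define B where "B = adj_mat A"
  have A: "A \<in> carrier_mat n n" by (simp add: A_def)
  have B: "B \<in> carrier_mat n n" and AB: "A * B = Determinant.det A \<cdot>\<^sub>m 1\<^sub>m n"
    using adj_mat[OF A] by (auto simp: B_def)
  have d: "Determinant.det A \<noteq> 0" using assms by (simp add: fdet_def A_def)
  define y where "y = (\<lambda>l. (\<Sum>j<n. B $$ (l, j) * v j) / Determinant.det A)"
  have "(\<Sum>l<n. y l * C i l) = v i" if i: "i < n" for i
  proof -
    have "(\<Sum>l<n. y l * C i l) = (\<Sum>l<n. \<Sum>j<n. C i l * B $$ (l, j) * v j) / Determinant.det A"
      by (simp add: y_def sum_divide_distrib sum_distrib_left mult_ac)
    also have "(\<Sum>l<n. \<Sum>j<n. C i l * B $$ (l, j) * v j) = (\<Sum>j<n. (\<Sum>l<n. C i l * B $$ (l, j)) * v j)"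
      by (subst sum.swap) (simp add: sum_distrib_right)
    also have "\<dots> = (\<Sum>j<n. if j = i then Determinant.det A * v j else 0)"
    proof (rule sum.cong)
      fix j assume j: "j \<in> {..<n}"
      have "(\<Sum>l<n. C i l * B $$ (l, j)) = (A * B) $$ (i, j)"
        using i j B by (simp add: A_def scalar_prod_def atLeast0LessThan)
      also have "\<dots> = (if j = i then Determinant.det A else 0)"
        unfolding AB using i j by simp
      finally show "(\<Sum>l<n. C i l * B $$ (l, j)) * v j = (if j = i then Determinant.det A * v j else 0)"
        by simp
    qed simp
    also have "\<dots> = Determinant.det A * v i" using i by (simp add: sum.delta')
    finally show ?thesis using d by simp
  qed
  then show thesis by (rule that)
qed

text \<open>
  Since the central minor is nonzero, multiples of the inner columns can be subtracted from the
  two outer ones so that these keep entries in the two outer rows only. None of the five minors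
  changes, and each of the four larger ones becomes an outer entry, or a \<open>2 \<times> 2\<close> determinant of outer
  entries, times the central minor.
\<close>

lemma desnanot_jacobi:
  fixes f :: "nat \<Rightarrow> nat \<Rightarrow> 'a :: field"
  assumes nz: "fdet n (\<lambda>i j. f (Suc i) (Suc j)) \<noteq> 0"
  shows "fdet (Suc (Suc n)) f * fdet n (\<lambda>i j. f (Suc i) (Suc j))
       = fdet (Suc n) f * fdet (Suc n) (\<lambda>i j. f (Suc i) (Suc j))
         - fdet (Suc n) (\<lambda>i j. f i (Suc j)) * fdet (Suc n) (\<lambda>i j. f (Suc i) j)"
proof -
  obtain y where y: "\<And>i. i < n \<Longrightarrow> (\<Sum>l<n. y l * f (Suc i) (Suc l)) = f (Suc i) 0"
    using fdet_nonzero_solve[OF nz, of "\<lambda>i. f (Suc i) 0"] by blast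
  obtain z where z: "\<And>i. i < n \<Longrightarrow> (\<Sum>l<n. z l * f (Suc i) (Suc l)) = f (Suc i) (Suc n)"
    using fdet_nonzero_solve[OF nz, of "\<lambda>i. f (Suc i) (Suc n)"] by blast
  define g where "g = (\<lambda>i j. if j = 0 then f i 0 - (\<Sum>l<n. y l * f i (Suc l))
      else if j = Suc n then f i (Suc n) - (\<Sum>l<n. z l * f i (Suc l)) else f i j)"
  have shift: "(\<Sum>l\<in>Suc ` {..<n}. h l) = (\<Sum>l<n. h (Suc l))" for h :: "nat \<Rightarrow> 'a"
    by (simp add: sum.reindex)
  have inner: "fdet n (\<lambda>i j. f (Suc i) (Suc j)) = fdet n (\<lambda>i j. g (Suc i) (Suc j))"
    by (rule fdet_cong) (auto simp: g_def)
  have full: "fdet (Suc (Suc n)) f = fdet (Suc (Suc n)) g"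
  proof -
    define h where "h = (\<lambda>i j. if j = 0 then f i 0 - (\<Sum>l\<in>Suc ` {..<n}. y (l - 1) * f i l) else f i j)"
    have "fdet (Suc (Suc n)) f = fdet (Suc (Suc n)) h"
      unfolding h_def by (rule fdet_subtract_columns) auto
    also have "\<dots> = fdet (Suc (Suc n))
        (\<lambda>i j. if j = Suc n then h i (Suc n) - (\<Sum>l\<in>Suc ` {..<n}. z (l - 1) * h i l) else h i j)"
      by (rule fdet_subtract_columns) auto
    also have "\<dots> = fdet (Suc (Suc n)) g"
      by (rule fdet_cong) (auto simp: g_def h_def shift)
    finally show ?thesis .
  qed
  have tl: "fdet (Suc n) f = fdet (Suc n) g"
    by (subst fdet_subtract_columns[of 0 _ "Suc ` {..<n}" f "\<lambda>l. y (l - 1)"])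
       (auto intro!: fdet_cong simp: g_def shift)
  have bl: "fdet (Suc n) (\<lambda>i j. f (Suc i) j) = fdet (Suc n) (\<lambda>i j. g (Suc i) j)"
    by (subst fdet_subtract_columns[of 0 _ "Suc ` {..<n}" _ "\<lambda>l. y (l - 1)"])
       (auto intro!: fdet_cong simp: g_def shift)
  have tr: "fdet (Suc n) (\<lambda>i j. f i (Suc j)) = fdet (Suc n) (\<lambda>i j. g i (Suc j))"
    by (subst fdet_subtract_columns[of n _ "{..<n}" _ z])
       (auto intro!: fdet_cong simp: g_def)
  have br: "fdet (Suc n) (\<lambda>i j. f (Suc i) (Suc j)) = fdet (Suc n) (\<lambda>i j. g (Suc i) (Suc j))"
    by (subst fdet_subtract_columns[of n _ "{..<n}" _ z])
       (auto intro!: fdet_cong simp: g_def)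
  let ?D = "fdet n (\<lambda>i j. g (Suc i) (Suc j))"
  have g0: "g i 0 = 0" if "i \<noteq> 0" "i \<le> n" for i
    using y[of "i - 1"] that by (simp add: g_def)
  have gn: "g i (Suc n) = 0" if "i \<noteq> 0" "i \<le> n" for i
    using z[of "i - 1"] that by (simp add: g_def)
  have tl': "fdet (Suc n) g = g 0 0 * ?D"
    by (subst fdet_single_entry_column[of 0 n 0]) (auto simp: g0)
  have bl': "fdet (Suc n) (\<lambda>i j. g (Suc i) j) = (-1) ^ n * g (Suc n) 0 * ?D"
    by (subst fdet_single_entry_column[of 0 n n]) (auto intro!: arg_cong2[where f = "(*)"] fdet_cong simp: g0)
  have tr': "fdet (Suc n) (\<lambda>i j. g i (Suc j)) = (-1) ^ n * g 0 (Suc n) * ?D"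
    by (subst fdet_single_entry_column[of n n 0]) (auto intro!: arg_cong2[where f = "(*)"] fdet_cong simp: gn)
  have br': "fdet (Suc n) (\<lambda>i j. g (Suc i) (Suc j)) = g (Suc n) (Suc n) * ?D"
    by (subst fdet_single_entry_column[of n n n])
       (auto intro!: arg_cong2[where f = "(*)"] fdet_cong simp: gn)
  have "fdet (Suc (Suc n)) g = g 0 0 * fdet (Suc n) (\<lambda>i j. g (Suc i) (Suc j))
          + g (Suc n) 0 * ((-1) ^ Suc n * fdet (Suc n) (\<lambda>i j. g i (Suc j)))"
  proof -
    have cut: "(\<Sum>i\<le>Suc n. h i) = h 0 + h (Suc n)" if "\<And>i. i \<noteq> 0 \<Longrightarrow> i \<le> n \<Longrightarrow> h i = 0"
      for h :: "nat \<Rightarrow> 'a"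
    proof -
      have "(\<Sum>i\<le>n. h i) = (\<Sum>i\<in>{0}. h i)"
        using that by (intro sum.mono_neutral_right) auto
      then show ?thesis by simp
    qed
    show ?thesis
      by (subst fdet_expand_column[of 0], simp, subst cut)
         (auto simp: g0 intro!: arg_cong2[where f = "(*)"] fdet_cong)
  qed
  also have "\<dots> = g 0 0 * (g (Suc n) (Suc n) * ?D)
      - ((-1) ^ n * (-1) ^ n) * (g (Suc n) 0 * (g 0 (Suc n) * ?D))"
    unfolding br' tr' by (simp add: algebra_simps)
  finally have full': "fdet (Suc (Suc n)) g = g 0 0 * (g (Suc n) (Suc n) * ?D)
      - ((-1) ^ n * (-1) ^ n) * (g (Suc n) 0 * (g 0 (Suc n) * ?D))" .
  show ?thesis
    unfolding full tl bl tr br inner unfolding full' tl' bl' tr' br'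
    by (simp only: algebra_simps)
qed

lemma solid_minor_0 [simp]: "solid_minor a 0 k = 1"
  by (simp add: solid_minor_def)

lemma solid_minor_1 [simp]: "solid_minor a (Suc 0) k = a k"
  by (simp add: solid_minor_def toeplitz_def)

lemma solid_minor_at_0: "solid_minor a s 0 = a 0 ^ s"
  unfolding solid_minor_def by (subst fdet_upper_triangular) (auto simp: toeplitz_def)

lemma solid_minor_desnanot_jacobi:
  assumes "k \<ge> 1" "solid_minor a s k \<noteq> 0"
  shows "solid_minor a (Suc (Suc s)) k * solid_minor a s k
       = (solid_minor a (Suc s) k)\<^sup>2 - solid_minor a (Suc s) (k - 1) * solid_minor a (Suc s) (k + 1)"
proof -
  define f where "f = (\<lambda>i q. toeplitz a i (k + q))"
  have *: "(\<lambda>i j. f (Suc i) (Suc j)) = f" "(\<lambda>i j. f i (Suc j)) = (\<lambda>i q. toeplitz a i (k + 1 + q))"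
    "(\<lambda>i j. f (Suc i) j) = (\<lambda>i q. toeplitz a i (k - 1 + q))"
    using assms(1) by (auto simp: f_def toeplitz_def fun_eq_iff)
  have "fdet s (\<lambda>i j. f (Suc i) (Suc j)) \<noteq> 0"
    unfolding * using assms(2) by (simp add: f_def solid_minor_def)
  from desnanot_jacobi[OF this] show ?thesis
    unfolding * by (simp add: f_def solid_minor_def power2_eq_square mult.commute)
qed

text \<open>
  This is \<open>T\<^sub>s\<^sub>+\<^sub>1(k) T\<^sub>s\<^sub>-\<^sub>1(k) / T\<^sub>s(k)\<^sup>2\<close> with \<open>T\<^sub>s = solid_minor a s\<close>, written as the relative defect from
  log-linearity of \<open>T\<^sub>s\<close>. The value 1 at \<open>k = 0\<close> corresponds to \<open>T\<^sub>s(-1) = 0\<close>, and the value 0 at \<open>s = 0\<close>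
  to the constant \<open>T\<^sub>0 = 1\<close>.
\<close>

definition log_defect :: "(nat \<Rightarrow> real) \<Rightarrow> nat \<Rightarrow> nat \<Rightarrow> real" where
  "log_defect a s k = (if s = 0 then 0 else if k = 0 then 1
     else 1 - solid_minor a s (k - 1) * solid_minor a s (k + 1) / (solid_minor a s k)\<^sup>2)"

lemma solid_minor_Suc_Suc:
  assumes "a 0 \<noteq> 0" "solid_minor a s k \<noteq> 0" "solid_minor a (Suc s) k \<noteq> 0"
  shows "solid_minor a (Suc (Suc s)) k = log_defect a (Suc s) k * (solid_minor a (Suc s) k)\<^sup>2 / solid_minor a s k"
proof (cases "k = 0")
  case True
  then show ?thesis using assms by (simp add: solid_minor_at_0 log_defect_def power2_eq_square)
next
  case False
  then have "log_defect a (Suc s) k * (solid_minor a (Suc s) k)\<^sup>2 = solid_minor a (Suc (Suc s)) k * solid_minor a s k"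
    using solid_minor_desnanot_jacobi[of k a s] assms by (simp add: log_defect_def left_diff_distrib)
  then show ?thesis using assms(2) by (simp add: field_simps)
qed

text \<open>
  The second logarithmic difference of \<open>T\<^sub>s\<^sub>+\<^sub>2 = R\<^sub>s\<^sub>+\<^sub>1 T\<^sub>s\<^sub>+\<^sub>1\<^sup>2 / T\<^sub>s\<close> is a combination of those of \<open>R\<^sub>s\<^sub>+\<^sub>1\<close>,
  \<open>T\<^sub>s\<^sub>+\<^sub>1\<close> and \<open>T\<^sub>s\<close>. No determinant is left in the resulting recursion.
\<close>

lemma log_defect_step:
  assumes k: "k \<ge> 1" and pos: "\<And>t j. t \<le> Suc (Suc s) \<Longrightarrow> solid_minor a t j > 0"
  shows "log_defect a (Suc (Suc s)) k
    = 1 - (1 - log_defect a (Suc s) k)\<^sup>2 / (1 - log_defect a s k)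
          * (log_defect a (Suc s) (k - 1) * log_defect a (Suc s) (k + 1) / (log_defect a (Suc s) k)\<^sup>2)"
proof -
  define R where "R = log_defect a (Suc s)"
  define T where "T = solid_minor a (Suc s)"
  define S where "S = solid_minor a s"
  have T: "T j > 0" and S: "S j > 0" for j using pos by (auto simp: T_def S_def)
  have a0: "a 0 \<noteq> 0" using pos[of 1 0] by simp
  have TT: "solid_minor a (Suc (Suc s)) j = R j * (T j)\<^sup>2 / S j" for j
    unfolding R_def T_def S_def using pos a0 by (intro solid_minor_Suc_Suc) (auto simp: less_imp_neq[symmetric])
  have R: "R j \<noteq> 0" for j
    using pos[of "Suc (Suc s)" j] unfolding TT by auto
  have lhs: "1 - log_defect a (Suc (Suc s)) k
      = (R (k - 1) * (T (k - 1))\<^sup>2 / S (k - 1)) * (R (k + 1) * (T (k + 1))\<^sup>2 / S (k + 1))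
        / (R k * (T k)\<^sup>2 / S k)\<^sup>2"
    using k by (simp add: log_defect_def TT)
  have 1: "1 - R k = T (k - 1) * T (k + 1) / (T k)\<^sup>2"
    using k by (simp add: R_def log_defect_def T_def)
  have 0: "1 - log_defect a s k = S (k - 1) * S (k + 1) / (S k)\<^sup>2"
    using k by (simp add: log_defect_def S_def)
  have "1 - log_defect a (Suc (Suc s)) k
     = (1 - R k)\<^sup>2 / (1 - log_defect a s k) * (R (k - 1) * R (k + 1) / (R k)\<^sup>2)"
    unfolding lhs 1 0 using T[of k] T[of "k - 1"] T[of "k + 1"] S[of k] S[of "k - 1"] S[of "k + 1"] R
    by (simp add: field_simps power2_eq_square)
  then show ?thesis by (simp add: R_def)
qed

text \<open>
  A solution \<open>u\<close> of the recursion with the right initial values is the sequence of defects, as long as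
  the minors are positive, and positive defects give positive minors of the next order. A solution
  given by an analytic formula need not agree with the defects near \<open>k = 0\<close>, where the sequence is
  cut off; but each step of the recursion looks back by one index only, so that it agrees from
  \<open>k = s\<close> on. This is the case \<open>d = 1\<close>, and \<open>d = 0\<close> is the case of a solution that takes the right value
  at \<open>k = 0\<close>, too. Where \<open>u\<close> gives no information, the minor itself has to be positive.
\<close>

lemma solid_minor_pos_by_recursion:
  fixes u :: "nat \<Rightarrow> nat \<Rightarrow> real"
  assumes a: "\<And>k. a k > 0" and d: "d \<le> 1"
    and u0: "\<And>k. u 0 k = 0"
    and u1: "\<And>k. k \<ge> 1 \<Longrightarrow> u 1 k = 1 - a (k - 1) * a (k + 1) / (a k)\<^sup>2"
    and step: "\<And>s k. Suc (Suc s) < r \<Longrightarrow> k \<ge> 1 \<Longrightarrow> k \<ge> d * Suc (Suc s) \<Longrightarrow>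
        u (Suc (Suc s)) k = 1 - (1 - u (Suc s) k)\<^sup>2 / (1 - u s k)
          * (u (Suc s) (k - 1) * u (Suc s) (k + 1) / (u (Suc s) k)\<^sup>2)"
    and init: "\<And>s. d = 0 \<Longrightarrow> 1 \<le> s \<Longrightarrow> s < r \<Longrightarrow> u s 0 = 1"
    and pos: "\<And>s k. 1 \<le> s \<Longrightarrow> s < r \<Longrightarrow> solid_minor a (Suc s) k > 0 \<or> (k \<ge> d * s \<and> u s k > 0)"
    and s: "s \<le> r"
  shows "solid_minor a s k > 0"
proof -
  have "s < r \<Longrightarrow> (\<forall>t\<le>Suc s. \<forall>k. solid_minor a t k > 0) \<and> (\<forall>t\<le>s. \<forall>k\<ge>d * t. u t k = log_defect a t k)" for s
  proof (induction s)
    case 0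
    show ?case using a u0 by (auto simp: log_defect_def le_Suc_eq)
  next
    case (Suc s)
    then have P: "\<And>t k. t \<le> Suc s \<Longrightarrow> solid_minor a t k > 0"
      and U: "\<And>t k. t \<le> s \<Longrightarrow> k \<ge> d * t \<Longrightarrow> u t k = log_defect a t k" by auto
    have new: "u (Suc s) k = log_defect a (Suc s) k" if k: "k \<ge> d * Suc s" for k
    proof (cases "k = 0")
      case True
      then have "d = 0" using k by simp
      then show ?thesis using True init[of "Suc s"] Suc.prems by (simp add: log_defect_def)
    next
      case False
      show ?thesis
      proof (cases s)
        case 0
        then show ?thesis using False u1[of k] by (simp add: log_defect_def)
      next
        case (Suc s')
        have dk: "k - 1 \<ge> d * Suc s'" "k + 1 \<ge> d * Suc s'" "k \<ge> d * Suc s'" "k \<ge> d * s'"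
          using k d False Suc by (cases "d = 0"; simp)+
        show ?thesis
          unfolding Suc using \<open>Suc s < r\<close> False k Suc P
          by (subst step) (use dk in \<open>auto simp: U Suc intro!: log_defect_step[symmetric, simplified]\<close>)
      qed
    qed
    have "solid_minor a (Suc (Suc s)) k > 0" for k
    proof -
      consider "solid_minor a (Suc (Suc s)) k > 0" | "k \<ge> d * Suc s" "u (Suc s) k > 0"
        using pos[of "Suc s" k] Suc.prems by auto
      then show ?thesis
      proof cases
        case 2
        have "solid_minor a (Suc (Suc s)) k
            = log_defect a (Suc s) k * (solid_minor a (Suc s) k)\<^sup>2 / solid_minor a s k"
          using a[of 0] P[of s k] P[of "Suc s" k] by (intro solid_minor_Suc_Suc) auto
        then show ?thesis using new[of k] 2 P[of s k] P[of "Suc s" k] by simp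
      qed simp
    qed
    then show ?case using P U new by (auto simp: le_Suc_eq)
  qed
  from this[of "s - 1"] show ?thesis using s by (cases s) auto
qed

section \<open>The reference sequence\<close>

text \<open>
  Up to the factor \<open>N!\<close> these are the coefficients of \<open>(1 - z)^(-N-1)\<close>.
\<close>

definition rising :: "nat \<Rightarrow> nat \<Rightarrow> real" where
  "rising N k = (\<Prod>i<N. real (k + 1 + i))"

lemma rising_pos: "rising N k > 0"
  by (auto simp: rising_def intro!: prod_pos)

lemma rising_Suc: "rising N (Suc k) * real (k + 1) = rising N k * real (k + 1 + N)"
proof -
  have "rising N (Suc k) * real (k + 1) = (\<Prod>i<Suc N. real (k + 1 + i))"
    unfolding rising_def by (subst prod.lessThan_Suc_shift) (simp add: add_ac)
  also have "\<dots> = rising N k * real (k + 1 + N)" by (simp add: rising_def)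
  finally show ?thesis .
qed

text \<open>
  For this sequence the recursion has the rational solution \<open>u\<close> below. It reflects that the solid
  minors count plane partitions in a box, by MacMahon's product formula.
\<close>

lemma solid_minor_rising_pos:
  assumes r: "r \<le> N" and s: "s \<le> r"
  shows "solid_minor (rising N) s k > 0"
proof -
  define u where "u = (\<lambda>s k. real s * (real N + 1 - real s)
     / ((real k + real s) * (real k + real N + 1 - real s)))"
  show ?thesis
  proof (rule solid_minor_pos_by_recursion[where u = u and d = 0 and r = r])
    show "u 1 k = 1 - rising N (k - 1) * rising N (k + 1) / (rising N k)\<^sup>2" if k: "k \<ge> 1" for k
    proof -
      obtain j where j: "k = Suc j" using k by (cases k) auto
      have 1: "rising N (Suc j) = rising N j * (real j + 1 + N) / (real j + 1)"
        using rising_Suc[of N j] by (simp add: field_simps)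
      have 2: "rising N (Suc (Suc j)) = rising N (Suc j) * (real j + 2 + N) / (real j + 2)"
        using rising_Suc[of N "Suc j"] by (simp add: field_simps)
      have "rising N j * rising N (Suc (Suc j)) / (rising N (Suc j))\<^sup>2
          = (real j + 1) * (real j + 2 + N) / ((real j + 2) * (real j + 1 + N))"
        unfolding 2 unfolding 1 using rising_pos[of N j] 
        by (simp add: power2_eq_square divide_simps)
      moreover have "1 - (real j + 1) * (real j + 2 + N) / ((real j + 2) * (real j + 1 + N))
          = ((real j + 2) * (real j + 1 + N) - (real j + 1) * (real j + 2 + N))
            / ((real j + 2) * (real j + 1 + N))"
        by (simp add: diff_divide_distrib)
      moreover have "(real j + 2) * (real j + 1 + N) - (real j + 1) * (real j + 2 + N) = N"
        by (simp add: algebra_simps)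
      ultimately show ?thesis by (simp add: u_def j add_ac)
    qed
    show "u (Suc (Suc s)) k = 1 - (1 - u (Suc s) k)\<^sup>2 / (1 - u s k)
          * (u (Suc s) (k - 1) * u (Suc s) (k + 1) / (u (Suc s) k)\<^sup>2)"
      if sr: "Suc (Suc s) < r" and k: "k \<ge> 1" for s k
    proof -
      define x where "x = real k"
      define y where "y = real s"
      define M where "M = real N"
      have x: "x \<ge> 1" and y: "y \<ge> 0" and M: "M - y > 2" using sr k r by (auto simp: x_def y_def M_def)
      have k1: "real (k - 1) = x - 1" using k by (simp add: x_def of_nat_diff)
      have one_minus: "1 - p / q = n / q" if "q \<noteq> 0" "q - p = n" for p q n :: real
        using that by (auto simp: diff_divide_distrib)
      have nz: "x \<noteq> 0" "x + M + 1 \<noteq> 0" "x + y \<noteq> 0" "x + M + 1 - y \<noteq> 0" "x + y + 1 \<noteq> 0" "x + M - y \<noteq> 0"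
        "x + y + 2 \<noteq> 0" "x + M - 1 - y \<noteq> 0" "y + 1 \<noteq> 0" "M - y \<noteq> 0" using x y M by auto
      have V: "1 - u s k = x * (x + M + 1) / ((x + y) * (x + M + 1 - y))"
        unfolding u_def x_def[symmetric] y_def[symmetric] M_def[symmetric]
        by (rule one_minus, simp only: nz mult_eq_0_iff simp_thms not_False_eq_True,
            simp only: algebra_simps)
      have us: "u (Suc s) k = (y + 1) * (M - y) / ((x + y + 1) * (x + M - y))"
        by (simp add: u_def x_def[symmetric] y_def[symmetric] M_def[symmetric] algebra_simps)
      have uss: "u (Suc (Suc s)) k = (y + 2) * (M - 1 - y) / ((x + y + 2) * (x + M - 1 - y))"
        by (simp add: u_def x_def[symmetric] y_def[symmetric] M_def[symmetric] algebra_simps)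
      have V1: "1 - u (Suc s) k = x * (x + M + 1) / ((x + y + 1) * (x + M - y))"
        unfolding us
        by (rule one_minus, simp only: nz mult_eq_0_iff simp_thms not_False_eq_True,
            simp only: algebra_simps)
      have V2: "1 - u (Suc (Suc s)) k = x * (x + M + 1) / ((x + y + 2) * (x + M - 1 - y))"
        unfolding uss
        by (rule one_minus, simp only: nz mult_eq_0_iff simp_thms not_False_eq_True,
            simp only: algebra_simps)
      have ua: "u (Suc s) (k - 1) = (y + 1) * (M - y) / ((x + y) * (x + M - 1 - y))"
        unfolding u_def k1 y_def[symmetric] M_def[symmetric] by (simp add: y_def algebra_simps)
      have ub: "u (Suc s) (k + 1) = (y + 1) * (M - y) / ((x + y + 2) * (x + M + 1 - y))"
        by (simp add: u_def x_def[symmetric] y_def[symmetric] M_def[symmetric] algebra_simps)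
      have uc: "u (Suc s) k = (y + 1) * (M - y) / ((x + y + 1) * (x + M - y))"
        by (simp add: u_def x_def[symmetric] y_def[symmetric] M_def[symmetric] algebra_simps)
      \<comment> \<open>The factors enter as atoms, so that the identity is a cancellation of monomials.\<close>
      have alg: "(X * P / (B * E))\<^sup>2 / (X * P / (A * D)) *
           (((Y * Z) / (A * F)) * ((Y * Z) / (C * D)) / ((Y * Z) / (B * E))\<^sup>2) = X * P / (C * F)"
        if "X \<noteq> 0" "P \<noteq> 0" "A \<noteq> 0" "B \<noteq> 0" "C \<noteq> 0" "D \<noteq> 0" "E \<noteq> 0" "F \<noteq> 0" "Y \<noteq> 0" "Z \<noteq> 0"
        for X P A B C D E F Y Z :: real
        using that by (simp add: power2_eq_square)
      have "(1 - u (Suc s) k)\<^sup>2 / (1 - u s k)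
          * (u (Suc s) (k - 1) * u (Suc s) (k + 1) / (u (Suc s) k)\<^sup>2) = 1 - u (Suc (Suc s)) k"
        unfolding V V1 V2 unfolding ua ub uc using nz by (intro alg)
      then show ?thesis by simp
    qed
    show "u s 0 = 1" if "1 \<le> s" "s < r" for s
      using that r by (simp add: u_def)
    show "solid_minor (rising N) (Suc s) k > 0 \<or> (k \<ge> 0 * s \<and> u s k > 0)" if "1 \<le> s" "s < r" for s k
      using that r by (auto simp: u_def intro!: divide_pos_pos mult_pos_pos)
  qed (auto simp: rising_pos u_def s)
qed

section \<open>Stability of the recursion in the complex domain\<close>

text \<open>
  The recursion for the defects as an operation on functions, usable both for real and for
  complex arguments; \<open>U\<close> is the defect of order 1.
\<close>

fun defect_rec :: "('a :: field \<Rightarrow> 'a) \<Rightarrow> nat \<Rightarrow> 'a \<Rightarrow> 'a" where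
  "defect_rec U 0 z = 0"
| "defect_rec U (Suc 0) z = U z"
| "defect_rec U (Suc (Suc s)) z = 1 - (1 - defect_rec U (Suc s) z)\<^sup>2 / (1 - defect_rec U s z)
     * (defect_rec U (Suc s) (z - 1) * defect_rec U (Suc s) (z + 1) / (defect_rec U (Suc s) z)\<^sup>2)"

lemma defect_rec_of_real:
  assumes "\<And>x. V (of_real x) = complex_of_real (U x)"
  shows "defect_rec V s (complex_of_real x) = of_real (defect_rec U s x)"
proof (induction s arbitrary: x rule: induct_nat_012)
  case (ge2 s)
  have "complex_of_real x - 1 = of_real (x - 1)" "complex_of_real x + 1 = of_real (x + 1)" by auto
  then show ?case by (simp only: defect_rec.simps ge2) simp
qed (use assms in auto)

text \<open>
  By Cauchy's inequalities on the circle of radius \<open>R / 2\<close>, a function with a double zero at 0 is of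
  size \<open>O(M / R\<^sup>2)\<close> at 1.
\<close>

lemma norm_le_of_double_zero:
  fixes E :: "complex \<Rightarrow> complex"
  assumes hol: "E holomorphic_on ball 0 R" and R: "R \<ge> 4"
    and bound: "\<And>t. t \<in> ball 0 R \<Longrightarrow> norm (E t) \<le> M"
    and zero: "E 0 = 0" "deriv E 0 = 0"
  shows "norm (E 1) \<le> 8 * M / R\<^sup>2"
proof -
  define q where "q = 2 / R"
  have q: "0 < q" "q \<le> 1 / 2" using R by (auto simp: q_def divide_simps)
  have "norm (E 0) \<le> M" using R by (intro bound) auto
  then have M: "M \<ge> 0" using norm_ge_zero[of "E 0"] by linarith
  have coeff: "norm ((deriv ^^ n) E 0 / fact n) \<le> M * q ^ n" for n
  proof -
    have "norm ((deriv ^^ n) E 0) \<le> fact n * M / (R / 2) ^ n"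
    proof (rule Cauchy_inequality)
      show "E holomorphic_on ball 0 (R / 2)" using hol R by (auto elim: holomorphic_on_subset)
      show "continuous_on (cball 0 (R / 2)) E"
        using R by (intro holomorphic_on_imp_continuous_on[OF holomorphic_on_subset[OF hol]]) auto
      show "norm (E x) \<le> M" if "norm (0 - x) = R / 2" for x using that R by (intro bound) auto
    qed (use R in auto)
    then show ?thesis by (simp add: norm_divide q_def field_simps power_divide)
  qed
  have sums: "(\<lambda>n. (deriv ^^ n) E 0 / fact n * (1 - 0) ^ n) sums E 1"
    using R by (intro holomorphic_power_series[OF hol]) auto
  then have "(\<lambda>n. (deriv ^^ (n + 2)) E 0 / fact (n + 2)) sums
      (E 1 - (\<Sum>n<2. (deriv ^^ n) E 0 / fact n))"
    by (subst sums_iff_shift) simp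
  then have sums2: "(\<lambda>n. (deriv ^^ (n + 2)) E 0 / fact (n + 2)) sums E 1"
    using zero by (simp add: numeral_2_eq_2)
  have geo: "(\<lambda>n. M * q\<^sup>2 * q ^ n) sums (M * q\<^sup>2 * (1 / (1 - q)))"
    using q by (intro sums_mult geometric_sums) auto
  have "norm (E 1) \<le> M * q\<^sup>2 * (1 / (1 - q))"
  proof (rule norm_sums_le[OF sums2 geo])
    show "norm ((deriv ^^ (n + 2)) E 0 / fact (n + 2)) \<le> M * q\<^sup>2 * q ^ n" for n
      using coeff[of "n + 2"] by (simp only: power_add mult_ac)
  qed
  also have "\<dots> \<le> M * q\<^sup>2 * 2"
    using q M by (intro mult_left_mono) (auto simp: field_simps)
  also have "\<dots> = 8 * M / R\<^sup>2" by (simp add: q_def power_divide)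
  finally show ?thesis .
qed

text \<open>
  A second difference in multiplicative form: \<open>B(z - t) B(z + t) - B(z)\<^sup>2\<close> is even in \<open>t\<close>, and therefore
  has a double zero at \<open>t = 0\<close>.
\<close>

lemma symmetric_product_bound:
  fixes B :: "complex \<Rightarrow> complex"
  assumes hol: "B holomorphic_on ball z R" and R: "R \<ge> 4"
    and bound: "\<And>w. w \<in> ball z R \<Longrightarrow> norm (B w) \<le> b"
  shows "norm (B (z - 1) * B (z + 1) - (B z)\<^sup>2) \<le> 16 * b\<^sup>2 / R\<^sup>2"
proof -
  define E where "E = (\<lambda>t. B (z - t) * B (z + t) - (B z)\<^sup>2)"
  have "norm (B z) \<le> b" using R by (intro bound) auto
  then have b: "b \<ge> 0" using norm_ge_zero[of "B z"] by linarith
  have in_ball: "z - t \<in> ball z R" "z + t \<in> ball z R" if "t \<in> ball 0 R" for t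
    using that by (auto simp: dist_norm)
  have holE: "E holomorphic_on ball 0 R"
    unfolding E_def
    by (intro holomorphic_intros holomorphic_on_compose_gen[OF _ hol, unfolded o_def])
       (use in_ball in auto)
  have z: "z \<in> ball z R" using R by auto
  have B': "(B has_field_derivative deriv B z) (at z)"
    using hol z by (intro holomorphic_derivI) auto
  have "(E has_field_derivative (- deriv B z * B z + B z * deriv B z - 0)) (at 0)"
    unfolding E_def
    by (rule derivative_eq_intros DERIV_chain2[where f = B and x = 0] B' refl | simp add: B')+
  then have dE: "deriv E 0 = 0" by (auto dest: DERIV_imp_deriv)
  have "norm (E 1) \<le> 8 * (2 * b\<^sup>2) / R\<^sup>2"
  proof (rule norm_le_of_double_zero[OF holE R])
    show "norm (E t) \<le> 2 * b\<^sup>2" if "t \<in> ball 0 R" for t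
    proof -
      have "norm (E t) \<le> norm (B (z - t)) * norm (B (z + t)) + (norm (B z))\<^sup>2"
        unfolding E_def by (metis norm_triangle_ineq4 norm_mult norm_power)
      also have "\<dots> \<le> b * b + b\<^sup>2"
        using in_ball[OF that] z b bound
        by (intro add_mono mult_mono power_mono) auto
      finally show ?thesis by (simp add: power2_eq_square)
    qed
  qed (use dE in \<open>auto simp: E_def power2_eq_square\<close>)
  then show ?thesis by (simp add: E_def)
qed

text \<open>
  One step of the recursion near an arithmetic progression \<open>(n - 1) u, n u, (n + 1) u\<close>. The identity
  \<open>(1 - B)\<^sup>2 / (1 - A) = 1 - 2 B + A + (B - A)\<^sup>2 / (1 - A)\<close> exhibits the linear extrapolation \<open>2 B - A\<close>, up to a
  term quadratic in \<open>u\<close>; the second differences contribute \<open>O(1 / R\<^sup>2)\<close>, however small \<open>u\<close> is. This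
  is why \<open>1 / R\<^sup>2\<close> has to be small compared with \<open>u\<close> later.
\<close>

lemma defect_step_bound:
  fixes A B :: "complex \<Rightarrow> complex" and n u R \<eta> :: real
  assumes holA: "A holomorphic_on ball c R" and holB: "B holomorphic_on ball c R"
    and n: "n \<ge> 1" and u: "u > 0" and \<eta>: "0 \<le> \<eta>" "\<eta> \<le> 1 / 2" and R: "R \<ge> 8" and nu: "(n + 1) * u \<le> 1 / 2"
    and A: "\<And>z. z \<in> ball c R \<Longrightarrow> norm (A z - of_real ((n - 1) * u)) \<le> \<eta> * u"
    and B: "\<And>z. z \<in> ball c R \<Longrightarrow> norm (B z - of_real (n * u)) \<le> \<eta> * u"
  defines "C \<equiv> \<lambda>z. 1 - (1 - B z)\<^sup>2 / (1 - A z) * (B (z - 1) * B (z + 1) / (B z)\<^sup>2)"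
  shows "C holomorphic_on ball c (R / 2)"
    and "z \<in> ball c (R / 2) \<Longrightarrow>
      norm (C z - of_real ((n + 1) * u)) \<le> 3 * \<eta> * u + 8 * u\<^sup>2 + 4608 / R\<^sup>2"
proof -
  have \<eta>u: "\<eta> * u \<le> u / 2" using \<eta> u by (simp add: field_simps)
  have u2: "u \<le> n * u" using n u by simp
  have exp: "(n + 1) * u = n * u + u" "(n - 1) * u = n * u - u" by (auto simp: algebra_simps)
  have nA: "norm (A z) \<le> 1 / 2" if "z \<in> ball c R" for z
  proof -
    have "norm (A z) \<le> norm (A z - of_real ((n - 1) * u)) + norm (complex_of_real ((n - 1) * u))"
      using norm_triangle_ineq[of "A z - of_real ((n - 1) * u)" "of_real ((n - 1) * u)"] by simp
    also have "norm (complex_of_real ((n - 1) * u)) = (n - 1) * u"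
      unfolding norm_of_real using n u by (intro abs_of_nonneg) auto
    finally show ?thesis using A[OF that] nu \<eta>u u unfolding exp by linarith
  qed
  have nB: "norm (B z) \<le> 3 / 2 * (n * u)" "norm (B z) \<ge> n * u / 2" "norm (B z) \<le> 1 / 2"
    if "z \<in> ball c R" for z
  proof -
    have nn: "norm (complex_of_real (n * u)) = n * u"
      unfolding norm_of_real using n u by (intro abs_of_nonneg) auto
    have 1: "norm (B z) \<le> norm (B z - of_real (n * u)) + norm (complex_of_real (n * u))"
      using norm_triangle_ineq[of "B z - of_real (n * u)" "of_real (n * u)"] by simp
    have 2: "norm (complex_of_real (n * u)) \<le> norm (B z) + norm (B z - of_real (n * u))"
      using norm_triangle_ineq4[of "B z" "B z - of_real (n * u)"] by simp
    note 3 = B[OF that]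
    show "norm (B z) \<le> 3 / 2 * (n * u)" using 1 3 nn \<eta>u u2 by linarith
    show "norm (B z) \<ge> n * u / 2" using 2 3 nn \<eta>u u2 by linarith
    show "norm (B z) \<le> 1 / 2" using 1 3 nn \<eta>u nu u unfolding exp by linarith
  qed
  have nu0: "n * u > 0" using n u by simp
  have sub: "ball c (R / 2) \<subseteq> ball c R" using R by auto
  have shift: "z - 1 \<in> ball c R" "z + 1 \<in> ball c R" "ball z (R / 2) \<subseteq> ball c R"
    if "z \<in> ball c (R / 2)" for z
  proof -
    show s: "ball z (R / 2) \<subseteq> ball c R"
    proof
      fix w assume "w \<in> ball z (R / 2)"
      then show "w \<in> ball c R" using that dist_triangle[of c w z] by auto
    qed
    show "z - 1 \<in> ball c R" "z + 1 \<in> ball c R" using R by (rule_tac subsetD[OF s], simp add: dist_norm)+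
  qed
  have A1: "1 - A z \<noteq> 0" if "z \<in> ball c R" for z using nA[OF that] by auto
  have B0: "B z \<noteq> 0" if "z \<in> ball c R" for z using nB(2)[OF that] nu0 by auto
  have hA: "A holomorphic_on ball c (R / 2)" and hB: "B holomorphic_on ball c (R / 2)"
    using holA holB sub by (auto elim: holomorphic_on_subset)
  have hBm: "(\<lambda>z. B (z - 1)) holomorphic_on ball c (R / 2)"
    by (rule holomorphic_on_compose_gen[OF _ holB, unfolded o_def])
       (use shift in \<open>auto intro!: holomorphic_intros\<close>)
  have hBp: "(\<lambda>z. B (z + 1)) holomorphic_on ball c (R / 2)"
    by (rule holomorphic_on_compose_gen[OF _ holB, unfolded o_def])
       (use shift in \<open>auto intro!: holomorphic_intros\<close>)
  show "C holomorphic_on ball c (R / 2)"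
    unfolding C_def using A1 B0 sub by (intro holomorphic_intros hA hB hBm hBp) auto
  assume z: "z \<in> ball c (R / 2)"
  then have z': "z \<in> ball c R" using sub by blast
  define Q where "Q = B (z - 1) * B (z + 1) / (B z)\<^sup>2"
  have num: "norm (B (z - 1) * B (z + 1) - (B z)\<^sup>2) \<le> 16 * (3 / 2 * (n * u))\<^sup>2 / (R / 2)\<^sup>2"
    using shift(3)[OF z] R nB(1)
    by (intro symmetric_product_bound holomorphic_on_subset[OF holB]) auto
  have Q: "norm (Q - 1) \<le> 576 / R\<^sup>2"
  proof -
    have "norm (Q - 1) = norm (B (z - 1) * B (z + 1) - (B z)\<^sup>2) / (norm (B z))\<^sup>2"
      using B0[OF z'] by (simp add: Q_def norm_divide[symmetric] norm_power[symmetric] diff_divide_distrib del: norm_divide norm_power)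
    also have "\<dots> \<le> (16 * (3 / 2 * (n * u))\<^sup>2 / (R / 2)\<^sup>2) / (n * u / 2)\<^sup>2"
      using num nB(2)[OF z'] nu0 by (intro frac_le power_mono) auto
    also have "\<dots> = 576 / R\<^sup>2" using nu0 R n u by (simp add: power2_eq_square field_simps)
    finally show ?thesis .
  qed
  have dA: "norm (1 - A z) \<ge> 1 / 2"
    using norm_triangle_ineq2[of 1 "A z"] nA[OF z'] by simp
  have T1: "norm ((B z - A z)\<^sup>2 / (1 - A z)) \<le> 8 * u\<^sup>2"
  proof -
    have "B z - A z = (B z - of_real (n * u)) - (A z - of_real ((n - 1) * u)) + of_real u"
      by (simp add: algebra_simps)
    then have "norm (B z - A z) \<le> norm (B z - of_real (n * u)) + norm (A z - of_real ((n - 1) * u)) + u"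
      using u by (metis (no_types, lifting) abs_of_pos add_right_mono norm_of_real norm_triangle_ineq norm_triangle_ineq4 order_trans)
    then have "norm (B z - A z) \<le> 2 * u" using A[OF z'] B[OF z'] \<eta>u by linarith
    then have "norm (B z - A z) ^ 2 / norm (1 - A z) \<le> (2 * u)\<^sup>2 / (1 / 2)"
      using dA u by (intro frac_le power_mono) auto
    then show ?thesis by (simp add: norm_divide norm_power power_mult_distrib)
  qed
  have T2: "norm ((1 - B z)\<^sup>2 / (1 - A z) * (Q - 1)) \<le> 4608 / R\<^sup>2"
  proof -
    have "norm (1 - B z) \<le> 2" using norm_triangle_ineq4[of 1 "B z"] nB(3)[OF z'] by simp
    then have "norm (1 - B z) ^ 2 / norm (1 - A z) \<le> 2\<^sup>2 / (1 / 2)"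
      using dA by (intro frac_le power_mono) auto
    then have "norm (1 - B z) ^ 2 / norm (1 - A z) * norm (Q - 1) \<le> 8 * (576 / R\<^sup>2)"
      using Q by (intro mult_mono) auto
    then show ?thesis by (simp add: norm_divide norm_power norm_mult)
  qed
  have expand: "C z - of_real ((n + 1) * u) = 2 * (B z - of_real (n * u)) - (A z - of_real ((n - 1) * u))
      - (B z - A z)\<^sup>2 / (1 - A z) - (1 - B z)\<^sup>2 / (1 - A z) * (Q - 1)"
  proof -
    have "(1 - B z)\<^sup>2 / (1 - A z) = 1 - 2 * B z + A z + (B z - A z)\<^sup>2 / (1 - A z)"
      using A1[OF z'] by (simp add: divide_simps) (simp add: power2_eq_square algebra_simps)
    moreover have "C z = 1 - (1 - B z)\<^sup>2 / (1 - A z) - (1 - B z)\<^sup>2 / (1 - A z) * (Q - 1)"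
      by (simp add: C_def Q_def algebra_simps)
    moreover have "c' - of_real ((n + 1) * u) = 2 * (b - of_real (n * u)) - (a - of_real ((n - 1) * u)) - y - d"
      if "x = 1 - 2 * b + a + y" "c' = 1 - x - d" for a b c' d x y :: complex
      unfolding that(2) unfolding that(1) by (simp add: algebra_simps)
    ultimately show ?thesis by blast
  qed
  have tri: "norm (2 * a - b - e - d) \<le> 2 * norm a + norm b + norm e + norm d" for a b d e :: complex
  proof -
    have "norm (2 * a - b - e - d) \<le> norm (2 * a) + norm b + norm e + norm d"
      by (meson add_mono_thms_linordered_semiring(3) norm_triangle_ineq4 order_trans)
    then show ?thesis by (simp add: norm_mult)
  qed
  have "norm (C z - of_real ((n + 1) * u)) \<le> 2 * norm (B z - of_real (n * u))
      + norm (A z - of_real ((n - 1) * u)) + norm ((B z - A z)\<^sup>2 / (1 - A z))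
      + norm ((1 - B z)\<^sup>2 / (1 - A z) * (Q - 1))"
    unfolding expand by (rule tri)
  also have "\<dots> \<le> 2 * (\<eta> * u) + \<eta> * u + 8 * u\<^sup>2 + 4608 / R\<^sup>2"
    using A[OF z'] B[OF z'] T1 T2 by (intro add_mono mult_left_mono) auto
  finally show "norm (C z - of_real ((n + 1) * u)) \<le> 3 * \<eta> * u + 8 * u\<^sup>2 + 4608 / R\<^sup>2" by simp
qed

text \<open>
  In each step the relative error at most quadruples and the radius is halved. Since \<open>1 / R\<^sup>2\<close>
  quadruples as well, one condition on the initial radius serves all steps.
\<close>

lemma defect_rec_bound:
  fixes U :: "complex \<Rightarrow> complex" and u R \<eta> :: real
  assumes hol: "U holomorphic_on ball c R"
    and U: "\<And>z. z \<in> ball c R \<Longrightarrow> norm (U z - of_real u) \<le> \<eta> * u"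
    and u: "u > 0" and \<eta>: "0 < \<eta>" "4 ^ r * \<eta> \<le> 1 / 2" "16 * u \<le> \<eta>" "(real r + 1) * u \<le> 1 / 2"
    and R: "R \<ge> 8 * 2 ^ r" "9216 \<le> \<eta> * u * R\<^sup>2"
  shows "s \<le> r \<Longrightarrow> defect_rec U s holomorphic_on ball c (R / 2 ^ s)
     \<and> (\<forall>z\<in>ball c (R / 2 ^ s). norm (defect_rec U s z - of_real (real s * u)) \<le> 4 ^ s * \<eta> * u)"
proof (induction s rule: induct_nat_012)
  case 0
  have "defect_rec U 0 = (\<lambda>z. 0)" by auto
  then show ?case using \<eta> u by simp
next
  case 1
  have "defect_rec U (Suc 0) = U" by auto
  moreover have R0: "R > 0" using R(1) by (rule less_le_trans[rotated]) simp
  moreover have "norm (U z - of_real u) \<le> 4 * \<eta> * u" if "z \<in> ball c (R / 2)" for z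
  proof -
    have "norm (U z - of_real u) \<le> \<eta> * u" using that R0 by (intro U) auto
    moreover have "0 < \<eta> * u" using \<eta> u by simp
    ultimately show ?thesis by simp
  qed
  ultimately show ?case
    using hol by (auto elim!: holomorphic_on_subset)
next
  case (ge2 s)
  define R' where "R' = R / 2 ^ Suc s"
  define \<eta>' where "\<eta>' = 4 ^ Suc s * \<eta>"
  have R0: "R > 0" using R(1) by (rule less_le_trans[rotated]) simp
  have A: "defect_rec U s holomorphic_on ball c R'"
     "\<And>z. z \<in> ball c R' \<Longrightarrow> norm (defect_rec U s z - of_real ((real (Suc s) - 1) * u)) \<le> \<eta>' * u"
  proof -
    have sub: "ball c R' \<subseteq> ball c (R / 2 ^ s)"
      unfolding R'_def using R0 by (intro subset_ball) (simp add: field_simps)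
    show "defect_rec U s holomorphic_on ball c R'"
      using ge2 sub by (auto elim: holomorphic_on_subset)
    fix z assume "z \<in> ball c R'"
    then have "norm (defect_rec U s z - of_real (real s * u)) \<le> 4 ^ s * \<eta> * u" using ge2 sub by auto
    also have "\<dots> \<le> \<eta>' * u" using \<eta> u by (simp add: \<eta>'_def)
    finally show "norm (defect_rec U s z - of_real ((real (Suc s) - 1) * u)) \<le> \<eta>' * u" by simp
  qed
  have B: "defect_rec U (Suc s) holomorphic_on ball c R'"
     "\<And>z. z \<in> ball c R' \<Longrightarrow> norm (defect_rec U (Suc s) z - of_real (real (Suc s) * u)) \<le> \<eta>' * u"
    using ge2 by (auto simp: R'_def \<eta>'_def)
  have \<eta>': "0 \<le> \<eta>'" "\<eta>' \<le> 1 / 2"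
  proof -
    have "\<eta>' \<le> 4 ^ r * \<eta>"
      unfolding \<eta>'_def using ge2.prems \<eta> by (intro mult_right_mono power_increasing) auto
    then show "\<eta>' \<le> 1 / 2" using \<eta> by simp
    show "0 \<le> \<eta>'" using \<eta> by (simp add: \<eta>'_def)
  qed
  have R': "R' \<ge> 8"
  proof -
    have "8 * 2 ^ Suc s \<le> (8 * 2 ^ r :: real)" using ge2.prems by (intro mult_left_mono power_increasing) auto
    also have "\<dots> \<le> R" by (rule R)
    finally show ?thesis by (simp add: R'_def field_simps)
  qed
  have su: "(real (Suc s) + 1) * u \<le> 1 / 2"
  proof -
    have "(real (Suc s) + 1) * u \<le> (real r + 1) * u" using ge2.prems u by (intro mult_right_mono) auto
    then show ?thesis using \<eta> by simp
  qed
  have eq: "defect_rec U (Suc (Suc s)) = (\<lambda>z. 1 - (1 - defect_rec U (Suc s) z)\<^sup>2 / (1 - defect_rec U s z)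
     * (defect_rec U (Suc s) (z - 1) * defect_rec U (Suc s) (z + 1) / (defect_rec U (Suc s) z)\<^sup>2))"
    by auto
  note step = defect_step_bound[OF A(1) B(1) _ u \<eta>' R' su A(2) B(2)]
  have half: "R' / 2 = R / 2 ^ Suc (Suc s)" by (simp add: R'_def)
  have err: "3 * \<eta>' * u + 8 * u\<^sup>2 + 4608 / R'\<^sup>2 \<le> 4 ^ Suc (Suc s) * \<eta> * u"
  proof -
    have "8 * u\<^sup>2 \<le> \<eta> * u / 2" using \<eta>(3) u by (simp add: power2_eq_square)
    also have "\<dots> \<le> \<eta>' * u / 2"
      using \<eta> u one_le_power[of "4 :: real" "Suc s"] by (simp add: \<eta>'_def del: one_le_power)
    finally have 1: "8 * u\<^sup>2 \<le> \<eta>' * u / 2" .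
    have "(2 ^ Suc s)\<^sup>2 = ((2 :: real)\<^sup>2) ^ Suc s"
      by (simp only: power_mult[symmetric] mult.commute)
    then have "4608 / R'\<^sup>2 = 4 ^ Suc s * (4608 / R\<^sup>2)"
      by (simp add: R'_def power_divide)
    also have "4608 / R\<^sup>2 \<le> \<eta> * u / 2" using R(2) R0 by (simp add: field_simps)
    finally have 2: "4608 / R'\<^sup>2 \<le> \<eta>' * u / 2" by (simp add: \<eta>'_def)
    have "4 ^ Suc (Suc s) * \<eta> * u = 4 * (\<eta>' * u)" by (simp add: \<eta>'_def)
    then show ?thesis using 1 2 by linarith
  qed
  show ?case
  proof (intro conjI ballI)
    show "defect_rec U (Suc (Suc s)) holomorphic_on ball c (R / 2 ^ Suc (Suc s))"
      using step(1) unfolding half eq by simp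
    fix z assume z: "z \<in> ball c (R / 2 ^ Suc (Suc s))"
    have "norm (defect_rec U (Suc (Suc s)) z - of_real ((real (Suc s) + 1) * u))
       \<le> 3 * \<eta>' * u + 8 * u\<^sup>2 + 4608 / R'\<^sup>2"
      using z unfolding half[symmetric] defect_rec.simps by (intro step(2)) auto
    then show "norm (defect_rec U (Suc (Suc s)) z - of_real (real (Suc (Suc s)) * u)) \<le> 4 ^ Suc (Suc s) * \<eta> * u"
      using err by (simp add: add_ac)
  qed
qed

section \<open>Sequences with given negative zeros\<close>

lemma norm_prod_one_minus_le:
  fixes x :: "'i \<Rightarrow> complex"
  assumes "finite I" "(\<Sum>i\<in>I. norm (x i)) \<le> 1"
  shows "norm ((\<Prod>i\<in>I. 1 - x i) - 1 + (\<Sum>i\<in>I. x i)) \<le> (\<Sum>i\<in>I. norm (x i))\<^sup>2"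
  using assms
proof (induction I rule: finite_induct)
  case (insert j I)
  define p where "p = (\<Prod>i\<in>I. 1 - x i)"
  define t where "t = (\<Sum>i\<in>I. x i)"
  define S where "S = (\<Sum>i\<in>I. norm (x i))"
  have S: "0 \<le> S" "S + norm (x j) \<le> 1"
    using insert by (auto simp: S_def intro: sum_nonneg)
  then have S1: "S \<le> 1" using norm_ge_zero[of "x j"] by linarith
  have IH: "norm (p - 1 + t) \<le> S\<^sup>2" using insert S1 by (simp add: p_def t_def S_def)
  have "norm (p - 1) \<le> norm (p - 1 + t) + norm t"
    using norm_triangle_ineq4[of "p - 1 + t" t] by simp
  also have "norm t \<le> S" unfolding t_def S_def by (rule norm_sum)
  also have "norm (p - 1 + t) \<le> S" using IH S S1 by (smt (verit) mult_left_le power2_eq_square)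
  finally have p1: "norm (p - 1) \<le> 2 * S" by simp
  have "(1 - x j) * p - 1 + (x j + t) = (p - 1 + t) - x j * (p - 1)" by (simp add: algebra_simps)
  then have "norm ((1 - x j) * p - 1 + (x j + t)) \<le> norm (p - 1 + t) + norm (x j) * norm (p - 1)"
    by (metis norm_mult norm_triangle_ineq4)
  also have "\<dots> \<le> S\<^sup>2 + norm (x j) * (2 * S)"
    using IH p1 by (intro add_mono mult_left_mono) auto
  also have "\<dots> \<le> (norm (x j) + S)\<^sup>2" by (simp add: power2_eq_square algebra_simps)
  finally show ?case using insert by (simp add: p_def t_def S_def)
qed simp

lemma norm_inverse_square_perturb:
  fixes \<theta> :: complex
  assumes "norm \<theta> \<le> \<rho>" "\<rho> \<le> 1 / 16"
  shows "norm (1 / (1 + \<theta>)\<^sup>2 - 1) \<le> 4 * \<rho>"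
proof -
  have \<rho>: "\<rho> \<ge> 0" using assms(1) norm_ge_zero[of \<theta>] by linarith
  have d: "norm (1 + \<theta>) \<ge> 15 / 16" using norm_triangle_ineq2[of 1 "- \<theta>"] assms by simp
  then have nz: "1 + \<theta> \<noteq> 0" by auto
  have "1 / (1 + \<theta>)\<^sup>2 - 1 = - (\<theta> * (2 + \<theta>)) / (1 + \<theta>)\<^sup>2"
    using nz by (simp add: divide_simps) (simp add: power2_eq_square algebra_simps)
  then have "norm (1 / (1 + \<theta>)\<^sup>2 - 1) = norm \<theta> * norm (2 + \<theta>) / (norm (1 + \<theta>))\<^sup>2"
    by (simp add: norm_divide norm_mult norm_power)
  also have "\<dots> \<le> \<rho> * (2 + 1 / 16) / (15 / 16)\<^sup>2"
    using assms d \<rho> norm_triangle_ineq[of 2 \<theta>] by (intro frac_le mult_mono power_mono) auto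
  also have "\<dots> \<le> 4 * \<rho>" using \<rho> by (simp add: power2_eq_square)
  finally show ?thesis .
qed

text \<open>
  The defect of order 1 of the sequence \<open>\<Prod>i. (k + \<mu> i)\<close> is almost constant on a disc about \<open>c\<close> of radius
  \<open>\<rho> c\<close>: relative to \<open>c + \<mu> i\<close> the displacement is at most \<open>\<rho>\<close>, whatever the size of \<open>\<mu> i > 0\<close>.
\<close>

lemma first_defect_bound:
  fixes \<mu> :: "'i \<Rightarrow> real" and c \<rho> :: real
  assumes fin: "finite I" and \<mu>: "\<And>i. i \<in> I \<Longrightarrow> \<mu> i > 0" and c: "c > 0" and \<rho>: "0 < \<rho>" "\<rho> \<le> 1 / 16"
  defines "W \<equiv> \<Sum>i\<in>I. 1 / (c + \<mu> i)\<^sup>2"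
  defines "U \<equiv> \<lambda>z :: complex. 1 - (\<Prod>i\<in>I. 1 - 1 / (z + of_real (\<mu> i))\<^sup>2)"
  assumes W: "W \<le> 1 / 2"
  shows "U holomorphic_on ball (of_real c) (\<rho> * c)"
    and "z \<in> ball (of_real c) (\<rho> * c) \<Longrightarrow> norm (U z - of_real W) \<le> (4 * \<rho> + 4 * W) * W"
proof -
  have rel: "norm ((z - of_real c) / of_real (c + \<mu> i)) \<le> \<rho>" "z + of_real (\<mu> i) \<noteq> 0"
    if z: "z \<in> ball (of_real c) (\<rho> * c)" and i: "i \<in> I" for z :: complex and i
  proof -
    have "norm (z - of_real c) \<le> \<rho> * c" using z by (simp add: dist_norm norm_minus_commute)
    also have "\<dots> \<le> \<rho> * (c + \<mu> i)" using \<mu>[OF i] \<rho> by simp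
    finally have "norm (z - of_real c) / (c + \<mu> i) \<le> \<rho>" using \<mu>[OF i] c by (simp add: divide_le_eq)
    moreover have "norm (complex_of_real (c + \<mu> i)) = c + \<mu> i"
      unfolding norm_of_real using \<mu>[OF i] c by simp
    ultimately show n: "norm ((z - of_real c) / of_real (c + \<mu> i)) \<le> \<rho>"
      by (simp only: norm_divide)
    show "z + of_real (\<mu> i) \<noteq> 0"
    proof
      assume "z + of_real (\<mu> i) = 0"
      then have "z - of_real c = - of_real (c + \<mu> i)" by (simp add: algebra_simps eq_neg_iff_add_eq_0)
      then have "norm ((z - of_real c) / of_real (c + \<mu> i)) = 1"
        using \<mu>[OF i] c by (simp only: norm_divide norm_minus_cancel norm_of_real) simp
      then show False using n \<rho> by simp
    qed
  qed
  show "U holomorphic_on ball (of_real c) (\<rho> * c)"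
    unfolding U_def using rel(2) by (intro holomorphic_intros) auto
  assume z: "z \<in> ball (of_real c) (\<rho> * c)"
  define x where "x = (\<lambda>i. 1 / (z + of_real (\<mu> i))\<^sup>2)"
  have err: "norm (x i - of_real (1 / (c + \<mu> i)\<^sup>2)) \<le> 4 * \<rho> * (1 / (c + \<mu> i)\<^sup>2)" if i: "i \<in> I" for i
  proof -
    define m where "m = complex_of_real (c + \<mu> i)"
    define \<theta> where "\<theta> = (z - of_real c) / m"
    have m0: "m \<noteq> 0" using \<mu>[OF i] c by (simp add: m_def del: of_real_add)
    have "z + of_real (\<mu> i) = m * (1 + \<theta>)"
      using m0 by (simp add: \<theta>_def field_simps) (simp add: m_def algebra_simps)
    then have "x i = 1 / m\<^sup>2 * (1 / (1 + \<theta>)\<^sup>2)" by (simp add: x_def power_mult_distrib)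
    moreover have "complex_of_real (1 / (c + \<mu> i)\<^sup>2) = 1 / m\<^sup>2" by (simp add: m_def)
    ultimately have "x i - of_real (1 / (c + \<mu> i)\<^sup>2) = of_real (1 / (c + \<mu> i)\<^sup>2) * (1 / (1 + \<theta>)\<^sup>2 - 1)"
      by (simp only: right_diff_distrib) simp
    then have "norm (x i - of_real (1 / (c + \<mu> i)\<^sup>2)) = 1 / (c + \<mu> i)\<^sup>2 * norm (1 / (1 + \<theta>)\<^sup>2 - 1)"
      by (simp only: norm_mult norm_of_real) simp
    also have "\<dots> \<le> 1 / (c + \<mu> i)\<^sup>2 * (4 * \<rho>)"
      using rel(1)[OF z i] \<rho> by (intro mult_left_mono norm_inverse_square_perturb) (auto simp: \<theta>_def m_def)
    finally show ?thesis by (simp add: mult.commute)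
  qed
  have W0: "W \<ge> 0" unfolding W_def by (intro sum_nonneg) auto
  have "norm ((\<Sum>i\<in>I. x i) - of_real W) \<le> (\<Sum>i\<in>I. norm (x i - of_real (1 / (c + \<mu> i)\<^sup>2)))"
    unfolding W_def of_real_sum sum_subtractf[symmetric] by (rule norm_sum)
  also have "\<dots> \<le> (\<Sum>i\<in>I. 4 * \<rho> * (1 / (c + \<mu> i)\<^sup>2))" by (intro sum_mono err)
  also have "\<dots> = 4 * \<rho> * W" by (simp only: W_def sum_distrib_left)
  finally have sum_err: "norm ((\<Sum>i\<in>I. x i) - of_real W) \<le> 4 * \<rho> * W" .
  define S where "S = (\<Sum>i\<in>I. norm (x i))"
  have "S \<le> (\<Sum>i\<in>I. 2 * (1 / (c + \<mu> i)\<^sup>2))"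
    unfolding S_def
  proof (rule sum_mono)
    fix i assume i: "i \<in> I"
    define w where "w = 1 / (c + \<mu> i)\<^sup>2"
    have w: "w \<ge> 0" by (simp add: w_def)
    have "norm (x i) \<le> norm (x i - of_real w) + norm (complex_of_real w)"
      using norm_triangle_ineq[of "x i - of_real w" "of_real w"] by simp
    also have "norm (complex_of_real w) = w" using w by simp
    also have "norm (x i - of_real w) \<le> 4 * \<rho> * w" using err[OF i] by (simp only: w_def)
    also have "4 * \<rho> * w \<le> w" using \<rho> w by (simp add: mult_left_le_one_le)
    finally show "norm (x i) \<le> 2 * (1 / (c + \<mu> i)\<^sup>2)" by (simp add: w_def)
  qed
  also have "\<dots> = 2 * W" by (simp only: W_def sum_distrib_left)
  finally have S: "S \<le> 2 * W" .
  have S0: "S \<ge> 0" unfolding S_def by (intro sum_nonneg) auto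
  have prod_err: "norm ((\<Prod>i\<in>I. 1 - x i) - 1 + (\<Sum>i\<in>I. x i)) \<le> S\<^sup>2"
    unfolding S_def using S W by (intro norm_prod_one_minus_le fin) (auto simp: S_def)
  have "U z - of_real W = ((\<Sum>i\<in>I. x i) - of_real W) - ((\<Prod>i\<in>I. 1 - x i) - 1 + (\<Sum>i\<in>I. x i))"
    by (simp add: U_def x_def)
  then have "norm (U z - of_real W) \<le> norm ((\<Sum>i\<in>I. x i) - of_real W) + norm ((\<Prod>i\<in>I. 1 - x i) - 1 + (\<Sum>i\<in>I. x i))"
    by (metis norm_triangle_ineq4)
  also have "\<dots> \<le> 4 * \<rho> * W + (2 * W)\<^sup>2"
    using sum_err prod_err power_mono[OF S S0, of 2] by linarith
  finally show "norm (U z - of_real W) \<le> (4 * \<rho> + 4 * W) * W"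
    by (simp add: power2_eq_square algebra_simps)
qed

text \<open>
  The negatives of the zeros \<open>-1, -2, \<dots>\<close> of \<open>rising\<close> together with those of the additional zeros.
\<close>

definition zeros :: "('i \<Rightarrow> real) \<Rightarrow> nat + 'i \<Rightarrow> real" where
  "zeros \<nu> = case_sum (\<lambda>i. 1 + real i) \<nu>"

lemma zeros_simps [simp]: "zeros \<nu> (Inl i) = 1 + real i" "zeros \<nu> (Inr j) = \<nu> j"
  by (auto simp: zeros_def)

text \<open>
  The first \<open>N\<close> zeros give \<open>W \<ge> N / (4 c\<^sup>2)\<close>, while \<open>1 / R\<^sup>2 = 1 / (\<rho> c)\<^sup>2\<close>. So \<open>N\<close> is chosen after \<open>\<rho>\<close>, and \<open>K\<close>
  after \<open>N\<close>, to make \<open>W\<close> small and the discs large. The additional zeros can only increase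
  \<open>W\<close>, and by at most \<open>1 / c\<close>; hence the constants do not depend on them.
\<close>

lemma defect_rec_pos_far_out:
  fixes r :: nat
  shows "\<exists>N\<ge>r. \<exists>K\<ge>r. \<forall>(B :: 'i set) \<nu>. finite B \<longrightarrow> (\<forall>j\<in>B. \<nu> j > 0) \<longrightarrow> (\<Sum>j\<in>B. 1 / \<nu> j) \<le> 1 \<longrightarrow>
    (\<forall>k\<ge>K. \<forall>s. 1 \<le> s \<longrightarrow> s \<le> r \<longrightarrow>
       defect_rec (\<lambda>x :: real. 1 - (\<Prod>i\<in>{..<N} <+> B. 1 - 1 / (x + zeros \<nu> i)\<^sup>2)) s (real k) > 0)"
proof -
  \<comment> \<open>The admissible initial error, so that after r steps the relative error is still at most 1 / 2.\<close>
  define \<eta> :: real where "\<eta> = 1 / (2 * 4 ^ r)"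
  define \<rho> where "\<rho> = \<eta> / 8"
  define N where "N = nat \<lceil>36864 / (\<eta> * \<rho>\<^sup>2)\<rceil> + r + 1"
  \<comment> \<open>The upper bound for W that keeps the quadratic terms small.\<close>
  define w where "w = min (\<eta> / 16) (1 / (2 * (real r + 1)))"
  define K where "K = r + N + nat \<lceil>(real N + 1) / w\<rceil> + nat \<lceil>8 * 2 ^ r / \<rho>\<rceil>"
  have \<eta>: "0 < \<eta>" "\<eta> \<le> 1 / 2" "4 ^ r * \<eta> \<le> 1 / 2" by (auto simp: \<eta>_def field_simps)
  have \<rho>: "0 < \<rho>" "\<rho> \<le> 1 / 16" using \<eta> by (auto simp: \<rho>_def)
  have w: "0 < w" "w \<le> \<eta> / 16" "w \<le> 1 / (2 * (real r + 1))" using \<eta> by (auto simp: w_def)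
  have Nge: "36864 / (\<eta> * \<rho>\<^sup>2) \<le> real N" unfolding N_def by linarith
  then have Nbig: "36864 \<le> \<eta> * \<rho>\<^sup>2 * real N" using \<eta> \<rho> by (simp add: field_simps)
  show ?thesis
  proof (rule exI[of _ N], rule conjI[OF _ exI[of _ K]]; (intro conjI allI impI)?)
    show "r \<le> N" by (simp add: N_def)
    show "r \<le> K" by (simp add: K_def)
  next
    fix B :: "'i set" and \<nu> :: "'i \<Rightarrow> real" and k s :: nat
    assume fin: "finite B" and \<nu>: "\<forall>j\<in>B. \<nu> j > 0" and sum: "(\<Sum>j\<in>B. 1 / \<nu> j) \<le> 1"
      and k: "K \<le> k" and s: "1 \<le> s" "s \<le> r"
    define c where "c = real k"
    define I where "I = {..<N} <+> B"
    define \<mu> where "\<mu> = zeros \<nu>"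
    define W where "W = (\<Sum>i\<in>I. 1 / (c + \<mu> i)\<^sup>2)"
    have K1: "real N \<le> real K" by (simp add: K_def)
    have K2: "(real N + 1) / w \<le> real K" unfolding K_def by linarith
    have K3: "8 * 2 ^ r / \<rho> \<le> real K" unfolding K_def by linarith
    have kK: "real K \<le> c" using k by (simp add: c_def)
    have N0: "real N \<ge> 1" by (simp add: N_def)
    have c: "c \<ge> real N" "c \<ge> 1" "c > 0" using K1 kK N0 by linarith+
    have W_split: "W = (\<Sum>i<N. 1 / (c + (1 + real i))\<^sup>2) + (\<Sum>j\<in>B. 1 / (c + \<nu> j)\<^sup>2)"
      unfolding W_def I_def \<mu>_def using fin by (simp add: sum.Plus)
    have tail0: "(\<Sum>j\<in>B. 1 / (c + \<nu> j)\<^sup>2) \<ge> 0" by (intro sum_nonneg) auto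
    have "(\<Sum>i<N. 1 / (2 * c)\<^sup>2) \<le> (\<Sum>i<N. 1 / (c + (1 + real i))\<^sup>2)"
      using c by (intro sum_mono divide_left_mono power_mono mult_pos_pos zero_less_power) auto
    then have Wlow: "real N / (4 * c\<^sup>2) \<le> W" using W_split tail0 by simp
    then have W0: "W > 0" using N0 c by (smt (verit) divide_pos_pos zero_less_power mult_pos_pos)
    have "(\<Sum>i<N. 1 / (c + (1 + real i))\<^sup>2) \<le> (\<Sum>i<N. 1 / c)"
    proof (intro sum_mono divide_left_mono)
      fix i :: nat
      have "c * 1 \<le> (c + (1 + real i)) * (c + (1 + real i))" using c by (intro mult_mono) auto
      then show "c \<le> (c + (1 + real i))\<^sup>2" by (simp add: power2_eq_square)
    qed (use c in auto)
    moreover have "(\<Sum>j\<in>B. 1 / (c + \<nu> j)\<^sup>2) \<le> (\<Sum>j\<in>B. 1 / c * (1 / \<nu> j))"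
    proof (intro sum_mono)
      fix j assume "j \<in> B"
      then have "\<nu> j > 0" using \<nu> by auto
      moreover have "c * \<nu> j \<le> (c + \<nu> j) * (c + \<nu> j)" using c \<open>\<nu> j > 0\<close> by (intro mult_mono) auto
      ultimately show "1 / (c + \<nu> j)\<^sup>2 \<le> 1 / c * (1 / \<nu> j)"
        using c by (simp add: power2_eq_square divide_left_mono)
    qed
    moreover have "(\<Sum>j\<in>B. 1 / c * (1 / \<nu> j)) \<le> 1 / c * 1"
      unfolding sum_distrib_left[symmetric] using sum c by (intro mult_left_mono) auto
    ultimately have "W \<le> (real N + 1) / c" unfolding W_split by (simp add: add_divide_distrib)
    moreover have "(real N + 1) / w \<le> c" using K2 kK by linarith
    then have "(real N + 1) / c \<le> w" using c w by (simp add: field_simps)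
    ultimately have Ww: "W \<le> w" by linarith
    have W2: "W \<le> 1 / 2" using Ww w \<eta> by linarith
    have \<mu>0: "\<mu> i > 0" if "i \<in> I" for i
      using that \<nu> by (auto simp: I_def \<mu>_def)
    have finI: "finite I" using fin by (simp add: I_def)
    define U where "U = (\<lambda>z :: complex. 1 - (\<Prod>i\<in>I. 1 - 1 / (z + of_real (\<mu> i))\<^sup>2))"
    define V where "V = (\<lambda>x :: real. 1 - (\<Prod>i\<in>I. 1 - 1 / (x + \<mu> i)\<^sup>2))"
    note first = first_defect_bound[of I \<mu> c \<rho>, folded W_def U_def, OF finI _ c(3) \<rho> W2]
    have bnd: "s \<le> r \<Longrightarrow> defect_rec U s holomorphic_on ball (of_real c) (\<rho> * c / 2 ^ s)
       \<and> (\<forall>z\<in>ball (of_real c) (\<rho> * c / 2 ^ s). norm (defect_rec U s z - of_real (real s * W)) \<le> 4 ^ s * \<eta> * W)"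
    proof (rule defect_rec_bound[OF first(1)])
      fix z assume z: "z \<in> ball (complex_of_real c) (\<rho> * c)"
      have "norm (U z - of_real W) \<le> (4 * \<rho> + 4 * W) * W"
        unfolding U_def using z \<mu>0 by (intro first(2)) auto
      also have "\<dots> \<le> \<eta> * W" using Ww w \<rho> \<eta> W0 by (intro mult_right_mono) (auto simp: \<rho>_def)
      finally show "norm (U z - of_real W) \<le> \<eta> * W" .
    next
      have "W \<le> 1 / (2 * (real r + 1))" using Ww w by linarith
      then have "(real r + 1) * W \<le> (real r + 1) * (1 / (2 * (real r + 1)))" by (intro mult_left_mono) auto
      also have "\<dots> = 1 / 2" by (simp add: field_simps)
      finally show "(real r + 1) * W \<le> 1 / 2" .
    next
      have "8 * 2 ^ r / \<rho> \<le> c" using K3 kK by linarith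
      then show "8 * 2 ^ r \<le> \<rho> * c" using \<rho> by (simp add: field_simps)
    next
      have "9216 \<le> \<eta> * \<rho>\<^sup>2 * real N / 4" using Nbig by simp
      also have "\<dots> = \<eta> * (real N / (4 * c\<^sup>2)) * (\<rho> * c)\<^sup>2"
        using c by (simp add: power_mult_distrib)
      also have "\<dots> \<le> \<eta> * W * (\<rho> * c)\<^sup>2"
        using Wlow \<eta> by (intro mult_right_mono mult_left_mono) auto
      finally show "9216 \<le> \<eta> * W * (\<rho> * c)\<^sup>2" .
    qed (use \<eta> W0 Ww w \<mu>0 in auto)
    have "norm (defect_rec U s (of_real c) - of_real (real s * W)) \<le> 4 ^ s * \<eta> * W"
      using bnd s \<rho> c by auto
    also have "defect_rec U s (of_real c) = of_real (defect_rec V s c)"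
      by (rule defect_rec_of_real) (simp add: U_def V_def)
    also have "norm (complex_of_real (defect_rec V s c) - of_real (real s * W)) = \<bar>defect_rec V s c - real s * W\<bar>"
      by (simp only: of_real_diff[symmetric] norm_of_real)
    also have "4 ^ s * \<eta> * W \<le> 1 / 2 * W"
    proof (rule mult_right_mono)
      have "4 ^ s * \<eta> \<le> 4 ^ r * \<eta>" using s \<eta> by (intro mult_right_mono power_increasing) auto
      then show "4 ^ s * \<eta> \<le> 1 / 2" using \<eta> by linarith
    qed (use W0 in auto)
    finally have "\<bar>defect_rec V s c - real s * W\<bar> \<le> 1 / 2 * W" .
    moreover have "1 * W \<le> real s * W" using s W0 by (intro mult_right_mono) auto
    ultimately have "defect_rec V s c > 0" using W0 by linarith
    then show "defect_rec (\<lambda>x :: real. 1 - (\<Prod>i\<in>{..<N} <+> B. 1 - 1 / (x + zeros \<nu> i)\<^sup>2)) s (real k) > 0"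
      by (simp add: V_def I_def \<mu>_def c_def)
  qed
qed

lemma tendsto_fdet:
  fixes f :: "'a \<Rightarrow> nat \<Rightarrow> nat \<Rightarrow> real"
  assumes "\<And>i j. i < n \<Longrightarrow> j < n \<Longrightarrow> ((\<lambda>x. f x i j) \<longlongrightarrow> l i j) F"
  shows "((\<lambda>x. fdet n (f x)) \<longlongrightarrow> fdet n l) F"
proof -
  have expand: "fdet n g = (\<Sum>p | p permutes {0..<n}. signof p * (\<Prod>i = 0..<n. g i (p i)))"
    for g :: "nat \<Rightarrow> nat \<Rightarrow> real"
    unfolding fdet_def
    by (subst det_def'[of _ n]) (auto intro!: sum.cong prod.cong arg_cong2[where f = "(*)"] dest: permutes_in_image)
  show ?thesis
    unfolding expand
    by (intro tendsto_intros assms) (auto simp: permutes_in_image)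
qed

lemma PF_seq_limit:
  assumes "\<And>n. PF_seq r (a n)" "\<And>k. (\<lambda>n. a n k) \<longlonglongrightarrow> b k"
  shows "PF_seq r b"
  unfolding PF_seq_def
proof (intro allI impI)
  fix k and I J :: "nat \<Rightarrow> nat"
  assume *: "k \<le> r \<and> strict_mono_on {..<k} I \<and> strict_mono_on {..<k} J"
  have minor: "toeplitz_minor c k I J = fdet k (\<lambda>p q. toeplitz c (I p) (J q))" for c
    by (simp add: toeplitz_minor_def fdet_def)
  have "(\<lambda>n. toeplitz_minor (a n) k I J) \<longlonglongrightarrow> toeplitz_minor b k I J"
    unfolding minor by (intro tendsto_fdet) (auto simp: toeplitz_def assms(2))
  then show "toeplitz_minor b k I J \<ge> 0"
    by (rule LIMSEQ_le_const) (use assms(1) * in \<open>auto simp: PF_seq_def\<close>)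
qed

lemma solid_minor_pos_stable:
  assumes "solid_minor a s k > 0"
  shows "\<exists>\<delta>>0. \<forall>b. (\<forall>j\<le>k + s. \<bar>b j - a j\<bar> < \<delta>) \<longrightarrow> solid_minor b s k > 0"
proof (rule ccontr)
  assume neg: "\<not> ?thesis"
  have "\<exists>b. (\<forall>j\<le>k + s. \<bar>b j - a j\<bar> < 1 / real (Suc n)) \<and> \<not> solid_minor b s k > 0" for n
    using neg by (metis of_nat_0_less_iff zero_less_Suc zero_less_divide_1_iff)
  then obtain b where b: "\<And>n j. j \<le> k + s \<Longrightarrow> \<bar>b n j - a j\<bar> < 1 / real (Suc n)"
    "\<And>n. \<not> solid_minor (b n) s k > 0" by metis
  have lim: "(\<lambda>n. b n j) \<longlonglongrightarrow> a j" if "j \<le> k + s" for j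
  proof (rule LIM_zero_cancel, rule Lim_null_comparison)
    show "\<forall>\<^sub>F n in sequentially. norm (b n j - a j) \<le> 1 / real (Suc n)"
      unfolding real_norm_def by (intro always_eventually allI less_imp_le b(1) that)
    show "(\<lambda>n. 1 / real (Suc n)) \<longlonglongrightarrow> 0" by (rule LIMSEQ_Suc[OF lim_1_over_n])
  qed
  have "(\<lambda>n. solid_minor (b n) s k) \<longlonglongrightarrow> solid_minor a s k"
    unfolding solid_minor_def by (intro tendsto_fdet) (auto simp: toeplitz_def intro!: lim)
  then have "solid_minor a s k \<le> 0"
    by (rule LIMSEQ_le_const2) (use b(2) in \<open>auto simp: not_less\<close>)
  then show False using assms by simp
qed

text \<open>
  For \<open>k > K\<close> the defects are positive by the estimates in the complex domain. For \<open>k \<le> K\<close> the solid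
  minors are compared with those of the reference sequence: the additional factors differ from
  1 by at most \<open>exp (j \<sigma>) - 1\<close> at the finitely many indices \<open>j\<close> that occur.
\<close>

lemma PF_seq_rising_times_linear_factors:
  fixes r :: nat
  shows "\<exists>N. \<exists>\<sigma>>0. \<forall>(B :: 'i set) \<nu>. finite B \<longrightarrow> (\<forall>j\<in>B. \<nu> j > 0) \<longrightarrow> (\<Sum>j\<in>B. 1 / \<nu> j) \<le> \<sigma> \<longrightarrow>
      PF_seq r (\<lambda>k. rising N k * (\<Prod>j\<in>B. 1 + real k / \<nu> j))"
proof -
  define far where "far = (\<lambda>N K. \<forall>(B :: 'i set) \<nu>. finite B \<longrightarrow> (\<forall>j\<in>B. \<nu> j > 0) \<longrightarrow> (\<Sum>j\<in>B. 1 / \<nu> j) \<le> 1 \<longrightarrow>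
    (\<forall>k\<ge>K. \<forall>s. 1 \<le> s \<longrightarrow> s \<le> r \<longrightarrow>
       defect_rec (\<lambda>x :: real. 1 - (\<Prod>i\<in>{..<N} <+> B. 1 - 1 / (x + zeros \<nu> i)\<^sup>2)) s (real k) > 0))"
  have "\<exists>N\<ge>r. \<exists>K\<ge>r. far N K"
    unfolding far_def by (rule defect_rec_pos_far_out)
  then obtain N K where N: "N \<ge> r" and K: "K \<ge> r" and NK: "far N K" by blast
  have stable: "\<forall>s k. \<exists>\<delta>>0. s \<le> r \<longrightarrow> (\<forall>b. (\<forall>j\<le>k + s. \<bar>b j - rising N j\<bar> < \<delta>) \<longrightarrow> solid_minor b s k > 0)"
  proof (intro allI)
    fix s k
    show "\<exists>\<delta>>0. s \<le> r \<longrightarrow> (\<forall>b. (\<forall>j\<le>k + s. \<bar>b j - rising N j\<bar> < \<delta>) \<longrightarrow> solid_minor b s k > 0)"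
    proof (cases "s \<le> r")
      case True
      then show ?thesis using solid_minor_pos_stable[OF solid_minor_rising_pos[OF N True, of k]] by simp
    next
      case False
      then show ?thesis by (intro exI[of _ 1]) simp
    qed
  qed
  from choice[OF stable[THEN spec]]
  have "\<forall>s. \<exists>D. \<forall>k. D k > 0 \<and> (s \<le> r \<longrightarrow> (\<forall>b. (\<forall>j\<le>k + s. \<bar>b j - rising N j\<bar> < D k) \<longrightarrow> solid_minor b s k > 0))"
    by blast
  from choice[OF this] obtain D where D': "\<forall>s k. D s k > 0 \<and>
      (s \<le> r \<longrightarrow> (\<forall>b. (\<forall>j\<le>k + s. \<bar>b j - rising N j\<bar> < D s k) \<longrightarrow> solid_minor b s k > 0))" ..
  have D: "D s k > 0" "s \<le> r \<Longrightarrow> (\<forall>j\<le>k + s. \<bar>b j - rising N j\<bar> < D s k) \<Longrightarrow> solid_minor b s k > 0" for s k b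
    using D' by auto
  define \<delta> where "\<delta> = Min ((\<lambda>(s, k). D s k) ` ({..r} \<times> {..K}))"
  have "\<delta> \<in> (\<lambda>(s, k). D s k) ` ({..r} \<times> {..K})"
    unfolding \<delta>_def by (rule Min_in) auto
  then have \<delta>0: "\<delta> > 0" using D(1) by auto
  have \<delta>D: "\<delta> \<le> D s k" if "s \<le> r" "k \<le> K" for s k
    unfolding \<delta>_def using that by (intro Min_le) auto
  note \<delta> = \<delta>0 \<delta>D
  define C where "C = (\<Sum>j\<le>K + r. rising N j)"
  have C: "rising N j \<le> C" if "j \<le> K + r" for j
    unfolding C_def by (rule member_le_sum) (use that rising_pos[of N] in \<open>auto intro: less_imp_le\<close>)
  have C0: "C > 0" using C[of 0] rising_pos[of N 0] by simp
  \<comment> \<open>Chosen so that rising N j * (exp (j * \<sigma>) - 1) stays below \<delta> for all j \<le> K + r.\<close>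
  define \<sigma> where "\<sigma> = min 1 (ln (1 + \<delta> / (2 * C)) / real (K + r + 1))"
  have "ln (1 + \<delta> / (2 * C)) > 0" using \<delta>0 C0 by (intro ln_gt_zero) simp
  then have \<sigma>: "\<sigma> > 0" "\<sigma> \<le> 1" by (auto simp: \<sigma>_def)
  have \<sigma>exp: "exp (real (K + r) * \<sigma>) \<le> 1 + \<delta> / (2 * C)"
  proof -
    have "real (K + r) * \<sigma> \<le> real (K + r + 1) * (ln (1 + \<delta> / (2 * C)) / real (K + r + 1))"
      using \<sigma> by (intro mult_mono) (auto simp: \<sigma>_def)
    also have "\<dots> = ln (1 + \<delta> / (2 * C))" by simp
    finally have "exp (real (K + r) * \<sigma>) \<le> exp (ln (1 + \<delta> / (2 * C)))" by simp
    also have "\<dots> = 1 + \<delta> / (2 * C)" using \<delta> C0 by (intro exp_ln) (simp add: add_pos_pos)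
    finally show ?thesis .
  qed
  show ?thesis
  proof (intro exI[of _ N] exI[of _ \<sigma>] conjI allI impI \<sigma>(1))
    fix B :: "'i set" and \<nu> :: "'i \<Rightarrow> real"
    assume fin: "finite B" and \<nu>: "\<forall>j\<in>B. \<nu> j > 0" and sum: "(\<Sum>j\<in>B. 1 / \<nu> j) \<le> \<sigma>"
    define a where "a = (\<lambda>k. rising N k * (\<Prod>j\<in>B. 1 + real k / \<nu> j))"
    have pos_factor: "1 + real k / \<nu> j > 0" if "j \<in> B" for j k
      using \<nu> that by (auto intro!: add_pos_nonneg)
    have apos: "a k > 0" for k
      unfolding a_def using rising_pos pos_factor by (intro mult_pos_pos prod_pos) auto
    have near: "\<bar>a j - rising N j\<bar> < \<delta>" if j: "j \<le> K + r" for j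
    proof -
      define p where "p = (\<Prod>i\<in>B. 1 + real j / \<nu> i)"
      have p1: "p \<ge> 1" unfolding p_def using \<nu> by (intro prod_ge_1) auto
      have "p \<le> (\<Prod>i\<in>B. exp (real j / \<nu> i))"
        unfolding p_def using pos_factor by (intro prod_mono) (auto intro: less_imp_le exp_ge_add_one_self)
      also have "\<dots> = exp (\<Sum>i\<in>B. real j / \<nu> i)" using fin by (rule exp_sum[symmetric])
      also have "(\<Sum>i\<in>B. real j / \<nu> i) = real j * (\<Sum>i\<in>B. 1 / \<nu> i)" by (simp add: sum_distrib_left)
      also have "\<dots> \<le> real (K + r) * \<sigma>" using j sum \<nu> by (intro mult_mono) (auto intro!: sum_nonneg)
      finally have "p \<le> 1 + \<delta> / (2 * C)" using \<sigma>exp by simp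
      then have "rising N j * (p - 1) \<le> C * (\<delta> / (2 * C))"
        using p1 C[OF j] C0 by (intro mult_mono) auto
      moreover have "\<bar>a j - rising N j\<bar> = rising N j * (p - 1)"
        using p1 rising_pos[of N j]
        by (simp add: a_def p_def[symmetric] right_diff_distrib)
      ultimately have "\<bar>a j - rising N j\<bar> \<le> C * (\<delta> / (2 * C))" by simp
      also have "\<dots> < \<delta>" using C0 \<delta> by simp
      finally show ?thesis .
    qed
    define V where "V = (\<lambda>x :: real. 1 - (\<Prod>i\<in>{..<N} <+> B. 1 - 1 / (x + zeros \<nu> i)\<^sup>2))"
    have first: "V (real k) = 1 - a (k - 1) * a (k + 1) / (a k)\<^sup>2" if k: "k \<ge> 1" for k
    proof -
      have \<mu>: "zeros \<nu> i > 0" if "i \<in> {..<N} <+> B" for i using that \<nu> by auto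
      define c where "c = (\<Prod>j\<in>B. \<nu> j)"
      have c: "c \<noteq> 0" unfolding c_def using \<nu> fin by (auto simp: prod_zero_iff)
      have form: "a m = (\<Prod>i\<in>{..<N} <+> B. real m + zeros \<nu> i) / c" for m
      proof -
        have "(\<Prod>j\<in>B. 1 + real m / \<nu> j) = (\<Prod>j\<in>B. (real m + \<nu> j) / \<nu> j)"
          using \<nu> by (intro prod.cong) (auto simp: field_simps)
        also have "\<dots> = (\<Prod>j\<in>B. real m + \<nu> j) / c" by (simp add: prod_dividef c_def)
        finally show ?thesis
          using fin by (simp add: a_def rising_def prod.Plus add_ac)
      qed
      have k1: "real (k - 1) = real k - 1" "real (k + 1) = real k + 1" using k by (auto simp: of_nat_diff)
      have "a (k - 1) * a (k + 1) / (a k)\<^sup>2 = (\<Prod>i\<in>{..<N} <+> B. real k - 1 + zeros \<nu> i)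
          * (\<Prod>i\<in>{..<N} <+> B. real k + 1 + zeros \<nu> i) / (\<Prod>i\<in>{..<N} <+> B. real k + zeros \<nu> i)\<^sup>2"
        unfolding form k1 using c by (simp add: power2_eq_square)
      also have "\<dots> = (\<Prod>i\<in>{..<N} <+> B. (real k - 1 + zeros \<nu> i) * (real k + 1 + zeros \<nu> i)
            / (real k + zeros \<nu> i)\<^sup>2)"
        by (simp only: prod.distrib prod_dividef prod_power_distrib)
      also have "\<dots> = (\<Prod>i\<in>{..<N} <+> B. 1 - 1 / (real k + zeros \<nu> i)\<^sup>2)"
      proof (rule prod.cong)
        fix i assume i: "i \<in> {..<N} <+> B"
        define y where "y = real k + zeros \<nu> i"
        have "y \<noteq> 0" using \<mu>[OF i] by (simp add: y_def)
        have "(real k - 1 + zeros \<nu> i) * (real k + 1 + zeros \<nu> i) = y\<^sup>2 - 1"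
          by (simp add: y_def power2_eq_square algebra_simps)
        then show "(real k - 1 + zeros \<nu> i) * (real k + 1 + zeros \<nu> i) / (real k + zeros \<nu> i)\<^sup>2
           = 1 - 1 / (real k + zeros \<nu> i)\<^sup>2"
          using \<open>y \<noteq> 0\<close> by (simp add: y_def[symmetric] diff_divide_distrib)
      qed simp
      finally show ?thesis by (simp add: V_def)
    qed
    show "PF_seq r (\<lambda>k. rising N k * (\<Prod>j\<in>B. 1 + real k / \<nu> j))"
      unfolding a_def[symmetric]
    proof (rule PF_seq_if_solid_minors_pos)
      fix s k assume "1 \<le> s" "s \<le> r"
      show "solid_minor a s k > 0"
      proof (rule solid_minor_pos_by_recursion[where d = 1 and r = r and u = "\<lambda>s k. defect_rec V s (real k)"])
        show "defect_rec V 1 (real k) = 1 - a (k - 1) * a (k + 1) / (a k)\<^sup>2" if "k \<ge> 1" for k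
          using first[OF that] by simp
        show "defect_rec V (Suc (Suc s)) (real k) = 1 - (1 - defect_rec V (Suc s) (real k))\<^sup>2 / (1 - defect_rec V s (real k))
          * (defect_rec V (Suc s) (real (k - 1)) * defect_rec V (Suc s) (real (k + 1)) / (defect_rec V (Suc s) (real k))\<^sup>2)"
          if "k \<ge> 1" for s k
        proof -
          have "real (k - 1) = real k - 1" "real (k + 1) = real k + 1" using that by (auto simp: of_nat_diff)
          then show ?thesis by (simp only: defect_rec.simps)
        qed
        show "solid_minor a (Suc s) k > 0 \<or> (1 * s \<le> k \<and> defect_rec V s (real k) > 0)"
          if s: "1 \<le> s" "s < r" for s k
        proof (cases "k \<le> K")
          case True
          have "solid_minor a (Suc s) k > 0"
          proof (rule D(2))
            show "\<forall>j\<le>k + Suc s. \<bar>a j - rising N j\<bar> < D (Suc s) k"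
            proof (intro allI impI)
              fix j assume "j \<le> k + Suc s"
              then have "\<bar>a j - rising N j\<bar> < \<delta>" using True s by (intro near) simp
              also have "\<delta> \<le> D (Suc s) k" using True s by (intro \<delta>D) auto
              finally show "\<bar>a j - rising N j\<bar> < D (Suc s) k" .
            qed
          qed (use s in auto)
          then show ?thesis ..
        next
          case False
          have "defect_rec V s (real k) > 0"
            unfolding V_def using NK[unfolded far_def, rule_format, of B \<nu> k s] fin \<nu> sum \<sigma>(2) False s by simp
          then show ?thesis using False K s by auto
        qed
      qed (use apos \<open>s \<le> r\<close> in auto)
    qed
  qed
qed

section \<open>Analytic continuation for coefficients of minimal exponential type\<close>

lemma binomial_series:
  fixes z :: complex
  assumes "norm z < 1"
  shows "(\<lambda>k. of_nat ((k + i) choose i) * z ^ k) sums (1 / (1 - z)) ^ Suc i"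
proof -
  have z: "1 - z \<noteq> 0" using assms by auto
  have "(\<lambda>k. ((- of_nat (Suc i)) gchoose k) * (- z) ^ k) sums (1 + (- z)) powr (- of_nat (Suc i))"
    using assms by (intro gen_binomial_complex) simp
  also have "(\<lambda>k. ((- of_nat (Suc i)) gchoose k) * (- z) ^ k) = (\<lambda>k. of_nat ((k + i) choose i) * z ^ k)"
  proof
    fix k
    have "((- of_nat (Suc i) :: complex) gchoose k) = (-1) ^ k * (of_nat (i + k) gchoose k)"
      by (subst gbinomial_minus) (simp add: add_ac)
    also have "(of_nat (i + k) gchoose k) = (of_nat ((i + k) choose k) :: complex)"
      by (rule binomial_gbinomial[symmetric])
    also have "(i + k) choose k = (k + i) choose i"
      by (subst binomial_symmetric) (auto simp: add.commute)
    finally have gb: "((- of_nat (Suc i) :: complex) gchoose k) = (-1) ^ k * of_nat ((k + i) choose i)" .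
    have sq: "(-1) ^ k * x * ((-1) ^ k * y) = x * y" for x y :: complex
    proof -
      have "(-1) ^ k * x * ((-1) ^ k * y) = ((-1) ^ k * (-1) ^ k) * (x * y)" by (simp only: mult_ac)
      then show ?thesis by simp
    qed
    show "((- of_nat (Suc i) :: complex) gchoose k) * (- z) ^ k = of_nat ((k + i) choose i) * z ^ k"
      by (simp only: gb power_minus[of z k] sq)
  qed
  also have "(1 + (- z)) powr (- of_nat (Suc i)) = (1 / (1 - z)) ^ Suc i"
    using z by (simp add: powr_minus powr_nat' power_one_over inverse_eq_divide del: power_Suc of_nat_Suc)
  finally show ?thesis .
qed

text \<open>
  The coefficients of \<open>k^n\<close> in the basis of the polynomials \<open>(k + i) choose i\<close>, which is the basis whose
  generating functions are the powers of \<open>1 / (1 - z)\<close>.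
\<close>

fun binomial_basis_coeff :: "nat \<Rightarrow> nat \<Rightarrow> real" where
  "binomial_basis_coeff 0 i = (if i = 0 then 1 else 0)"
| "binomial_basis_coeff (Suc n) i = real i * binomial_basis_coeff n (i - 1) - (real i + 1) * binomial_basis_coeff n i"

lemma binomial_basis_coeff_eq_0: "i > n \<Longrightarrow> binomial_basis_coeff n i = 0"
  by (induction n arbitrary: i) auto

lemma power_eq_sum_binomial:
  "real k ^ n = (\<Sum>i\<le>n. binomial_basis_coeff n i * real ((k + i) choose i))"
proof (induction n)
  case (Suc n)
  define c where "c = (\<lambda>i. real ((k + i) choose i))"
  \<comment> \<open>Multiplication by k in this basis; the recursion for the coefficients is its transpose.\<close>
  have step: "real k * c i = (real i + 1) * c (Suc i) - (real i + 1) * c i" for i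
  proof -
    have "Suc i * (Suc (k + i) choose Suc i) = Suc (k + i) * ((k + i) choose i)"
      using Suc_times_binomial_eq[of "k + i" i] by (simp only: mult.commute)
    then have "real (Suc i) * real (Suc (k + i) choose Suc i) = real (Suc (k + i)) * real ((k + i) choose i)"
      by (simp only: of_nat_mult[symmetric])
    then have "real (Suc i) * c (Suc i) = real (Suc (k + i)) * c i"
      by (simp only: c_def add_Suc_right)
    then show ?thesis by (simp add: algebra_simps)
  qed
  have "real k ^ Suc n = (\<Sum>i\<le>n. binomial_basis_coeff n i * (real k * c i))"
    by (simp add: Suc c_def sum_distrib_left mult_ac)
  also have "\<dots> = (\<Sum>i\<le>n. binomial_basis_coeff n i * (real i + 1) * c (Suc i))
      - (\<Sum>i\<le>n. binomial_basis_coeff n i * (real i + 1) * c i)"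
    unfolding step by (simp add: sum_subtractf algebra_simps)
  also have "(\<Sum>i\<le>n. binomial_basis_coeff n i * (real i + 1) * c (Suc i))
      = (\<Sum>i\<le>Suc n. real i * binomial_basis_coeff n (i - 1) * c i)"
    by (subst sum.atMost_Suc_shift) (simp add: mult_ac add_ac)
  also have "(\<Sum>i\<le>n. binomial_basis_coeff n i * (real i + 1) * c i)
      = (\<Sum>i\<le>Suc n. (real i + 1) * binomial_basis_coeff n i * c i)"
    by (simp add: binomial_basis_coeff_eq_0 mult_ac)
  also have "(\<Sum>i\<le>Suc n. real i * binomial_basis_coeff n (i - 1) * c i)
      - (\<Sum>i\<le>Suc n. (real i + 1) * binomial_basis_coeff n i * c i)
      = (\<Sum>i\<le>Suc n. binomial_basis_coeff (Suc n) i * c i)"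
    by (simp only: sum_subtractf[symmetric] binomial_basis_coeff.simps left_diff_distrib)
  finally show ?case by (simp only: c_def)
qed simp

lemma binomial_basis_coeff_bound:
  assumes R: "R \<ge> 1"
  shows "(\<Sum>i\<le>n. \<bar>binomial_basis_coeff n i\<bar> * R ^ i) \<le> fact n * (2 * R) ^ n"
proof (induction n)
  case (Suc n)
  define S where "S = (\<Sum>i\<le>n. \<bar>binomial_basis_coeff n i\<bar> * R ^ i)"
  have S0: "S \<ge> 0" unfolding S_def using R by (intro sum_nonneg) auto
  have "(\<Sum>i\<le>Suc n. \<bar>binomial_basis_coeff (Suc n) i\<bar> * R ^ i)
      \<le> (\<Sum>i\<le>Suc n. real i * \<bar>binomial_basis_coeff n (i - 1)\<bar> * R ^ i + (real i + 1) * \<bar>binomial_basis_coeff n i\<bar> * R ^ i)"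
  proof (rule sum_mono)
    fix i
    have "\<bar>binomial_basis_coeff (Suc n) i\<bar> \<le> real i * \<bar>binomial_basis_coeff n (i - 1)\<bar> + (real i + 1) * \<bar>binomial_basis_coeff n i\<bar>"
      using abs_triangle_ineq4[of "real i * binomial_basis_coeff n (i - 1)" "(real i + 1) * binomial_basis_coeff n i"]
      by (simp add: abs_mult)
    then have "\<bar>binomial_basis_coeff (Suc n) i\<bar> * R ^ i
        \<le> (real i * \<bar>binomial_basis_coeff n (i - 1)\<bar> + (real i + 1) * \<bar>binomial_basis_coeff n i\<bar>) * R ^ i"
      using R by (intro mult_right_mono) auto
    then show "\<bar>binomial_basis_coeff (Suc n) i\<bar> * R ^ i
       \<le> real i * \<bar>binomial_basis_coeff n (i - 1)\<bar> * R ^ i + (real i + 1) * \<bar>binomial_basis_coeff n i\<bar> * R ^ i"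
      by (simp only: distrib_right)
  qed
  also have "\<dots> = (\<Sum>i\<le>Suc n. real i * \<bar>binomial_basis_coeff n (i - 1)\<bar> * R ^ i)
       + (\<Sum>i\<le>Suc n. (real i + 1) * \<bar>binomial_basis_coeff n i\<bar> * R ^ i)"
    by (rule sum.distrib)
  also have "(\<Sum>i\<le>Suc n. real i * \<bar>binomial_basis_coeff n (i - 1)\<bar> * R ^ i)
       = (\<Sum>i\<le>n. (real i + 1) * \<bar>binomial_basis_coeff n i\<bar> * R ^ Suc i)"
    by (subst sum.atMost_Suc_shift) (simp add: add_ac)
  also have "\<dots> \<le> (\<Sum>i\<le>n. (real n + 1) * R * (\<bar>binomial_basis_coeff n i\<bar> * R ^ i))"
  proof (rule sum_mono)
    fix i assume "i \<in> {..n}"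
    then have "(real i + 1) * (R * (\<bar>binomial_basis_coeff n i\<bar> * R ^ i)) \<le> (real n + 1) * (R * (\<bar>binomial_basis_coeff n i\<bar> * R ^ i))"
      using R by (intro mult_right_mono) auto
    then show "(real i + 1) * \<bar>binomial_basis_coeff n i\<bar> * R ^ Suc i \<le> (real n + 1) * R * (\<bar>binomial_basis_coeff n i\<bar> * R ^ i)"
      by (simp add: mult_ac)
  qed
  also have "\<dots> = (real n + 1) * R * S" by (simp add: S_def sum_distrib_left)
  also have "(\<Sum>i\<le>Suc n. (real i + 1) * \<bar>binomial_basis_coeff n i\<bar> * R ^ i)
       = (\<Sum>i\<le>n. (real i + 1) * (\<bar>binomial_basis_coeff n i\<bar> * R ^ i))"
    by (simp add: binomial_basis_coeff_eq_0 mult_ac)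
  also have "\<dots> \<le> (\<Sum>i\<le>n. (real n + 1) * (\<bar>binomial_basis_coeff n i\<bar> * R ^ i))"
    using R by (intro sum_mono mult_right_mono) auto
  also have "\<dots> = (real n + 1) * S" by (simp add: S_def sum_distrib_left)
  also have "(real n + 1) * R * S + (real n + 1) * S \<le> (real n + 1) * (2 * R) * S"
  proof -
    have "(real n + 1) * 1 * S \<le> (real n + 1) * R * S" using R S0 by (intro mult_right_mono mult_left_mono) auto
    then show ?thesis by (simp add: algebra_simps)
  qed
  also have "\<dots> \<le> (real n + 1) * (2 * R) * (fact n * (2 * R) ^ n)"
    using Suc R by (intro mult_left_mono) (auto simp: S_def)
  also have "\<dots> = fact (Suc n) * (2 * R) ^ Suc n" by (simp add: algebra_simps)
  finally show ?case by simp
qed simp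

text \<open>
  The generating function of \<open>k^n\<close> as a polynomial in \<open>w = 1 / (1 - z)\<close>.
\<close>

definition power_gf :: "nat \<Rightarrow> complex \<Rightarrow> complex" where
  "power_gf n w = (\<Sum>i\<le>n. of_real (binomial_basis_coeff n i) * w ^ Suc i)"

lemma power_gf_sums:
  assumes "norm z < 1"
  shows "(\<lambda>k. of_nat k ^ n * z ^ k) sums power_gf n (1 / (1 - z))"
proof -
  have "(\<lambda>k. \<Sum>i\<le>n. of_real (binomial_basis_coeff n i) * (of_nat ((k + i) choose i) * z ^ k))
          sums power_gf n (1 / (1 - z))"
    unfolding power_gf_def by (intro sums_sum sums_mult binomial_series assms)
  also have "(\<lambda>k. \<Sum>i\<le>n. of_real (binomial_basis_coeff n i) * (of_nat ((k + i) choose i) * z ^ k))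
     = (\<lambda>k. of_nat k ^ n * z ^ k)"
  proof
    fix k
    have "complex_of_real (real k ^ n) = of_real (\<Sum>i\<le>n. binomial_basis_coeff n i * real ((k + i) choose i))"
      by (simp only: power_eq_sum_binomial)
    then have "of_nat k ^ n = (\<Sum>i\<le>n. complex_of_real (binomial_basis_coeff n i) * of_nat ((k + i) choose i))"
      by simp
    then show "(\<Sum>i\<le>n. of_real (binomial_basis_coeff n i) * (of_nat ((k + i) choose i) * z ^ k)) = of_nat k ^ n * z ^ k"
      by (simp add: sum_distrib_right mult.assoc)
  qed
  finally show ?thesis .
qed

lemma norm_power_gf_le:
  assumes "R \<ge> 1" "norm w \<le> R"
  shows "norm (power_gf n w) \<le> R * (fact n * (2 * R) ^ n)"
proof -
  have "norm (power_gf n w) \<le> (\<Sum>i\<le>n. norm (complex_of_real (binomial_basis_coeff n i) * w ^ Suc i))"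
    unfolding power_gf_def by (rule norm_sum)
  also have "\<dots> \<le> (\<Sum>i\<le>n. R * (\<bar>binomial_basis_coeff n i\<bar> * R ^ i))"
  proof (rule sum_mono)
    fix i
    have "norm w ^ Suc i \<le> R ^ Suc i" using assms by (intro power_mono) auto
    then have "\<bar>binomial_basis_coeff n i\<bar> * norm w ^ Suc i \<le> \<bar>binomial_basis_coeff n i\<bar> * R ^ Suc i"
      by (intro mult_left_mono) auto
    then show "norm (complex_of_real (binomial_basis_coeff n i) * w ^ Suc i) \<le> R * (\<bar>binomial_basis_coeff n i\<bar> * R ^ i)"
      by (simp add: norm_mult norm_power mult_ac)
  qed
  also have "\<dots> = R * (\<Sum>i\<le>n. \<bar>binomial_basis_coeff n i\<bar> * R ^ i)" by (simp add: sum_distrib_left)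
  also have "\<dots> \<le> R * (fact n * (2 * R) ^ n)"
    using binomial_basis_coeff_bound[OF assms(1)] assms(1) by (intro mult_left_mono) auto
  finally show ?thesis .
qed

text \<open>
  Cauchy's estimate on the circle of radius about \<open>n / \<delta>\<close>, together with \<open>n! \<le> n^n\<close>.
\<close>

lemma minimal_type_coeff_bound:
  fixes \<phi> :: "complex \<Rightarrow> complex"
  assumes hol: "\<phi> holomorphic_on UNIV" and \<delta>: "\<delta> > 0"
    and bound: "\<And>z. norm (\<phi> z) \<le> C * exp (\<delta> * norm z)"
  shows "norm ((deriv ^^ n) \<phi> 0 / fact n) * fact n \<le> C * exp 1 * (exp 1 * \<delta>) ^ n"
proof -
  \<comment> \<open>Up to the shift by 1, which keeps the radius positive for n = 0, this is the optimal radius n / \<delta>.\<close>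
  define r where "r = real (Suc n) / \<delta>"
  have r: "r > 0" using \<delta> by (simp add: r_def)
  have C: "C \<ge> 0" using bound[of 0] norm_ge_zero[of "\<phi> 0"] by (simp del: norm_ge_zero)
  have "norm ((deriv ^^ n) \<phi> 0) \<le> fact n * (C * exp (real (Suc n))) / r ^ n"
  proof (rule Cauchy_inequality)
    show "\<phi> holomorphic_on ball 0 r" "continuous_on (cball 0 r) \<phi>"
      using hol by (auto intro: holomorphic_on_subset holomorphic_on_imp_continuous_on)
    show "norm (\<phi> x) \<le> C * exp (real (Suc n))" if "norm (0 - x) = r" for x
      using bound[of x] that \<delta> by (simp add: r_def)
  qed (rule r)
  then have "norm ((deriv ^^ n) \<phi> 0) \<le> C * exp (real (Suc n)) * (fact n / r ^ n)" by (simp add: mult_ac)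
  also have "\<dots> \<le> C * exp (real (Suc n)) * \<delta> ^ n"
  proof (intro mult_left_mono)
    have "(fact n :: real) \<le> real n ^ n"
      using fact_le_power[of n] by simp
    also have "\<dots> \<le> real (Suc n) ^ n" by (intro power_mono) auto
    finally show "fact n / r ^ n \<le> \<delta> ^ n"
      using \<delta> by (simp add: r_def power_divide field_simps)
  qed (use C in auto)
  also have "\<dots> = C * exp 1 * (exp 1 * \<delta>) ^ n"
    by (simp add: power_mult_distrib exp_add exp_of_nat_mult[symmetric] mult_ac)
  finally show ?thesis by (simp add: norm_divide)
qed

text \<open>
  This is one direction of Wigert's theorem. With \<open>\<phi>(k) = \<Sum>n. b\<^sub>n k^n\<close> the function is
  \<open>G(w) = \<Sum>n. b\<^sub>n P\<^sub>n(w)\<close>, where \<open>P\<^sub>n\<close> is the generating function of \<open>k^n\<close>. On the disc of radius \<open>R\<close> the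
  \<open>n\<close>-th summand is at most a constant times \<open>(2 e \<delta> R)^n\<close>; since \<open>\<delta>\<close> is arbitrary, the series converges
  everywhere. Inside the unit disc it may be rearranged into a power series in \<open>z\<close>, because
  replacing \<open>z\<close> by its modulus replaces \<open>1 / (1 - z)\<close> by \<open>1 / (1 - \<bar>z\<bar>)\<close> and keeps absolute convergence.
\<close>

lemma wigert_analytic_continuation:
  fixes \<phi> :: "complex \<Rightarrow> complex"
  assumes hol: "\<phi> holomorphic_on UNIV"
    and type: "\<And>\<delta>. \<delta> > 0 \<Longrightarrow> \<exists>C. \<forall>z. norm (\<phi> z) \<le> C * exp (\<delta> * norm z)"
  obtains G where "G holomorphic_on UNIV"
    and "\<And>z. norm z < 1 \<Longrightarrow> (\<lambda>k. \<phi> (of_nat k) * z ^ k) sums G (1 / (1 - z))"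
proof -
  define b where "b = (\<lambda>n. (deriv ^^ n) \<phi> 0 / fact n)"
  define G where "G = (\<lambda>w. \<Sum>n. b n * power_gf n w)"
  have \<phi>: "(\<lambda>n. b n * z ^ n) sums \<phi> z" for z
  proof -
    have "(\<lambda>n. (deriv ^^ n) \<phi> 0 / fact n * (z - 0) ^ n) sums \<phi> z"
      by (rule holomorphic_power_series[of _ _ "norm z + 1"]) (use hol in \<open>auto intro: holomorphic_on_subset\<close>)
    then show ?thesis by (simp add: b_def)
  qed
  have maj: "\<exists>K. \<forall>n. norm (b n) * (R * (fact n * (2 * R) ^ n)) \<le> K * (1 / 2) ^ n" if R: "R \<ge> 1" for R
  proof -
    \<comment> \<open>Makes the ratio exp 1 * \<delta> * (2 * R) of the majorant equal to 1 / 2.\<close>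
    define \<delta> where "\<delta> = 1 / (4 * R * exp 1)"
    have \<delta>: "\<delta> > 0" using R by (simp add: \<delta>_def)
    obtain C where C: "\<And>z. norm (\<phi> z) \<le> C * exp (\<delta> * norm z)" using type[OF \<delta>] by blast
    have "norm (b n) * (R * (fact n * (2 * R) ^ n)) \<le> (C * exp 1 * R) * (1 / 2) ^ n" for n
    proof -
      have "norm (b n) * fact n * (R * (2 * R) ^ n) \<le> C * exp 1 * (exp 1 * \<delta>) ^ n * (R * (2 * R) ^ n)"
        unfolding b_def using R by (intro mult_right_mono minimal_type_coeff_bound[OF hol \<delta> C]) auto
      also have "\<dots> = C * exp 1 * R * (exp 1 * \<delta> * (2 * R)) ^ n"
        by (simp only: power_mult_distrib mult_ac)
      also have "exp 1 * \<delta> * (2 * R) = 1 / 2" using R by (simp add: \<delta>_def)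
      finally show ?thesis by (simp only: mult_ac)
    qed
    then show ?thesis by blast
  qed
  have unif: "uniform_limit (cball 0 R) (\<lambda>N w. \<Sum>n<N. b n * power_gf n w) G sequentially"
    if R: "R \<ge> 1" for R
  proof -
    obtain K where K: "\<And>n. norm (b n) * (R * (fact n * (2 * R) ^ n)) \<le> K * (1 / 2) ^ n"
      using maj[OF R] by blast
    show ?thesis unfolding G_def
    proof (rule Weierstrass_m_test)
      fix n w assume "w \<in> cball (0 :: complex) R"
      then have "norm (power_gf n w) \<le> R * (fact n * (2 * R) ^ n)" using R by (intro norm_power_gf_le) auto
      then have "norm (b n * power_gf n w) \<le> norm (b n) * (R * (fact n * (2 * R) ^ n))"
        unfolding norm_mult by (intro mult_left_mono) auto
      also note K[of n]
      finally show "norm (b n * power_gf n w) \<le> K * (1 / 2) ^ n" .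
    next
      show "summable (\<lambda>n. K * (1 / 2 :: real) ^ n)" by (intro summable_mult summable_geometric) auto
    qed
  qed
  have "G holomorphic_on UNIV"
  proof (rule holomorphic_uniform_sequence[where f = "\<lambda>N w. \<Sum>n<N. b n * power_gf n w"])
    show "(\<lambda>w. \<Sum>n<N. b n * power_gf n w) holomorphic_on UNIV" for N
      unfolding power_gf_def by (intro holomorphic_intros)
    fix x :: complex
    have "cball x 1 \<subseteq> cball 0 (norm x + 1)"
    proof
      fix y assume "y \<in> cball x 1"
      then have "norm y \<le> norm x + 1"
        using norm_triangle_ineq4[of x "x - y"] by (simp add: dist_norm)
      then show "y \<in> cball 0 (norm x + 1)" by simp
    qed
    then have "uniform_limit (cball x 1) (\<lambda>N w. \<Sum>n<N. b n * power_gf n w) G sequentially"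
      by (rule uniform_limit_on_subset[OF unif[of "norm x + 1"], rotated]) simp
    then show "\<exists>d>0. cball x d \<subseteq> UNIV \<and> uniform_limit (cball x d) (\<lambda>N w. \<Sum>n<N. b n * power_gf n w) G sequentially"
      by (intro exI[of _ 1]) simp
  qed simp
  moreover have "(\<lambda>k. \<phi> (of_nat k) * z ^ k) sums G (1 / (1 - z))" if z: "norm z < 1" for z
  proof -
    define R where "R = 1 / (1 - norm z)"
    have R: "R \<ge> 1" using z by (simp add: R_def)
    define w where "w = 1 / (1 - z)"
    have wR: "norm w \<le> R"
    proof -
      have "1 - norm z \<le> norm (1 - z)" using norm_triangle_ineq2[of 1 z] by simp
      then show ?thesis using z by (simp add: w_def R_def norm_divide frac_le)
    qed
    obtain K where K: "\<And>n. norm (b n) * (R * (fact n * (2 * R) ^ n)) \<le> K * (1 / 2) ^ n"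
      using maj[OF R] by blast
    have geo: "summable (\<lambda>n. K * (1 / 2 :: real) ^ n)" by (intro summable_mult summable_geometric) auto
    define f where "f = (\<lambda>(n, k). b n * (of_nat k ^ n * z ^ k))"
    have norms: "(\<lambda>k. norm (f (n, k))) sums (norm (b n) * norm (power_gf n (of_real R)))" for n
    proof -
      have "norm (complex_of_real (norm z)) < 1" using z by simp
      from power_gf_sums[OF this, of n]
      have "(\<lambda>k. of_real (real k ^ n * norm z ^ k)) sums power_gf n (of_real R)"
        by (simp add: R_def)
      then have "summable (\<lambda>k. complex_of_real (real k ^ n * norm z ^ k))" by (rule sums_summable)
      then have "summable (\<lambda>k. real k ^ n * norm z ^ k)" by (simp only: summable_of_real_iff)
      then have s: "(\<lambda>k. real k ^ n * norm z ^ k) sums (\<Sum>k. real k ^ n * norm z ^ k)"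
        by (rule summable_sums)
      have p: "power_gf n (of_real R) = of_real (\<Sum>k. real k ^ n * norm z ^ k)"
        by (rule sums_unique2[OF \<open>(\<lambda>k. of_real (real k ^ n * norm z ^ k)) sums power_gf n (of_real R)\<close>
              sums_of_real[OF s]])
      have "0 \<le> (\<Sum>k. real k ^ n * norm z ^ k)"
        using s by (intro suminf_nonneg) (auto simp: sums_iff)
      then have "norm (power_gf n (of_real R)) = (\<Sum>k. real k ^ n * norm z ^ k)"
        unfolding p by simp
      then show ?thesis using sums_mult[OF s, of "norm (b n)"]
        by (simp add: f_def norm_mult norm_power)
    qed
    have rows: "((\<lambda>k. f (n, k)) has_sum (b n * power_gf n w)) UNIV" for n
    proof (rule norm_summable_imp_has_sum)
      show "summable (\<lambda>k. norm (f (n, k)))" using norms by (rule sums_summable)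
      show "(\<lambda>k. f (n, k)) sums (b n * power_gf n w)"
        unfolding f_def w_def using sums_mult[OF power_gf_sums[OF z], of "b n" n] by simp
    qed
    have norm_rows: "((\<lambda>k. norm (f (n, k))) has_sum (norm (b n) * norm (power_gf n (of_real R)))) UNIV" for n
      by (rule norm_summable_imp_has_sum) (use norms in \<open>auto intro: sums_summable\<close>)
    have total: "(\<lambda>x. norm (f x)) summable_on UNIV \<times> UNIV"
    proof (rule summable_on_SigmaI[where g = "\<lambda>n. norm (b n) * norm (power_gf n (of_real R))"])
      show "(\<lambda>n. norm (b n) * norm (power_gf n (of_real R))) summable_on UNIV"
      proof (rule norm_summable_imp_summable_on, rule summable_comparison_test'[OF geo, of 0])
        fix n :: nat
        have "norm (b n) * norm (power_gf n (of_real R)) \<le> norm (b n) * (R * (fact n * (2 * R) ^ n))"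
          using R by (intro mult_left_mono norm_power_gf_le) auto
        also note K[of n]
        finally show "norm (norm (norm (b n) * norm (power_gf n (of_real R)))) \<le> K * (1 / 2) ^ n" by simp
      qed
    qed (use norm_rows in auto)
    then obtain S where S: "(f has_sum S) (UNIV \<times> UNIV)"
      using abs_summable_summable by (auto simp: summable_on_def)
    have "((\<lambda>n. b n * power_gf n w) has_sum S) UNIV"
      by (rule has_sum_SigmaD[OF S]) (use rows in auto)
    then have 1: "G w = S" unfolding G_def by (rule sums_unique[OF has_sum_imp_sums, symmetric])
    have "((\<lambda>(k, n). f (n, k)) has_sum S) (UNIV \<times> UNIV)" using S by (subst (asm) has_sum_swap)
    then have "((\<lambda>k. \<phi> (of_nat k) * z ^ k) has_sum S) UNIV"
    proof (rule has_sum_SigmaD)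
      fix k :: nat
      have "(\<lambda>x. norm ((\<lambda>(k, n). f (n, k)) x)) summable_on UNIV \<times> UNIV"
        using total by (subst (asm) summable_on_swap) (simp add: case_prod_unfold)
      then have "(\<lambda>n. norm (f (n, k))) summable_on UNIV"
        using Infinite_Sum.abs_summable_on_Sigma_iff[where f = "\<lambda>(k, n). f (n, k)" and A = UNIV and B = "\<lambda>_. UNIV"]
        by simp
      then have "(\<lambda>n. f (n, k)) summable_on UNIV" by (rule abs_summable_summable)
      then obtain T where T: "((\<lambda>n. f (n, k)) has_sum T) UNIV" by (auto simp: summable_on_def)
      have "(\<lambda>n. f (n, k)) sums (\<phi> (of_nat k) * z ^ k)"
        using sums_mult2[OF \<phi>[of "of_nat k"], of "z ^ k"] by (simp add: f_def mult.assoc)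
      then have "T = \<phi> (of_nat k) * z ^ k" by (rule sums_unique2[OF has_sum_imp_sums[OF T]])
      then show "((\<lambda>n. case (k, n) of (k, n) \<Rightarrow> f (n, k)) has_sum (\<phi> (of_nat k) * z ^ k)) UNIV" using T by simp
    qed
    then show ?thesis unfolding w_def[symmetric] 1 by (rule has_sum_imp_sums)
  qed
  ultimately show thesis by (rule that)
qed

section \<open>The entire function interpolating the coefficients\<close>

text \<open>
  A zero at \<open>- M 2^(j\<^sup>2)\<close> of multiplicity \<open>2^(j\<^sup>2 - j)\<close>. The multiplicity is smaller than the modulus by a
  factor of order \<open>2^j\<close>. This factor makes the sum of the reciprocals of the zeros converge, and yet it
  grows more slowly than any positive power of the modulus, which is what infinite order needs.
\<close>

definition zero_block :: "nat \<Rightarrow> nat \<Rightarrow> 'a :: field \<Rightarrow> 'a" where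
  "zero_block M j z = (1 + z / (of_nat M * 2 ^ (j * j))) ^ (2 ^ (j * (j - 1)))"

lemma block_density: "2 ^ (j * (j - 1)) / (2 :: real) ^ (j * j) = (1 / 2) ^ j"
proof -
  have "j * j = j * (j - 1) + j" by (cases j) auto
  then have "(2 :: real) ^ (j * j) = 2 ^ (j * (j - 1)) * 2 ^ j" by (simp only: power_add)
  then show ?thesis by (simp add: power_one_over)
qed

lemma norm_one_plus_power_minus_one:
  fixes u :: complex
  shows "norm ((1 + u) ^ m - 1) \<le> (1 + norm u) ^ m - 1"
proof (induction m)
  case (Suc m)
  have "(1 + u) ^ Suc m - 1 = (1 + u) * ((1 + u) ^ m - 1) + u" by (simp add: algebra_simps)
  then have "norm ((1 + u) ^ Suc m - 1) \<le> norm (1 + u) * norm ((1 + u) ^ m - 1) + norm u"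
    by (metis norm_mult norm_triangle_ineq)
  also have "\<dots> \<le> (1 + norm u) * ((1 + norm u) ^ m - 1) + norm u"
    using Suc norm_triangle_ineq[of 1 u] by (intro add_right_mono mult_mono) auto
  also have "\<dots> = (1 + norm u) ^ Suc m - 1" by (simp add: algebra_simps)
  finally show ?case .
qed simp

lemma zero_block_of_real:
  "zero_block M j (complex_of_real x) = of_real (zero_block M j x)"
  by (simp add: zero_block_def)

lemma norm_zero_block:
  fixes z :: complex
  shows "norm (zero_block M j z) \<le> zero_block M j (norm z)"
    and "norm (zero_block M j z - 1) \<le> zero_block M j (norm z) - 1"
proof -
  define u where "u = z / (of_nat M * 2 ^ (j * j))"
  have n: "norm u = norm z / (real M * 2 ^ (j * j))" by (simp add: u_def norm_divide norm_mult norm_power)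
  show "norm (zero_block M j z - 1) \<le> zero_block M j (norm z) - 1"
    unfolding zero_block_def u_def[symmetric] n[symmetric] by (rule norm_one_plus_power_minus_one)
  show "norm (zero_block M j z) \<le> zero_block M j (norm z)"
    unfolding zero_block_def u_def[symmetric] n[symmetric] norm_power
    using norm_triangle_ineq[of 1 u] by (intro power_mono) auto
qed

lemma zero_block_ge_1: "x \<ge> 0 \<Longrightarrow> zero_block M j (x :: real) \<ge> 1"
  unfolding zero_block_def by (intro one_le_power) simp

lemma zero_block_le_exp:
  fixes x :: real
  assumes "x \<ge> 0" "M \<ge> 1"
  shows "zero_block M j x \<le> exp (x * (1 / 2) ^ j)"
proof -
  define u where "u = x / (real M * 2 ^ (j * j))"
  have u: "u \<ge> 0" using assms by (simp add: u_def)
  have "zero_block M j x \<le> exp u ^ (2 ^ (j * (j - 1)))"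
    unfolding zero_block_def u_def[symmetric] using u by (intro power_mono exp_ge_add_one_self) auto
  also have "\<dots> = exp (2 ^ (j * (j - 1)) * u)" by (simp add: exp_of_nat_mult[symmetric])
  also have "2 ^ (j * (j - 1)) * u = (x / real M) * (2 ^ (j * (j - 1)) / 2 ^ (j * j))"
    by (simp add: u_def)
  also have "\<dots> = x / real M * (1 / 2) ^ j" by (simp only: block_density)
  also have "exp \<dots> \<le> exp (x * (1 / 2) ^ j)"
  proof -
    have "x / real M \<le> x / 1" using assms by (intro divide_left_mono) auto
    then show ?thesis using mult_right_mono[of "x / real M" x "(1 / 2) ^ j"] by simp
  qed
  finally show ?thesis .
qed

lemma exp_minus_one_le: "t \<ge> 0 \<Longrightarrow> exp t - 1 \<le> t * exp (t :: real)"
  using exp_ge_add_one_self[of "- t"] by (simp add: exp_minus field_simps)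

lemma zero_blocks_converge:
  assumes M: "M \<ge> 1"
  obtains g :: "complex \<Rightarrow> complex"
  where "\<And>R. uniform_limit (cball 0 R) (\<lambda>n z. \<Prod>j<n. zero_block M j z) g sequentially"
proof -
  have "uniformly_convergent_on (cball 0 R) (\<lambda>n z. \<Prod>j<n. zero_block M j (z :: complex))" for R
  proof (rule uniformly_convergent_on_prod')
    show "continuous_on (cball 0 R) (zero_block M n :: complex \<Rightarrow> complex)" for n
      unfolding zero_block_def using M by (intro continuous_intros) auto
    show "uniformly_convergent_on (cball 0 R) (\<lambda>N z. \<Sum>n<N. norm (zero_block M n z - 1 :: complex))"
    proof (rule Weierstrass_m_test')
      fix n and z :: complex assume z: "z \<in> cball 0 R"
      then have R: "R \<ge> 0" using norm_ge_zero[of z] by (simp del: norm_ge_zero)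
      define t where "t = norm z * (1 / 2) ^ n"
      have t: "0 \<le> t" "t \<le> R * (1 / 2) ^ n" using z by (auto simp: t_def intro: mult_right_mono)
      have "R * (1 / 2) ^ n \<le> R * 1" using R by (intro mult_left_mono power_le_one) auto
      then have tR: "t \<le> R" using t by simp
      have "norm (zero_block M n z - 1) \<le> zero_block M n (norm z) - 1" by (rule norm_zero_block)
      also have "\<dots> \<le> exp t - 1" unfolding t_def using M by (intro diff_right_mono zero_block_le_exp) auto
      also have "\<dots> \<le> t * exp t" using t(1) by (rule exp_minus_one_le)
      also have "\<dots> \<le> (R * (1 / 2) ^ n) * exp R" using t tR R by (intro mult_mono) auto
      finally show "norm (norm (zero_block M n z - 1)) \<le> R * exp R * (1 / 2) ^ n" by (simp add: mult_ac)
    next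
      show "summable (\<lambda>n. R * exp R * (1 / 2) ^ n)" by (intro summable_mult summable_geometric) auto
    qed
  qed simp
  then have "uniform_limit (cball 0 R) (\<lambda>n z. \<Prod>j<n. zero_block M j (z :: complex))
       (\<lambda>z. lim (\<lambda>n. \<Prod>j<n. zero_block M j z)) sequentially" for R
    by (simp add: uniformly_convergent_uniform_limit_iff)
  then show thesis by (rule that)
qed

text \<open>
  Minimal exponential type for nonnegative majorants on the half-line, in a form that is
  preserved by products.
\<close>

definition subexponential :: "(real \<Rightarrow> real) \<Rightarrow> bool" where
  "subexponential f \<longleftrightarrow> (\<forall>\<delta>>0. \<exists>C. \<forall>x\<ge>0. 0 \<le> f x \<and> f x \<le> C * exp (\<delta> * x))"

lemma subexponential_linear:
  assumes "\<alpha> \<ge> 0" "\<beta> \<ge> 0"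
  shows "subexponential (\<lambda>x. \<alpha> + \<beta> * x)"
  unfolding subexponential_def
proof (intro allI impI, rule exI, intro allI impI conjI)
  fix \<delta> x :: real assume \<delta>: "\<delta> > 0" and x: "x \<ge> 0"
  show "0 \<le> \<alpha> + \<beta> * x" using assms x by simp
  have "\<alpha> + \<beta> * x \<le> (\<alpha> + \<beta> / \<delta>) * (1 + \<delta> * x)"
    using assms \<delta> x by (simp add: field_simps)
  also have "\<dots> \<le> (\<alpha> + \<beta> / \<delta>) * exp (\<delta> * x)"
    using assms \<delta> by (intro mult_left_mono exp_ge_add_one_self) auto
  finally show "\<alpha> + \<beta> * x \<le> (\<alpha> + \<beta> / \<delta>) * exp (\<delta> * x)" .
qed

lemma subexponential_mult:
  assumes "subexponential f" "subexponential g"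
  shows "subexponential (\<lambda>x. f x * g x)"
  unfolding subexponential_def
proof (intro allI impI)
  fix \<delta> :: real assume "\<delta> > 0"
  then have \<delta>: "\<delta> / 2 > 0" by simp
  obtain C where C: "\<And>x. x \<ge> 0 \<Longrightarrow> 0 \<le> f x \<and> f x \<le> C * exp (\<delta> / 2 * x)"
    using assms(1) \<delta> unfolding subexponential_def by blast
  obtain D where D: "\<And>x. x \<ge> 0 \<Longrightarrow> 0 \<le> g x \<and> g x \<le> D * exp (\<delta> / 2 * x)"
    using assms(2) \<delta> unfolding subexponential_def by blast
  have "0 \<le> f x * g x \<and> f x * g x \<le> (C * D) * exp (\<delta> * x)" if x: "x \<ge> 0" for x
  proof -
    have "f x * g x \<le> (C * exp (\<delta> / 2 * x)) * (D * exp (\<delta> / 2 * x))"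
      using C[OF x] D[OF x] by (intro mult_mono) auto
    also have "\<dots> = C * D * (exp (\<delta> / 2 * x) * exp (\<delta> / 2 * x))" by (simp only: mult_ac)
    also have "exp (\<delta> / 2 * x) * exp (\<delta> / 2 * x) = exp (\<delta> * x)" by (simp add: exp_add[symmetric])
    finally show ?thesis using C[OF x] D[OF x] by simp
  qed
  then show "\<exists>C. \<forall>x\<ge>0. 0 \<le> f x * g x \<and> f x * g x \<le> C * exp (\<delta> * x)" by blast
qed

lemma subexponential_prod:
  assumes "finite I" "\<And>i. i \<in> I \<Longrightarrow> subexponential (f i)"
  shows "subexponential (\<lambda>x. \<Prod>i\<in>I. f i x)"
  using assms
proof (induction I rule: finite_induct)
  case empty
  show ?case using subexponential_linear[of 1 0] by simp
next
  case (insert i I)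
  then show ?case by (simp add: subexponential_mult)
qed

lemma subexponential_zero_block: "subexponential (zero_block M j)"
proof -
  have "subexponential (\<lambda>x. \<Prod>i<(2 ^ (j * (j - 1)) :: nat). 1 + 1 / (real M * 2 ^ (j * j)) * x)"
    by (intro subexponential_prod subexponential_linear) auto
  then show ?thesis by (simp add: zero_block_def[abs_def])
qed

text \<open>
  All factors are dominated by their values at \<open>\<bar>z\<bar>\<close>. Finitely many of them form a polynomial, and the
  others contribute at most \<open>exp (\<delta> \<bar>z\<bar> / 2)\<close> because the tail of the sum of reciprocal zeros is small.
\<close>

lemma minimal_type_product:
  fixes g :: "complex \<Rightarrow> complex"
  assumes M: "M \<ge> 1" and lim: "\<And>z. (\<lambda>n. \<Prod>j<n. zero_block M j z) \<longlonglongrightarrow> g z"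
    and \<delta>: "\<delta> > 0"
  shows "\<exists>C. \<forall>z. norm ((\<Prod>i<N. z + of_nat (1 + i)) * g z) \<le> C * exp (\<delta> * norm z)"
proof -
  obtain J where J: "(1 / 2 :: real) ^ J < \<delta> / 4"
    using real_arch_pow_inv[of "\<delta> / 4" "1 / 2"] \<delta> by auto
  define H where "H = (\<lambda>x. (\<Prod>i<N. real (1 + i) + 1 * x) * (\<Prod>j<J. zero_block M j x))"
  have "subexponential H"
    unfolding H_def
    by (intro subexponential_mult subexponential_prod subexponential_linear subexponential_zero_block) auto
  then obtain C where C: "\<And>x. x \<ge> 0 \<Longrightarrow> H x \<le> C * exp (\<delta> / 2 * x)"
    using \<delta> unfolding subexponential_def by (meson half_gt_zero)
  have "norm ((\<Prod>i<N. z + of_nat (1 + i)) * g z) \<le> C * exp (\<delta> * norm z)" for z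
  proof -
    define x where "x = norm z"
    have x: "x \<ge> 0" by (simp add: x_def)
    have H0: "H x \<ge> 0"
      unfolding H_def using x zero_block_ge_1[OF x, of M]
      by (intro mult_nonneg_nonneg prod_nonneg) (auto intro: order_trans[of 0 1])
    have "norm ((\<Prod>i<N. z + of_nat (1 + i)) * (\<Prod>j<n. zero_block M j z)) \<le> C * exp (\<delta> * x)"
      if n: "n \<ge> J" for n
    proof -
      have "norm ((\<Prod>i<N. z + of_nat (1 + i)) * (\<Prod>j<n. zero_block M j z))
          \<le> (\<Prod>i<N. real (1 + i) + 1 * x) * (\<Prod>j<n. zero_block M j x)"
        unfolding norm_mult prod_norm[symmetric] x_def
      proof (intro mult_mono prod_mono conjI norm_ge_zero norm_zero_block prod_nonneg)
        show "norm (z + of_nat (1 + i)) \<le> real (1 + i) + 1 * norm z" for i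
          using norm_triangle_ineq[of z "of_nat (1 + i)"] by (simp add: norm_of_nat del: of_nat_add of_nat_Suc)
      qed auto
      also have "(\<Prod>j<n. zero_block M j x) = (\<Prod>j<J. zero_block M j x) * (\<Prod>j=J..<n. zero_block M j x)"
        using n by (simp add: atLeast0LessThan[symmetric] prod.atLeastLessThan_concat)
      also have "(\<Prod>i<N. real (1 + i) + 1 * x) * \<dots> = H x * (\<Prod>j=J..<n. zero_block M j x)"
        by (simp only: H_def mult.assoc)
      also have "\<dots> \<le> H x * exp (\<delta> / 2 * x)"
      proof (intro mult_left_mono H0)
        have "(\<Prod>j=J..<n. zero_block M j x) \<le> (\<Prod>j=J..<n. exp (x * (1 / 2) ^ j))"
          using zero_block_ge_1[OF x, of M] zero_block_le_exp[OF x M]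
          by (intro prod_mono) (auto intro: order_trans[of 0 1])
        also have "\<dots> = exp (x * (\<Sum>j=J..<n. (1 / 2) ^ j))"
          by (simp add: exp_sum[symmetric] sum_distrib_left)
        also have "\<dots> \<le> exp (\<delta> / 2 * x)"
        proof -
          have "(\<Sum>j=J..<n. (1 / 2 :: real) ^ j) = 2 * (1 / 2) ^ J - 2 * (1 / 2) ^ n"
            using n by (induction rule: dec_induct) auto
          moreover have "(1 / 2 :: real) ^ n \<ge> 0" by simp
          ultimately have "(\<Sum>j=J..<n. (1 / 2 :: real) ^ j) \<le> \<delta> / 2" using J by linarith
          then have "x * (\<Sum>j=J..<n. (1 / 2 :: real) ^ j) \<le> x * (\<delta> / 2)" using x by (rule mult_left_mono)
          then show ?thesis by (simp add: mult.commute)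
        qed
        finally show "(\<Prod>j=J..<n. zero_block M j x) \<le> exp (\<delta> / 2 * x)" .
      qed
      also have "\<dots> \<le> (C * exp (\<delta> / 2 * x)) * exp (\<delta> / 2 * x)"
        using C[OF x] by (intro mult_right_mono) auto
      also have "\<dots> = C * exp (\<delta> * x)" by (simp add: mult.assoc exp_add[symmetric])
      finally show ?thesis .
    qed
    moreover have "(\<lambda>n. norm ((\<Prod>i<N. z + of_nat (1 + i)) * (\<Prod>j<n. zero_block M j z)))
        \<longlonglongrightarrow> norm ((\<Prod>i<N. z + of_nat (1 + i)) * g z)"
      by (intro tendsto_intros lim)
    ultimately show ?thesis unfolding x_def by (intro LIMSEQ_le_const2) auto
  qed
  then show ?thesis by blast
qed

section \<open>Infinite order and essential singularity from radial growth\<close>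

lemma log_plus_ge: "exp t \<le> m \<Longrightarrow> t \<le> log_plus m"
  unfolding log_plus_def by (smt (verit) exp_gt_zero ln_exp ln_le_cancel_iff max.coboundedI2)

lemma iterated_log_ratio_ge:
  assumes x: "x > 1" and m: "exp (x ^ p) \<le> m"
  shows "real p \<le> log_plus (log_plus m) / ln x"
proof -
  have "x ^ p \<le> log_plus m" by (rule log_plus_ge[OF m])
  moreover have "exp (real p * ln x) = x ^ p" using x by (simp add: exp_of_nat_mult)
  ultimately have "exp (real p * ln x) \<le> log_plus m" by simp
  then have "real p * ln x \<le> log_plus (log_plus m)" by (rule log_plus_ge)
  then show ?thesis using x by (simp add: pos_le_divide_eq)
qed

lemma infinite_disk_order:
  assumes cont: "continuous_on (- {1}) F"
    and growth: "\<And>p X. \<exists>x>X. norm (F (of_real (1 - 1 / x))) \<ge> exp (x ^ p)"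
  shows "disk_order F = \<infinity>"
proof (rule ccontr)
  assume "disk_order F \<noteq> \<infinity>"
  then obtain p :: nat where "disk_order F < ereal (real p)" using less_PInf_Ex_of_nat by blast
  then have "eventually (\<lambda>y. ereal (log_plus (log_plus (max_mod y F)) / ln (1 / (1 - y))) < ereal (real p)) (at_left 1)"
    unfolding disk_order_def by (rule Limsup_lessD)
  then obtain b where b: "b < 1"
    "\<And>y. b < y \<Longrightarrow> y < 1 \<Longrightarrow> log_plus (log_plus (max_mod y F)) / ln (1 / (1 - y)) < real p"
    unfolding eventually_at_left_field by auto
  obtain x where x: "x > max 2 (1 / (1 - b))" and grow: "norm (F (of_real (1 - 1 / x))) \<ge> exp (x ^ p)"
    using growth by blast
  define y where "y = 1 - 1 / x"
  have xb: "1 / (1 - b) < x" "x > 2" using x by auto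
  have y: "b < y" "0 \<le> y" "y < 1" "1 / (1 - y) = x" using xb b(1) by (auto simp: y_def field_simps)
  have "norm (F (of_real y)) \<le> max_mod y F"
    unfolding max_mod_def
  proof (rule cSUP_upper)
    show "of_real y \<in> sphere (0 :: complex) y" using y by simp
    have "sphere 0 y \<subseteq> - {1 :: complex}" using y by auto
    then have "compact ((\<lambda>z. norm (F z)) ` sphere 0 y)"
      by (intro compact_continuous_image continuous_intros continuous_on_subset[OF cont]) auto
    then show "bdd_above ((\<lambda>z. norm (F z)) ` sphere 0 y)" by (intro bounded_imp_bdd_above compact_imp_bounded)
  qed
  then have "real p \<le> log_plus (log_plus (max_mod y F)) / ln x"
    using grow xb by (intro iterated_log_ratio_ge) (auto simp: y_def)
  then show False using b(2)[OF y(1,3)] y(4) by simp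
qed

lemma infinite_order_at_1:
  assumes cont: "continuous_on (- {1}) F" and \<epsilon>: "\<epsilon> > 0"
    and growth: "\<And>p X. \<exists>x>X. norm (F (of_real (1 - 1 / x))) \<ge> exp (x ^ p)"
  shows "order_at_1 \<epsilon> F = \<infinity>"
proof (rule ccontr)
  assume "order_at_1 \<epsilon> F \<noteq> \<infinity>"
  then obtain p :: nat where "order_at_1 \<epsilon> F < ereal (real p)" using less_PInf_Ex_of_nat by blast
  then have "eventually (\<lambda>x. ereal (log_plus (log_plus (max_mod_at_1 \<epsilon> x F)) / ln x) < ereal (real p)) at_top"
    unfolding order_at_1_def by (rule Limsup_lessD)
  then obtain b where b: "\<And>x. b \<le> x \<Longrightarrow> log_plus (log_plus (max_mod_at_1 \<epsilon> x F)) / ln x < real p"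
    unfolding eventually_at_top_linorder by auto
  obtain x where x: "x > max b (max 2 (1 / \<epsilon>))" and grow: "norm (F (of_real (1 - 1 / x))) \<ge> exp (x ^ p)"
    using growth by blast
  have xb: "b \<le> x" "x > 2" "1 / \<epsilon> < x" using x by auto
  let ?A = "{z :: complex. 1 / x \<le> norm (z - 1) \<and> norm (z - 1) \<le> \<epsilon>}"
  have "norm (F (of_real (1 - 1 / x))) \<le> max_mod_at_1 \<epsilon> x F"
    unfolding max_mod_at_1_def
  proof (rule cSUP_upper)
    have "norm (complex_of_real (1 - 1 / x) - 1) = 1 / x"
      using xb by (simp add: norm_divide)
    moreover have "1 / x \<le> \<epsilon>" using xb \<epsilon> by (simp add: field_simps)
    ultimately show "of_real (1 - 1 / x) \<in> ?A" by simp
    have "?A = cball 1 \<epsilon> - ball 1 (1 / x)" by (auto simp: dist_norm norm_minus_commute)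
    then have "compact ?A" by (simp add: compact_diff)
    moreover have "?A \<subseteq> - {1}" using xb by auto
    ultimately have "compact ((\<lambda>z. norm (F z)) ` ?A)"
      by (intro compact_continuous_image continuous_intros continuous_on_subset[OF cont])
    then show "bdd_above ((\<lambda>z. norm (F z)) ` ?A)" by (intro bounded_imp_bdd_above compact_imp_bounded)
  qed
  then have "real p \<le> log_plus (log_plus (max_mod_at_1 \<epsilon> x F)) / ln x"
    using grow xb by (intro iterated_log_ratio_ge) auto
  then show False using b[OF xb(1)] by simp
qed

text \<open>
  At a removable singularity or a pole the function would be \<open>O(x^n)\<close> along \<open>1 - 1 / x\<close>.
\<close>

lemma essential_singularity_of_growth:
  assumes hol: "F holomorphic_on - {1}"
    and growth: "\<And>p X. \<exists>x>X. norm (F (of_real (1 - 1 / x))) \<ge> exp (x ^ p)"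
  shows "essential_singularity_at F 1"
  unfolding essential_singularity_at_def
proof
  have "F holomorphic_on ball 1 1 - {1}" using hol by (rule holomorphic_on_subset) auto
  then show "isolated_singularity_at F 1"
    by (intro isolated_singularity_at_holomorphic[of _ "ball 1 1"]) auto
  have approach: "filterlim (\<lambda>x. complex_of_real (1 - 1 / x)) (at 1) at_top"
    unfolding filterlim_at
  proof
    have "((\<lambda>x. 1 - 1 / x) \<longlongrightarrow> 1 - 0) (at_top :: real filter)"
      by (intro tendsto_intros tendsto_divide_0[OF tendsto_const] filterlim_at_top_imp_at_infinity filterlim_ident)
    from tendsto_of_real[OF this, where 'a = complex]
    show "((\<lambda>x. complex_of_real (1 - 1 / x)) \<longlongrightarrow> 1) at_top"
      by (simp only: diff_zero of_real_1)
    show "\<forall>\<^sub>F x in at_top. complex_of_real (1 - 1 / x) \<in> UNIV \<and> complex_of_real (1 - 1 / x) \<noteq> 1"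
      using eventually_gt_at_top[of 0] by eventually_elim (auto simp: complex_eq_iff)
  qed
  have no_polynomial_bound: False
    if "\<forall>\<^sub>F x in at_top. norm (F (of_real (1 - 1 / x))) \<le> C * x ^ n" for C :: real and n :: nat
  proof -
    have "((\<lambda>x :: real. C * (x ^ n / exp x)) \<longlongrightarrow> C * 0) at_top"
      by (intro tendsto_intros tendsto_power_div_exp_0)
    then have "\<forall>\<^sub>F x in at_top. C * (x ^ n / exp x) < 1" by (intro order_tendstoD(2)) auto
    then have "\<forall>\<^sub>F x in at_top. norm (F (of_real (1 - 1 / x))) < exp (x ^ 1)"
      using that
    proof eventually_elim
      case (elim x)
      then have "C * x ^ n < exp x" by (simp add: pos_divide_less_eq)
      then show ?case using elim by simp
    qed
    then obtain X where X: "\<forall>x\<ge>X. norm (F (of_real (1 - 1 / x))) < exp (x ^ 1)"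
      unfolding eventually_at_top_linorder by blast
    obtain x where "x > X" "norm (F (of_real (1 - 1 / x))) \<ge> exp (x ^ 1)" using growth by blast
    moreover from this have "norm (F (of_real (1 - 1 / x))) < exp (x ^ 1)" by (intro X[rule_format]) simp
    ultimately show False by linarith
  qed
  show "\<not> not_essential F 1"
  proof
    assume "not_essential F 1"
    then consider l where "(F \<longlongrightarrow> l) (at 1)" | "is_pole F 1" unfolding not_essential_def by blast
    then show False
    proof cases
      case 1
      then have "((\<lambda>z. norm (F z)) \<longlongrightarrow> norm l) (at 1)" by (rule tendsto_norm)
      then have "\<forall>\<^sub>F z in at 1. norm (F z) < norm l + 1" by (rule order_tendstoD) simp
      then have "\<forall>\<^sub>F x in at_top. norm (F (of_real (1 - 1 / x))) < norm l + 1"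
        using approach by (rule eventually_compose_filterlim)
      then have "\<forall>\<^sub>F x in at_top. norm (F (of_real (1 - 1 / x))) \<le> (norm l + 1) * x ^ 0"
        by eventually_elim simp
      then show False by (rule no_polynomial_bound)
    next
      case 2
      have "F holomorphic_on UNIV - {1}" using hol by (simp only: Compl_eq_Diff_UNIV)
      note pole = zorder_exist_pole[OF this open_UNIV UNIV_I 2]
      define h where "h = zor_poly F 1"
      define n where "n = nat (- zorder F 1)"
      obtain r where r: "r > 0" and h: "h holomorphic_on cball 1 r"
        and F: "\<forall>w\<in>cball 1 r - {1}. F w = h w / (w - 1) ^ n \<and> h w \<noteq> 0"
        using pole unfolding h_def n_def by blast
      have "compact (h ` cball 1 r)"
        by (intro compact_continuous_image holomorphic_on_imp_continuous_on h) auto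
      then have "bounded (h ` cball 1 r)" by (rule compact_imp_bounded)
      then obtain C where C: "\<forall>w\<in>cball 1 r. norm (h w) \<le> C"
        unfolding bounded_iff by blast
      have "\<forall>\<^sub>F x in at_top. norm (F (of_real (1 - 1 / x))) \<le> C * x ^ n"
        using eventually_gt_at_top[of "max 1 (1 / r)"]
      proof eventually_elim
        case (elim x)
        then have x: "x > 1" "1 / r < x" by auto
        define w where "w = complex_of_real (1 - 1 / x)"
        have nw: "norm (w - 1) = 1 / x" using x by (simp add: w_def norm_divide)
        have "1 / x \<le> r" using x r by (simp add: field_simps)
        then have w: "w \<in> cball 1 r" using nw by (simp add: dist_norm norm_minus_commute)
        have "w \<noteq> 1" using nw x by auto
        then have "norm (F w) = norm (h w) * x ^ n"
          using F w by (simp add: norm_divide norm_power nw power_one_over)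
        also have "\<dots> \<le> C * x ^ n" using C w x by (intro mult_right_mono) auto
        finally show ?case by (simp only: w_def)
      qed
      then show False by (rule no_polynomial_bound)
    qed
  qed
qed

section \<open>The function\<close>

text \<open>
  With \<open>k = M 2^(j\<^sup>2)\<close> and \<open>m = j\<^sup>2 - j\<close> the coefficient \<open>a k\<close> is at least \<open>2^(2^m)\<close>. The point \<open>y = 1 - 1 / x\<close>,
  \<open>x = 8 M 2^j\<close>, is so close to 1 that \<open>y^k \<ge> exp (- 2^m / 4)\<close>, which costs only part of this. As a function
  of \<open>j\<close>, any power of \<open>x\<close> has an exponent to base 2 that is linear in \<open>j\<close>, whereas \<open>m\<close> is quadratic.
\<close>

lemma growth_towards_1:
  fixes a :: "nat \<Rightarrow> real" and F :: "complex \<Rightarrow> complex"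
  assumes M: "M \<ge> 1"
    and a: "\<And>k. a k \<ge> 0" "\<And>j. a (M * 2 ^ (j * j)) \<ge> 2 ^ (2 ^ (j * (j - 1)))"
    and F: "\<And>z. norm z < 1 \<Longrightarrow> (\<lambda>k. of_real (a k) * z ^ k) sums F z"
  shows "\<exists>x>X. norm (F (of_real (1 - 1 / x))) \<ge> exp (x ^ p)"
proof -
  obtain q where q: "8 * real M \<le> 2 ^ q" using real_arch_pow[of 2 "8 * real M"] by (auto intro: less_imp_le)
  obtain s where s: "X < 2 ^ s" using real_arch_pow[of 2 X] by auto
  \<comment> \<open>Large enough for (q + j) * p + 2 \<le> j * (j - 1), where 8 * M \<le> 2 ^ q, and for x > X.\<close>
  define j where "j = p + q * p + 4 + s"
  define x where "x = 8 * real M * 2 ^ j"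
  define y where "y = 1 - 1 / x"
  define k where "k = M * 2 ^ (j * j)"
  define m where "m = j * (j - 1)"
  have x8: "8 * 2 ^ j \<le> x" using M by (simp add: x_def)
  have j1: "(1 :: real) \<le> 2 ^ j" by simp
  have x2: "x \<ge> 2" using x8 j1 by linarith
  have "X < x"
  proof -
    have "(2 :: real) ^ s \<le> 2 ^ j" by (intro power_increasing) (auto simp: j_def)
    then show ?thesis using s x8 j1 by linarith
  qed
  have jj: "j * j = m + j" unfolding m_def by (cases j) auto
  have y: "0 < y" "y < 1" using x2 by (auto simp: y_def field_simps)
  have "exp (- (2 ^ m / 4)) \<le> y ^ k"
  proof -
    have "- (1 / x) - 2 * (1 / x)\<^sup>2 \<le> ln y"
      unfolding y_def using x2 by (intro ln_one_minus_pos_lower_bound) (auto simp: field_simps)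
    moreover have "2 * (1 / x)\<^sup>2 \<le> 1 / x" using x2 by (simp add: power2_eq_square field_simps)
    ultimately have "- (2 / x) \<le> ln y" by simp
    then have "real k * (- (2 / x)) \<le> real k * ln y" by (intro mult_left_mono) auto
    moreover have "real k * (- (2 / x)) = - (2 ^ m / 4)"
      using M by (simp add: k_def x_def jj power_add field_simps)
    ultimately have "exp (- (2 ^ m / 4)) \<le> exp (real k * ln y)" by simp
    also have "\<dots> = y ^ k" using y by (simp add: exp_of_nat_mult)
    finally show ?thesis .
  qed
  moreover have "exp (2 ^ m / 2) \<le> a k"
  proof -
    have "(1 / 2 :: real) \<le> ln 2" using ln2_ge_two_thirds by simp
    then have "(2 :: real) ^ m * (1 / 2) \<le> 2 ^ m * ln 2" by (intro mult_left_mono) auto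
    then have "exp (2 ^ m / 2 :: real) \<le> exp (2 ^ m * ln 2)" by simp
    also have "\<dots> = exp (real (2 ^ m) * ln 2)" by simp
    also have "\<dots> = 2 ^ (2 ^ m)" by (subst exp_of_nat_mult) simp
    also have "\<dots> \<le> a k" unfolding k_def m_def by (rule a)
    finally show ?thesis .
  qed
  ultimately have "exp (2 ^ m / 2) * exp (- (2 ^ m / 4)) \<le> a k * y ^ k"
    using a(1)[of k] by (intro mult_mono) auto
  then have term_ge: "exp (2 ^ m / 4) \<le> a k * y ^ k" by (simp add: exp_add[symmetric])
  have "x ^ p \<le> 2 ^ m / 4"
  proof -
    have "x \<le> 2 ^ q * 2 ^ j" unfolding x_def using q by (intro mult_right_mono) auto
    also have "\<dots> = 2 ^ (q + j)" by (simp add: power_add)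
    finally have "x ^ p \<le> (2 ^ (q + j)) ^ p" using x2 by (intro power_mono) auto
    also have "\<dots> = 2 ^ ((q + j) * p)" by (simp add: power_mult)
    also have "\<dots> \<le> 2 ^ (m - 2)"
    proof (intro power_increasing)
      obtain i where i: "j = p + q * p + 4 + i" by (simp add: j_def)
      have "(q + j) * p + 2 \<le> j * (j - 1)"
        unfolding i by (simp add: algebra_simps)
      then show "(q + j) * p \<le> m - 2" by (simp add: m_def)
    qed simp
    also have "(2 :: real) ^ (m - 2) = 2 ^ m / 4"
    proof -
      have "j \<ge> 2" "j - 1 \<ge> 1" by (auto simp: j_def)
      then have "2 * 1 \<le> m" unfolding m_def by (intro mult_le_mono)
      then have "m = (m - 2) + 2" by simp
      then have "(2 :: real) ^ m = 2 ^ (m - 2) * 2 ^ 2" by (metis power_add)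
      then show ?thesis by simp
    qed
    finally show ?thesis .
  qed
  then have "exp (x ^ p) \<le> exp (2 ^ m / 4)" by simp
  also note term_ge
  also have "a k * y ^ k \<le> norm (F (of_real y))"
  proof -
    have "norm (complex_of_real y) < 1" using y by simp
    from F[OF this] have "(\<lambda>k. complex_of_real (a k * y ^ k)) sums F (of_real y)" by simp
    then have re: "(\<lambda>k. a k * y ^ k) sums Re (F (of_real y))" using sums_Re by fastforce
    have "a k * y ^ k = (\<Sum>i\<in>{k}. a i * y ^ i)" by simp
    also have "\<dots> \<le> (\<Sum>i. a i * y ^ i)"
      using a(1) y re by (intro sum_le_suminf) (auto dest: sums_summable)
    also have "\<dots> = Re (F (of_real y))" using re by (rule sums_unique[symmetric])
    also have "\<dots> \<le> norm (F (of_real y))" by (rule complex_Re_le_cmod)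
    finally show ?thesis .
  qed
  finally show ?thesis using \<open>X < x\<close> unfolding y_def by blast
qed

theorem theoremB:
  fixes r :: nat
  assumes "r \<ge> 2"
  shows "\<exists>\<Upsilon> :: complex \<Rightarrow> complex.
      \<Upsilon> analytic_on ball 0 1 \<and>
      PF_fun r \<Upsilon> \<and>
      disk_order \<Upsilon> = \<infinity> \<and>
      (\<exists>F :: complex \<Rightarrow> complex.
         (\<forall>z\<in>ball 0 1. F z = \<Upsilon> z) \<and>
         F analytic_on (- {1}) \<and>
         analytic_at_infinity F \<and>
         essential_singularity_at F 1 \<and>
         (\<forall>\<epsilon>>0. order_at_1 \<epsilon> F = \<infinity>))"
proof -
  obtain N \<sigma> where \<sigma>: "\<sigma> > 0" and PF: "\<forall>(B :: (nat \<times> nat) set) \<nu>. finite B \<longrightarrow> (\<forall>j\<in>B. \<nu> j > 0) \<longrightarrow>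
      (\<Sum>j\<in>B. 1 / \<nu> j) \<le> \<sigma> \<longrightarrow> PF_seq r (\<lambda>k. rising N k * (\<Prod>j\<in>B. 1 + real k / \<nu> j))"
    using PF_seq_rising_times_linear_factors[of r, where 'i = "nat \<times> nat"] by (elim exE conjE)
  \<comment> \<open>The reciprocals of the additional zeros sum up to at most 2 / M.\<close>
  define M where "M = nat \<lceil>2 / \<sigma>\<rceil> + 1"
  have M: "M \<ge> 1" by (simp add: M_def)
  have M\<sigma>: "2 / real M \<le> \<sigma>"
  proof -
    have "2 / \<sigma> \<le> real M" unfolding M_def by linarith
    then show ?thesis using \<sigma> M by (simp add: field_simps)
  qed
  obtain g :: "complex \<Rightarrow> complex"
    where g: "\<And>R. uniform_limit (cball 0 R) (\<lambda>n z. \<Prod>j<n. zero_block M j z) g sequentially"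
    using zero_blocks_converge[OF M] by blast
  have lim: "(\<lambda>n. \<Prod>j<n. zero_block M j z) \<longlonglongrightarrow> g z" for z
    using tendsto_uniform_limitI[OF g[of "norm z"], of z] by simp
  define \<phi> where "\<phi> = (\<lambda>z. (\<Prod>i<N. z + of_nat (1 + i)) * g z)"
  have "g holomorphic_on UNIV"
  proof (rule holomorphic_uniform_sequence[where f = "\<lambda>n z. \<Prod>j<n. zero_block M j z"])
    show "(\<lambda>z. \<Prod>j<n. zero_block M j z) holomorphic_on (UNIV :: complex set)" for n
      unfolding zero_block_def using M by (intro holomorphic_intros) auto
    fix x :: complex
    have "cball x 1 \<subseteq> cball 0 (norm x + 1)"
    proof
      fix y assume "y \<in> cball x 1"
      then have "norm y \<le> norm x + 1"
        using norm_triangle_ineq4[of x "x - y"] by (simp add: dist_norm)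
      then show "y \<in> cball 0 (norm x + 1)" by simp
    qed
    then have "uniform_limit (cball x 1) (\<lambda>n z. \<Prod>j<n. zero_block M j z) g sequentially"
      by (rule uniform_limit_on_subset[OF g])
    then show "\<exists>d>0. cball x d \<subseteq> UNIV \<and> uniform_limit (cball x d) (\<lambda>n z. \<Prod>j<n. zero_block M j z) g sequentially"
      by (intro exI[of _ 1]) simp
  qed simp
  then have hol\<phi>: "\<phi> holomorphic_on UNIV" unfolding \<phi>_def by (intro holomorphic_intros)
  obtain G where holG: "G holomorphic_on UNIV"
    and G: "\<And>z. norm z < 1 \<Longrightarrow> (\<lambda>k. \<phi> (of_nat k) * z ^ k) sums G (1 / (1 - z))"
    by (rule wigert_analytic_continuation[OF hol\<phi>]) (use minimal_type_product[OF M lim] in \<open>auto simp: \<phi>_def\<close>)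
  define F where "F = (\<lambda>z. G (1 / (1 - z)))"
  define a where "a = (\<lambda>k. Re (\<phi> (of_nat k)))"
  define b where "b = (\<lambda>n k. rising N k * (\<Prod>j<n. zero_block M j (real k)))"
  have b: "(\<lambda>n. complex_of_real (b n k)) \<longlonglongrightarrow> \<phi> (of_nat k)" for k
  proof -
    have "(\<Prod>j<n. zero_block M j (of_nat k)) = complex_of_real (\<Prod>j<n. zero_block M j (real k))" for n
      by (simp add: zero_block_of_real[symmetric])
    moreover have "(\<Prod>i<N. of_nat k + of_nat (1 + i)) = complex_of_real (rising N k)"
      by (simp add: rising_def add_ac)
    moreover have "(\<lambda>n. (\<Prod>i<N. of_nat k + of_nat (1 + i)) * (\<Prod>j<n. zero_block M j (of_nat k)))
        \<longlonglongrightarrow> \<phi> (of_nat k)"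
      unfolding \<phi>_def by (intro tendsto_intros lim)
    ultimately show ?thesis by (simp add: b_def)
  qed
  have ba: "(\<lambda>n. b n k) \<longlonglongrightarrow> a k" for k
    using tendsto_Re[OF b[of k]] by (simp add: a_def)
  have \<phi>a: "\<phi> (of_nat k) = of_real (a k)" for k
    using LIMSEQ_unique[OF b tendsto_of_real[OF ba]] .
  have F: "(\<lambda>k. of_real (a k) * z ^ k) sums F z" if "norm z < 1" for z
    using G[OF that] by (simp add: F_def \<phi>a)
  have PFa: "PF_seq r a"
  proof (rule PF_seq_limit[OF _ ba])
    fix n
    \<comment> \<open>The additional zeros of the first n blocks, listed with multiplicity.\<close>
    define B where "B = Sigma {..<n} (\<lambda>j. {..<(2 ^ (j * (j - 1)) :: nat)})"
    define \<nu> where "\<nu> = (\<lambda>(j, l :: nat). real M * 2 ^ (j * j))"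
    have "(\<Sum>p\<in>B. 1 / \<nu> p) \<le> \<sigma>"
    proof -
      have "(\<Sum>p\<in>B. 1 / \<nu> p) = (\<Sum>j<n. \<Sum>l<(2 ^ (j * (j - 1)) :: nat). 1 / (real M * 2 ^ (j * j)))"
        unfolding B_def \<nu>_def by (subst sum.Sigma) (auto simp: case_prod_unfold)
      also have "\<dots> = (\<Sum>j<n. 1 / real M * (2 ^ (j * (j - 1)) / 2 ^ (j * j)))"
        by simp
      also have "\<dots> = 1 / real M * (\<Sum>j<n. (1 / 2) ^ j)"
        by (simp only: block_density sum_distrib_left)
      also have "(\<Sum>j<n. (1 / 2 :: real) ^ j) \<le> 2"
        by (subst geometric_sum) auto
      finally show ?thesis using M\<sigma> M by (simp add: mult_left_mono divide_right_mono)
    qed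
    then have "PF_seq r (\<lambda>k. rising N k * (\<Prod>p\<in>B. 1 + real k / \<nu> p))"
      using M by (intro PF[rule_format]) (auto simp: B_def \<nu>_def)
    also have "(\<lambda>k. rising N k * (\<Prod>p\<in>B. 1 + real k / \<nu> p)) = b n"
    proof
      fix k
      have "(\<Prod>p\<in>B. 1 + real k / \<nu> p)
          = (\<Prod>j<n. \<Prod>l<(2 ^ (j * (j - 1)) :: nat). 1 + real k / (real M * 2 ^ (j * j)))"
        unfolding B_def \<nu>_def by (subst prod.Sigma) (auto simp: case_prod_unfold)
      then show "rising N k * (\<Prod>p\<in>B. 1 + real k / \<nu> p) = b n k"
        by (simp add: b_def zero_block_def)
    qed
    finally show "PF_seq r (b n)" .
  qed
  have rising1: "rising N k \<ge> 1" for k unfolding rising_def by (intro prod_ge_1) simp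
  have block1: "zero_block M j (real k) \<ge> 1" for j k by (rule zero_block_ge_1) simp
  have a0: "a k \<ge> 0" for k
    by (rule LIMSEQ_le_const[OF ba])
       (use rising1[of k] block1[of _ k] in \<open>auto simp: b_def intro!: mult_nonneg_nonneg prod_nonneg intro: order_trans[OF zero_le_one]\<close>)
  have a_large: "a (M * 2 ^ (j * j)) \<ge> 2 ^ (2 ^ (j * (j - 1)))" for j
  proof (rule LIMSEQ_le_const[OF ba], intro exI allI impI)
    fix n assume n: "Suc j \<le> n"
    define k where "k = M * 2 ^ (j * j)"
    have "2 ^ (2 ^ (j * (j - 1))) = zero_block M j (real k)"
      using M by (simp add: zero_block_def k_def)
    also have "\<dots> \<le> zero_block M j (real k) * (\<Prod>i\<in>{..<n} - {j}. zero_block M i (real k))"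
      using mult_left_mono[OF prod_ge_1[of "{..<n} - {j}" "\<lambda>i. zero_block M i (real k)"], of "zero_block M j (real k)"]
        block1[of _ k] order_trans[OF zero_le_one block1[of j k]] by simp
    also have "\<dots> = (\<Prod>i<n. zero_block M i (real k))"
      using n by (subst prod.remove[of "{..<n}" j]) auto
    also have "\<dots> \<le> rising N k * (\<Prod>i<n. zero_block M i (real k))"
      using mult_right_mono[OF rising1[of k], of "\<Prod>i<n. zero_block M i (real k)"]
        prod_nonneg[of "{..<n}" "\<lambda>i. zero_block M i (real k)"]
        order_trans[OF zero_le_one block1[of _ k]] by simp
    finally show "2 ^ (2 ^ (j * (j - 1))) \<le> b n (M * 2 ^ (j * j))" by (simp add: b_def k_def)
  qed
  have growth: "\<exists>x>X. norm (F (of_real (1 - 1 / x))) \<ge> exp (x ^ p)" for p X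
    by (rule growth_towards_1[OF M a0 a_large F])
  have holF: "F holomorphic_on - {1}"
    unfolding F_def by (rule holomorphic_on_compose_gen[OF _ holG, unfolded o_def])
      (auto intro!: holomorphic_intros)
  have contF: "continuous_on (- {1}) F" using holF by (rule holomorphic_on_imp_continuous_on)
  have anF: "F analytic_on - {1}" using holF by (simp add: analytic_on_open open_Compl)
  have inf: "analytic_at_infinity F"
    unfolding analytic_at_infinity_def
  proof (intro exI conjI)
    have "(\<lambda>w. G (w / (w - 1))) holomorphic_on ball 0 1"
      by (rule holomorphic_on_compose_gen[OF _ holG, unfolded o_def])
         (auto intro!: holomorphic_intros)
    then have "(\<lambda>w. G (w / (w - 1))) analytic_on ball 0 1" by (simp add: analytic_on_open)
    then show "(\<lambda>w. G (w / (w - 1))) analytic_on {0}" by (rule analytic_on_subset) simp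
    have "\<forall>\<^sub>F w in at 0. w \<noteq> (0 :: complex)" by (simp add: eventually_at_filter)
    then show "\<forall>\<^sub>F w in at 0. G (w / (w - 1)) = F (1 / w)"
    proof eventually_elim
      case (elim w)
      then have "1 / (1 - 1 / w) = w / (w - 1)" by (simp add: divide_simps)
      then show ?case by (simp add: F_def)
    qed
  qed
  show ?thesis
  proof (intro exI[of _ F] conjI ballI allI impI refl)
    show "F analytic_on ball 0 1" using anF by (rule analytic_on_subset) auto
    show "PF_fun r F" unfolding PF_fun_def using PFa F by (intro exI[of _ a]) auto
    show "disk_order F = \<infinity>" by (rule infinite_disk_order[OF contF growth])
    show "essential_singularity_at F 1" by (rule essential_singularity_of_growth[OF holF growth])
    show "order_at_1 \<epsilon> F = \<infinity>" if "\<epsilon> > 0" for \<epsilon> by (rule infinite_order_at_1[OF contF that growth])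
  qed (use anF inf in auto)
qed

end
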